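(* Let $K$ be an algebraically closed field of characteristic $0$ and let $d,e \geq 1$ be integers. The Segre-Veronese embedding of $\mathbb{P}^2 \times \mathbb{P}^1$ of degree $(d,e)$ is non-defective unless (1) $d=2$ and $e=2k$ is even, in which case the $(3k+1)$-st secant variety has codimension $3$ rather than the expected $2$ and the $(3k+2)$-nd secant variety has codimension $1$ rather than the expected $0$; or (2) $d=3$ and $e=1$, in which case the $5$-th secant variety has codimension $1$ rather than the expected $0$.
   Context: All varieties are over $K$. The Segre-Veronese embedding of $\mathbb{P}^2\times\mathbb{P}^1$ of degree $(d,e)$ is the map $\iota:\mathbb{P}^2\times\mathbb{P}^1 \to \mathbb{P}(V)$, $V=S^d(K^3)\otimes S^e(K^2)$, given by $([u],[v])\mapsto [u^d\otimes v^e]$. For an embedding $\iota:X\to\mathbb{P}(V)$ of a projective variety $X$ whose image spans $\mathbb{P}(V)$, and for an integer $k\ge 1$, the $k$-th (higher) secant variety $k\iota(X)$ is the closure in $\mathbb{P}(V)$ of the union of all subspaces of $\mathbb{P}(V)$ spanned by $k$ points on $\iota(X)$. The expected dimension of $k\iota(X)$ is $\min\{k(\dim X+1)-1,\ \dim V-1\}$ (always an upper bound for $\dim k\iota(X)$). $k\iota(X)$ is called non-defective if it has the expected dimension and defective otherwise. The embedding $\iota$ is called non-defective if $k\iota(X)$ is non-defective for all $k$, and defective otherwise. Codimensions are taken in $\mathbb{P}(V)$; the expected codimension is $\dim V-1$ minus the expected dimension. *)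

theory Defs
  imports
    "HOL-Analysis.Analysis"
    "HOL-Library.Poly_Mapping"
    "HOL-Computational_Algebra.Polynomial"
begin

section \<open>Projective spaces\<close>

text \<open>
  Points of \<open>P(V)\<close> are the lines through the origin of \<open>V\<close>, as subsets of \<open>V\<close>.
\<close>

definition (in vector_space) projectivization :: "'b set \<Rightarrow> 'b set set" where
  "projectivization V = (\<lambda>x. span {x}) ` (V - {0})"

section \<open>Free vector spaces and polynomials\<close>

text \<open>
  \<open>'i \<Rightarrow>\<^sub>0 'k\<close> serves as the vector space with basis \<open>'i\<close>. In particular
  \<open>('i \<Rightarrow>\<^sub>0 nat) \<Rightarrow>\<^sub>0 'k\<close> is the polynomial ring with one variable for each element of \<open>'i\<close>.
\<close>

definition pm_scale :: "'k::field \<Rightarrow> ('i \<Rightarrow>\<^sub>0 'k) \<Rightarrow> ('i \<Rightarrow>\<^sub>0 'k)" where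
  "pm_scale c p = Poly_Mapping.map ((*) c) p"

lemma lookup_pm_scale [simp]: "Poly_Mapping.lookup (pm_scale c p) i = c * Poly_Mapping.lookup p i"
  by (simp add: pm_scale_def Poly_Mapping.map.rep_eq when_def in_keys_iff)

global_interpretation pm: vector_space "pm_scale :: 'k::field \<Rightarrow> ('i \<Rightarrow>\<^sub>0 'k) \<Rightarrow> ('i \<Rightarrow>\<^sub>0 'k)"
  by unfold_locales (auto intro!: poly_mapping_eqI simp: lookup_add algebra_simps)

definition monom_degree :: "('i \<Rightarrow>\<^sub>0 nat) \<Rightarrow> nat" where
  "monom_degree m = (\<Sum>i\<in>Poly_Mapping.keys m. Poly_Mapping.lookup m i)"

definition forms :: "nat \<Rightarrow> (('i \<Rightarrow>\<^sub>0 nat) \<Rightarrow>\<^sub>0 'k::field) set" where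
  "forms n = {p. \<forall>m\<in>Poly_Mapping.keys p. monom_degree m = n}"

definition poly_eval :: "(('i \<Rightarrow>\<^sub>0 nat) \<Rightarrow>\<^sub>0 'k::field) \<Rightarrow> ('i \<Rightarrow>\<^sub>0 'k) \<Rightarrow> 'k" where
  "poly_eval F x = (\<Sum>m\<in>Poly_Mapping.keys F. Poly_Mapping.lookup F m * (\<Prod>i\<in>Poly_Mapping.keys m. Poly_Mapping.lookup x i ^ Poly_Mapping.lookup m i))"

section \<open>The Zariski topology and Krull dimension\<close>

text \<open>
  \<open>V\<close> is meant to be a finite-dimensional subspace, so that the restrictions to \<open>V\<close> of the
  polynomials in the coordinates of \<open>'i \<Rightarrow>\<^sub>0 'k\<close> are all polynomial functions on \<open>V\<close>.
  A form does not vanish at a point \<open>L\<close> iff it is nonzero at some vector of the line \<open>L\<close>.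
  The loci of nonvanishing of single forms are a base of the topology, so the closed sets are the
  common zero loci in \<open>P(V)\<close> of arbitrary sets of forms.
\<close>

definition zariski :: "('i \<Rightarrow>\<^sub>0 'k::field) set \<Rightarrow> ('i \<Rightarrow>\<^sub>0 'k) set topology" where
  "zariski V = topology_generated_by
     {{L \<in> pm.projectivization V. \<exists>x\<in>L. poly_eval F x \<noteq> 0} | F. \<exists>n. F \<in> forms n}"

lemma topspace_zariski:
  fixes V :: "('i \<Rightarrow>\<^sub>0 'k::field) set"
  shows "topspace (zariski V) = pm.projectivization V"
proof -
  have one: "(1 :: ('i \<Rightarrow>\<^sub>0 nat) \<Rightarrow>\<^sub>0 'k) \<in> forms 0"
    by (simp add: forms_def monom_degree_def)
  moreover have "poly_eval (1 :: ('i \<Rightarrow>\<^sub>0 nat) \<Rightarrow>\<^sub>0 'k) x = 1" for x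
    by (simp add: poly_eval_def lookup_one)
  moreover have "\<exists>x. x \<in> L" if "L \<in> pm.projectivization V" for L
    using that by (auto simp: pm.projectivization_def intro: pm.span_base)
  ultimately have "pm.projectivization V \<subseteq> {L \<in> pm.projectivization V.
      \<exists>x\<in>L. poly_eval (1 :: ('i \<Rightarrow>\<^sub>0 nat) \<Rightarrow>\<^sub>0 'k) x \<noteq> 0}"
    by auto
  with one show ?thesis
    unfolding zariski_def topology_generated_by_topspace by blast
qed

definition irreducible_space :: "'a topology \<Rightarrow> bool" where
  "irreducible_space T \<longleftrightarrow> topspace T \<noteq> {} \<and>
     (\<forall>A B. closedin T A \<and> closedin T B \<and> topspace T = A \<union> B \<longrightarrow> A = topspace T \<or> B = topspace T)"

definition krull_dim :: "'a topology \<Rightarrow> enat" where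
  "krull_dim T = Sup {enat n | n. \<exists>Z. (\<forall>i\<le>n. closedin T (Z i) \<and> irreducible_space (subtopology T (Z i)))
     \<and> (\<forall>i<n. Z i \<subset> Z (Suc i))}"

definition variety_dim :: "('i \<Rightarrow>\<^sub>0 'k::field) set \<Rightarrow> ('i \<Rightarrow>\<^sub>0 'k) set set \<Rightarrow> enat" where
  "variety_dim V Y = krull_dim (subtopology (zariski V) Y)"

definition variety_codim :: "('i \<Rightarrow>\<^sub>0 'k::field) set \<Rightarrow> ('i \<Rightarrow>\<^sub>0 'k) set set \<Rightarrow> enat" where
  "variety_codim V Y = enat (pm.dim V - 1) - variety_dim V Y"

section \<open>Secant varieties\<close>

text \<open>Below, \<open>X\<close> is the embedded variety, a subset of \<open>P(V)\<close>.\<close>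

definition secant_variety ::
    "('i \<Rightarrow>\<^sub>0 'k::field) set \<Rightarrow> ('i \<Rightarrow>\<^sub>0 'k) set set \<Rightarrow> nat \<Rightarrow> ('i \<Rightarrow>\<^sub>0 'k) set set" where
  "secant_variety V X k = zariski V closure_of
     (\<Union>S\<in>{S. S \<subseteq> X \<and> finite S \<and> card S = k}. pm.projectivization (pm.span (\<Union>S)))"

definition expected_secant_dim ::
    "('i \<Rightarrow>\<^sub>0 'k::field) set \<Rightarrow> ('i \<Rightarrow>\<^sub>0 'k) set set \<Rightarrow> nat \<Rightarrow> enat" where
  "expected_secant_dim V X k =
     min (enat k * (variety_dim V X + 1) - 1) (enat (pm.dim V - 1))"

definition expected_secant_codim ::
    "('i \<Rightarrow>\<^sub>0 'k::field) set \<Rightarrow> ('i \<Rightarrow>\<^sub>0 'k) set set \<Rightarrow> nat \<Rightarrow> enat" where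
  "expected_secant_codim V X k = enat (pm.dim V - 1) - expected_secant_dim V X k"

definition nondefective :: "('i \<Rightarrow>\<^sub>0 'k::field) set \<Rightarrow> ('i \<Rightarrow>\<^sub>0 'k) set set \<Rightarrow> bool" where
  "nondefective V X \<longleftrightarrow>
     (\<forall>k\<ge>1. variety_dim V (secant_variety V X k) = expected_secant_dim V X k)"

section \<open>The Segre-Veronese embedding\<close>

text \<open>
  \<open>S\<^sup>d(K\<^sup>n)\<close> is the degree \<open>d\<close> part of the polynomial ring whose variables are the standard
  basis vectors of \<open>K\<^sup>n\<close>; \<open>linear_form\<close> is the inclusion of \<open>K\<^sup>n\<close> as its degree 1 part, and
  \<open>u\<^sup>d\<close> is a power in this ring. The tensor product of the spaces with bases \<open>'a\<close> and \<open>'b\<close> is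
  the space with basis \<open>'a \<times> 'b\<close>.
\<close>

definition linear_form :: "'k::field ^ 'n \<Rightarrow> ('n \<Rightarrow>\<^sub>0 nat) \<Rightarrow>\<^sub>0 'k" where
  "linear_form u = (\<Sum>i\<in>UNIV. Poly_Mapping.single (Poly_Mapping.single i 1) (u $ i))"

definition tensor :: "('a \<Rightarrow>\<^sub>0 'k::field) \<Rightarrow> ('b \<Rightarrow>\<^sub>0 'k) \<Rightarrow> ('a \<times> 'b) \<Rightarrow>\<^sub>0 'k" where
  "tensor p q = (\<Sum>a\<in>Poly_Mapping.keys p. \<Sum>b\<in>Poly_Mapping.keys q. Poly_Mapping.single (a, b) (Poly_Mapping.lookup p a * Poly_Mapping.lookup q b))"

definition SV_space :: "nat \<Rightarrow> nat \<Rightarrow> ((('m \<Rightarrow>\<^sub>0 nat) \<times> ('n \<Rightarrow>\<^sub>0 nat)) \<Rightarrow>\<^sub>0 'k::field) set" where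
  "SV_space d e = pm.span {tensor p q | p q. p \<in> forms d \<and> q \<in> forms e}"

text \<open>
  A pair of points \<open>(L, M) = ([u], [v])\<close> goes to the line \<open>[u\<^sup>d \<otimes> v\<^sup>e]\<close>, which is spanned by
  the vectors \<open>u\<^sup>d \<otimes> v\<^sup>e\<close> for all representatives \<open>u \<in> L\<close> and \<open>v \<in> M\<close>; for chosen
  representatives see the lemma below.
\<close>

definition SV_map :: "nat \<Rightarrow> nat \<Rightarrow> ('k::field ^ 'm) set \<times> ('k ^ 'n) set
    \<Rightarrow> ((('m \<Rightarrow>\<^sub>0 nat) \<times> ('n \<Rightarrow>\<^sub>0 nat)) \<Rightarrow>\<^sub>0 'k) set" where
  "SV_map d e = (\<lambda>(L, M).
     pm.span {tensor (linear_form u ^ d) (linear_form v ^ e) | u v. u \<in> L \<and> v \<in> M})"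

lemma lookup_tensor: "Poly_Mapping.lookup (tensor p q) (a, b) = Poly_Mapping.lookup p a * Poly_Mapping.lookup q b"
proof -
  have "Poly_Mapping.lookup (tensor p q) (a, b) =
     (\<Sum>a'\<in>Poly_Mapping.keys p. \<Sum>b'\<in>Poly_Mapping.keys q. if a' = a \<and> b' = b then Poly_Mapping.lookup p a * Poly_Mapping.lookup q b else 0)"
    unfolding tensor_def lookup_sum by (intro sum.cong refl) (auto simp: lookup_single when_def)
  also have "\<dots> = (\<Sum>a'\<in>Poly_Mapping.keys p. if a' = a then Poly_Mapping.lookup p a * Poly_Mapping.lookup q b else 0)"
  proof (intro sum.cong refl)
    fix a'
    show "(\<Sum>b'\<in>Poly_Mapping.keys q. if a' = a \<and> b' = b then Poly_Mapping.lookup p a * Poly_Mapping.lookup q b else 0)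
       = (if a' = a then Poly_Mapping.lookup p a * Poly_Mapping.lookup q b else 0)"
      by (cases "a' = a") (auto simp: in_keys_iff)
  qed
  also have "\<dots> = Poly_Mapping.lookup p a * Poly_Mapping.lookup q b"
    by (auto simp: in_keys_iff)
  finally show ?thesis .
qed

lemma linear_form_scale: "linear_form (c *s u) = pm_scale c (linear_form u)"
  unfolding linear_form_def
  by (intro poly_mapping_eqI)
    (auto simp: lookup_sum lookup_single when_def sum_distrib_left intro!: sum.cong)

lemma pm_scale_eq_mult: "pm_scale c p = Poly_Mapping.single 0 c * p"
  by (intro poly_mapping_eqI) (simp add: pm_scale_def mult_map_scale_conv_mult)

lemma pm_scale_power:
  fixes p :: "('n \<Rightarrow>\<^sub>0 nat) \<Rightarrow>\<^sub>0 'k::field"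
  shows "pm_scale c p ^ d = pm_scale (c ^ d) (p ^ d)"
proof -
  have "Poly_Mapping.single 0 c ^ d = (Poly_Mapping.single 0 (c ^ d) :: ('n \<Rightarrow>\<^sub>0 nat) \<Rightarrow>\<^sub>0 'k)"
    by (induction d) (auto simp: mult_single)
  then show ?thesis by (simp add: pm_scale_eq_mult power_mult_distrib)
qed

lemma tensor_scale: "tensor (pm_scale a p) (pm_scale b q) = pm_scale (a * b) (tensor p q)"
  by (intro poly_mapping_eqI) (auto simp: lookup_tensor split_paired_all)

lemma SV_map_span:
  "SV_map d e (vec.span {u}, vec.span {v})
     = pm.span {tensor (linear_form u ^ d) (linear_form v ^ e)}"
proof -
  let ?t = "tensor (linear_form u ^ d) (linear_form v ^ e)"
  let ?A = "{tensor (linear_form u' ^ d) (linear_form v' ^ e) | u' v'.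
      u' \<in> vec.span {u} \<and> v' \<in> vec.span {v}}"
  have "?A \<subseteq> pm.span {?t}"
    by (auto simp: vec.span_singleton pm.span_singleton linear_form_scale pm_scale_power tensor_scale)
  moreover have "?t \<in> ?A"
    by (auto intro!: exI[of _ u] exI[of _ v] vec.span_base)
  ultimately have "pm.span ?A = pm.span {?t}"
    by (intro subset_antisym pm.span_minimal pm.span_mono) auto
  then show ?thesis by (simp add: SV_map_def)
qed

definition SV_variety :: "nat \<Rightarrow> nat
    \<Rightarrow> ((((3 \<Rightarrow>\<^sub>0 nat) \<times> (2 \<Rightarrow>\<^sub>0 nat)) \<Rightarrow>\<^sub>0 'k::field) set) set" where
  "SV_variety d e = SV_map d e `
     (vec.projectivization (UNIV :: ('k ^ 3) set) \<times> vec.projectivization (UNIV :: ('k ^ 2) set))"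

end

theory Submission
  imports Defs
begin

text \<open>
  In the affine chart where the last coordinates are 1, the point \<open>(a, b, c)\<close> of
  \<open>P\<^sup>2 \<times> P\<^sup>1\<close> goes to a vector whose coordinates are, up to positive integer factors, the
  monomials \<open>a\<^sup>x b\<^sup>y c\<^sup>z\<close> with \<open>(x, y, z)\<close> in the lattice prism \<open>A\<close> given by \<open>x + y \<le> d\<close> and
  \<open>z \<le> e\<close>. The cone over the \<open>k\<close>-th secant variety is therefore the closure of the image of the
  polynomial map \<open>chart_param\<close>, a sum of \<open>k\<close> multiples of such vectors. Its dimension is the generic
  rank of the Jacobian matrix. Where no variable is zero, multiplying the partial derivatives by their
  variables (Euler's identities, \<open>euler_chart_param\<close>) turns the Jacobian, up to non-zero factors in rows
  and columns, into the matrix with four rows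
  \<open>q\<^sup>\<alpha>, x q\<^sup>\<alpha>, y q\<^sup>\<alpha>, z q\<^sup>\<alpha>\<close> for each of the \<open>k\<close> points \<open>q\<close>, with columns indexed by
  \<open>\<alpha> = (x, y, z) \<in> A\<close>.

  Dimension means here the length of chains of irreducible closed sets, and its comparison with the
  rank is elementary in both directions. A chain of length \<open>n\<close> yields \<open>n + 1\<close> forms that satisfy no
  homogeneous polynomial relation on the image. If the rank is at most \<open>\<rho>\<close>, then all variables but
  \<open>\<rho>\<close> can be frozen without losing polynomial identities (\<open>rank_reduction\<close>), and \<open>\<rho> + 1\<close> polynomials
  in \<open>\<rho>\<close> variables always satisfy a relation, by counting (\<open>algebraic_dependence\<close>); this gives
  \<open>chain_length_less_rank\<close>. Conversely, at a point where the rank is maximal, the closures of the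
  images of slices with more and more free variables form a chain (\<open>krull_dim_ge_rank\<close>).

  Large rank is proved by degeneration. Call a set of lattice points separated by \<open>k\<close> points if the
  corresponding columns of the matrix are independent. If a plane cuts a set into two parts that are
  separated by \<open>k1\<close> and by \<open>k2\<close> points, then moving these points by two one-parameter groups of
  the torus makes the matrix block diagonal in the limit, so the whole set is separated by
  \<open>k1 + k2\<close> points (\<open>separable_cut\<close>). One point separates four affinely independent lattice points.
  Hence cutting \<open>A\<close> by planes into affinely independent cells of four points, and one smaller cell for
  the remainder, proves that no secant variety is defective (\<open>nondefective_if_tileable\<close>). Such
  cuttings are given explicitly for finitely many prisms, and the others are composed from them by
  adding strips of width 8 in the triangle and slabs of four layers in the third direction
  (\<open>tileable_triangle_prism\<close>).

  In the exceptional cases the rank drops because there are too many forms of bidegree \<open>(d, e)\<close>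
  that are singular at the given points. For \<open>(d, e) = (2, 2k)\<close> the forms of bidegree \<open>(1, k)\<close>
  have \<open>3k + 3\<close> coefficients, so a pencil spanned by \<open>f, g\<close> passes through \<open>3k + 1\<close> points, and
  \<open>f\<^sup>2, f g, g\<^sup>2\<close> are three independent forms singular there; through one more point there still
  passes one \<open>f\<close>, and \<open>f\<^sup>2\<close> is singular. For \<open>(d, e) = (3, 1)\<close> the product of a form of bidegree
  \<open>(2, 0)\<close> and one of bidegree \<open>(1, 1)\<close>, both passing through 5 points, is singular at them. Each such
  form annihilates the tangent spaces (\<open>form_functional_kills_tangents\<close>), and cutting a suitable
  subset of \<open>A\<close> shows that the dimension does not drop further.
\<close>

section \<open>Polynomial functions\<close>

text \<open>
  Polynomial functions in arbitrarily many variables. Only identities between their values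
  matter below, so functions replace polynomials; the field is infinite.
\<close>

inductive polyfun :: "(('p \<Rightarrow> 'k::field) \<Rightarrow> 'k) \<Rightarrow> bool" where
  const: "polyfun (\<lambda>x. c)"
| var: "polyfun (\<lambda>x. x i)"
| add: "polyfun f \<Longrightarrow> polyfun g \<Longrightarrow> polyfun (\<lambda>x. f x + g x)"
| mult: "polyfun f \<Longrightarrow> polyfun g \<Longrightarrow> polyfun (\<lambda>x. f x * g x)"

lemma polyfun_minus: "polyfun f \<Longrightarrow> polyfun g \<Longrightarrow> polyfun (\<lambda>x. f x - g x)"
  using polyfun.add[OF _ polyfun.mult[OF polyfun.const[of "-1"]], of f g] by simp

lemma polyfun_sum: "(\<And>i. i \<in> I \<Longrightarrow> polyfun (f i)) \<Longrightarrow> polyfun (\<lambda>x. \<Sum>i\<in>I. f i x)"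
  by (induction I rule: infinite_finite_induct) (auto intro: polyfun.intros)

lemma polyfun_prod: "(\<And>i. i \<in> I \<Longrightarrow> polyfun (f i)) \<Longrightarrow> polyfun (\<lambda>x. \<Prod>i\<in>I. f i x)"
  by (induction I rule: infinite_finite_induct) (auto intro: polyfun.intros)

lemma polyfun_power: "polyfun f \<Longrightarrow> polyfun (\<lambda>x. f x ^ n)"
  by (induction n) (auto intro: polyfun.intros)

lemma polyfun_comp:
  assumes "polyfun F" and "\<And>r. polyfun (\<lambda>x. \<phi> x r)"
  shows "polyfun (\<lambda>x. F (\<phi> x))"
  using assms(1) by induction (auto intro: polyfun.intros assms(2))

lemma polyfun_if: "(b \<Longrightarrow> polyfun f) \<Longrightarrow> (\<not> b \<Longrightarrow> polyfun g) \<Longrightarrow> polyfun (\<lambda>x. if b then f x else g x)"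
  by (cases b) auto

lemma polyfun_upd: "polyfun f \<Longrightarrow> polyfun (\<lambda>x. f (x(j := c)))"
  by (rule polyfun_comp[of f]) (auto simp: fun_upd_def intro: polyfun_if polyfun.intros)

lemmas polyfun_intros = polyfun.intros polyfun_minus polyfun_sum polyfun_prod polyfun_power polyfun_if

lemma polyfun_curve:
  assumes "polyfun f" and "\<And>i. \<exists>q. \<forall>s. X s i = poly q s"
  shows "\<exists>q. \<forall>s. f (X s) = poly q s"
  using assms(1)
proof induction
  case (const c) then show ?case by (intro exI[of _ "[:c:]"]) simp
next
  case (var i) then show ?case using assms(2) by blast
next
  case (add f g)
  then obtain q r where "\<forall>s. f (X s) = poly q s" "\<forall>s. g (X s) = poly r s" by blast
  then show ?case by (intro exI[of _ "q + r"]) simp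
next
  case (mult f g)
  then obtain q r where "\<forall>s. f (X s) = poly q s" "\<forall>s. g (X s) = poly r s" by blast
  then show ?case by (intro exI[of _ "q * r"]) simp
qed

lemma polyfun_line:
  assumes "polyfun f"
  shows "\<exists>q. \<forall>s. f (\<lambda>i. x i + s * w i) = poly q s"
proof -
  have "\<exists>q. \<forall>s. x i + s * w i = poly q s" for i
    by (intro exI[of _ "[:x i, w i:]"]) simp
  then show ?thesis using polyfun_curve[OF assms, where X="\<lambda>s i. x i + s * w i"] by blast
qed

lemma polyfun_coordinate_line:
  assumes "polyfun f"
  shows "\<exists>q. \<forall>s. f (x(i := a + s)) = poly q s"
proof -
  have "\<exists>q. \<forall>s. (x(i := a + s)) j = poly q s" for j
    by (cases "j = i") (auto intro: exI[of _ "[:a, 1:]"] exI[of _ "[:x j:]"])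
  then show ?thesis using polyfun_curve[OF assms, where X="\<lambda>s. x(i := a + s)"] by blast
qed

lemma poly_fun_zero:
  fixes q :: "'k::field_char_0 poly"
  shows "(\<And>s. s \<noteq> 0 \<Longrightarrow> poly q s = 0) \<Longrightarrow> q = 0"
proof (rule ccontr)
  assume a: "\<And>s. s \<noteq> 0 \<Longrightarrow> poly q s = 0" and q: "q \<noteq> 0"
  have "UNIV - {0} \<subseteq> {s. poly q s = 0}" using a by auto
  then have "finite (UNIV - {0::'k})" using poly_roots_finite[OF q] finite_subset by blast
  then show False using infinite_UNIV_char_0[where 'a='k] by simp
qed

text \<open>
  Restriction to the line through a non-zero of \<open>f\<close> and a non-zero of \<open>g\<close> reduces this to
  polynomials in one variable.
\<close>

lemma polyfun_domain:
  fixes f :: "('p \<Rightarrow> 'k::field_char_0) \<Rightarrow> 'k"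
  assumes "polyfun f" "polyfun g" and 0: "\<And>x. f x * g x = 0"
  shows "(\<forall>x. f x = 0) \<or> (\<forall>x. g x = 0)"
proof (rule ccontr)
  assume "\<not> ?thesis"
  then obtain x y where x: "f x \<noteq> 0" and y: "g y \<noteq> 0" by blast
  let ?l = "\<lambda>s i. x i + s * (y i - x i)"
  obtain q where q: "\<And>s. f (?l s) = poly q s"
    using polyfun_line[OF assms(1), of x "\<lambda>i. y i - x i"] by blast
  obtain r where r: "\<And>s. g (?l s) = poly r s"
    using polyfun_line[OF assms(2), of x "\<lambda>i. y i - x i"] by blast
  have "q * r = 0" by (rule poly_fun_zero) (simp flip: q r add: 0)
  then have "q = 0 \<or> r = 0" by simp
  moreover have "poly q 0 \<noteq> 0" using x by (simp flip: q)
  moreover have "poly r 1 \<noteq> 0" using y by (simp flip: r)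
  ultimately show False by auto
qed

section \<open>Partial derivatives\<close>

text \<open>
  The linear coefficient of the increment in direction \<open>i\<close>. It is purely algebraic and defined for
  all polynomial functions over a field of characteristic 0, where the restriction to a line
  determines its polynomial.
\<close>

definition pd :: "'p \<Rightarrow> (('p \<Rightarrow> 'k::field) \<Rightarrow> 'k) \<Rightarrow> ('p \<Rightarrow> 'k) \<Rightarrow> 'k" where
  "pd i f x = coeff (THE q. \<forall>s. f (x(i := x i + s)) = poly q s) 1"

lemma pd_eq:
  fixes f :: "('p \<Rightarrow> 'k::field_char_0) \<Rightarrow> 'k"
  assumes "\<And>s. f (x(i := x i + s)) = poly q s"
  shows "pd i f x = coeff q 1"
proof -
  have "(THE q. \<forall>s. f (x(i := x i + s)) = poly q s) = q"
  proof (rule the_equality)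
    fix r assume "\<forall>s. f (x(i := x i + s)) = poly r s"
    then have "r - q = 0" by (intro poly_fun_zero) (simp add: assms)
    then show "r = q" by simp
  qed (simp add: assms)
  then show ?thesis by (simp add: pd_def)
qed

lemma pd_const [simp]: "pd i (\<lambda>x. c) x = (0::'k::field_char_0)"
  by (subst pd_eq[where q="[:c:]"]) auto

lemma pd_var [simp]: "pd i (\<lambda>x. x j) x = (if i = j then 1 else (0::'k::field_char_0))"
  by (subst pd_eq[where q="if i = j then [:x j, 1:] else [:x j:]"]) auto

lemma pd_add [simp]:
  fixes f :: "('p \<Rightarrow> 'k::field_char_0) \<Rightarrow> 'k"
  assumes "polyfun f" "polyfun g"
  shows "pd i (\<lambda>x. f x + g x) x = pd i f x + pd i g x"
proof -
  obtain q where q: "\<And>s. f (x(i := x i + s)) = poly q s" using polyfun_coordinate_line[OF assms(1)] by blast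
  obtain r where r: "\<And>s. g (x(i := x i + s)) = poly r s" using polyfun_coordinate_line[OF assms(2)] by blast
  show ?thesis by (subst pd_eq[where q="q + r"]) (auto simp: q r pd_eq[OF q] pd_eq[OF r])
qed

lemma pd_mult [simp]:
  fixes f :: "('p \<Rightarrow> 'k::field_char_0) \<Rightarrow> 'k"
  assumes "polyfun f" "polyfun g"
  shows "pd i (\<lambda>x. f x * g x) x = pd i f x * g x + f x * pd i g x"
proof -
  obtain q where q: "\<And>s. f (x(i := x i + s)) = poly q s" using polyfun_coordinate_line[OF assms(1)] by blast
  obtain r where r: "\<And>s. g (x(i := x i + s)) = poly r s" using polyfun_coordinate_line[OF assms(2)] by blast
  have "f x = coeff q 0" "g x = coeff r 0" using q[of 0] r[of 0] by (simp_all add: poly_0_coeff_0)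
  then show ?thesis
    by (subst pd_eq[where q="q * r"]) (auto simp: q r pd_eq[OF q] pd_eq[OF r] coeff_mult)
qed

lemma polyfun_pd:
  fixes f :: "('p \<Rightarrow> 'k::field_char_0) \<Rightarrow> 'k"
  shows "polyfun f \<Longrightarrow> polyfun (pd i f)"
proof (induction rule: polyfun.induct)
  case (const c)
  have "pd i (\<lambda>x. c :: 'k) = (\<lambda>x. 0)" by (rule ext) simp
  then show ?case by (simp add: polyfun.const)
next
  case (var j)
  have "pd i (\<lambda>x. x j :: 'k) = (\<lambda>x. if i = j then 1 else 0)" by (rule ext) simp
  then show ?case by (simp add: polyfun.const)
next
  case (add f g)
  have "pd i (\<lambda>x. f x + g x) = (\<lambda>x. pd i f x + pd i g x)" by (rule ext) (simp add: add.hyps)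
  then show ?case using add by (simp add: polyfun.add)
next
  case (mult f g)
  have "pd i (\<lambda>x. f x * g x) = (\<lambda>x. pd i f x * g x + f x * pd i g x)" by (rule ext) (simp add: mult.hyps)
  then show ?case using mult by (auto intro!: polyfun.intros)
qed

lemma pd_upd_other: "i \<noteq> j \<Longrightarrow> pd i (\<lambda>x. f (x(j := p))) x = pd i f (x(j := p))"
  by (simp add: pd_def fun_upd_twist)

text \<open>
  By the chain rule: a vector in the kernel of the differential of \<open>\<phi>\<close> annihilates all
  polynomial expressions in \<open>\<phi>\<close>.
\<close>

lemma pd_chain_zero:
  fixes \<phi> :: "('p \<Rightarrow> 'k::field_char_0) \<Rightarrow> 'r \<Rightarrow> 'k"
  assumes F: "polyfun F" and \<phi>: "\<And>r. polyfun (\<lambda>x. \<phi> x r)"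
    and 0: "\<And>r. (\<Sum>i\<in>S. a i * pd i (\<lambda>x. \<phi> x r) x) = 0"
  shows "(\<Sum>i\<in>S. a i * pd i (\<lambda>x. F (\<phi> x)) x) = 0"
  using F
proof induction
  case (add f g)
  then show ?case
    by (simp add: pd_add[OF polyfun_comp polyfun_comp] \<phi> distrib_left sum.distrib)
next
  case (mult f g)
  have "(\<Sum>i\<in>S. a i * pd i (\<lambda>x. f (\<phi> x) * g (\<phi> x)) x)
     = (\<Sum>i\<in>S. a i * pd i (\<lambda>x. f (\<phi> x)) x) * g (\<phi> x) + f (\<phi> x) * (\<Sum>i\<in>S. a i * pd i (\<lambda>x. g (\<phi> x)) x)"
    by (simp add: pd_mult[OF polyfun_comp[OF mult.hyps(1) \<phi>] polyfun_comp[OF mult.hyps(2) \<phi>]]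
        sum_distrib_left sum_distrib_right sum.distrib[symmetric] algebra_simps)
  then show ?case using mult.IH by simp
qed (auto simp: 0)

section \<open>Freezing variables that do not affect the rank\<close>

lemma polyfun_factor:
  fixes G :: "('p \<Rightarrow> 'k::field) \<Rightarrow> 'k"
  assumes "polyfun G"
  shows "\<exists>H. polyfun H \<and> (\<forall>x. G x = G (x(j := p)) + (x j - p) * H x)"
  using assms
proof induction
  case (const c) show ?case by (rule exI[of _ "\<lambda>x. 0"]) (simp add: polyfun.const)
next
  case (var i)
  show ?case by (rule exI[of _ "\<lambda>x. if i = j then 1 else 0"]) (simp add: polyfun.const)
next
  case (add f g)
  then obtain A B where AB: "polyfun A" "polyfun B"
    and f: "\<And>x. f x = f (x(j := p)) + (x j - p) * A x" and g: "\<And>x. g x = g (x(j := p)) + (x j - p) * B x" by blast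
  show ?case
  proof (intro exI[of _ "\<lambda>x. A x + B x"] conjI allI)
    show "polyfun (\<lambda>x. A x + B x)" using AB by (rule polyfun.add)
    show "f x + g x = f (x(j := p)) + g (x(j := p)) + (x j - p) * (A x + B x)" for x
      by (subst f[of x], subst g[of x]) (simp add: algebra_simps)
  qed
next
  case (mult f g)
  then obtain A B where AB: "polyfun A" "polyfun B"
    and f: "\<And>x. f x = f (x(j := p)) + (x j - p) * A x" and g: "\<And>x. g x = g (x(j := p)) + (x j - p) * B x" by blast
  show ?case
  proof (intro exI[of _ "\<lambda>x. f (x(j:=p)) * B x + A x * g x"] conjI allI)
    show "polyfun (\<lambda>x. f (x(j:=p)) * B x + A x * g x)"
      using AB mult by (intro polyfun_intros polyfun_upd)
    fix x
    have "f x * g x = f (x(j := p)) * g x + (x j - p) * (A x * g x)"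
      by (subst f[of x]) (simp add: algebra_simps)
    also have "f (x(j := p)) * g x = f (x(j := p)) * g (x(j := p)) + (x j - p) * (f (x(j := p)) * B x)"
      by (subst g[of x]) (simp add: algebra_simps)
    finally show "f x * g x = f (x(j := p)) * g (x(j := p)) + (x j - p) * (f (x(j := p)) * B x + A x * g x)"
      by (simp add: algebra_simps)
  qed
qed

lemma pd_minus_const [simp]:
  fixes p :: "'k::field_char_0"
  shows "pd i (\<lambda>x. x j - p) x = (if i = j then 1 else 0)"
proof -
  have "pd i (\<lambda>x. x j - p) x = pd i (\<lambda>x. x j + (\<lambda>x. - p) x) x" by simp
  also have "\<dots> = pd i (\<lambda>x. x j) x + pd i (\<lambda>x. - p) x"
    by (rule pd_add) (rule polyfun.intros)+
  finally show ?thesis by simp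
qed

lemma pd_power_minus_const:
  fixes p :: "'k::field_char_0"
  shows "pd i (\<lambda>x. (x j - p) ^ n) x = (if i = j then of_nat n * (x j - p) ^ (n - 1) else 0)"
proof (induction n)
  case (Suc n)
  have "pd i (\<lambda>x. (x j - p) ^ Suc n) x = pd i (\<lambda>x. (x j - p) * (x j - p) ^ n) x" by simp
  also have "\<dots> = pd i (\<lambda>x. x j - p) x * (x j - p) ^ n + (x j - p) * pd i (\<lambda>x. (x j - p) ^ n) x"
    by (rule pd_mult) (intro polyfun_intros)+
  finally show ?case using Suc.IH by (cases n) (auto simp: algebra_simps)
qed simp

text \<open>
  The field \<open>a\<close> is tangent to the level sets of \<open>G\<close> and not everywhere tangent to the hyperplane
  \<open>x j = p\<close>. Heuristically, \<open>G\<close> is constant along the integral curves of \<open>a\<close>, which leave the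
  hyperplane in a generic point and sweep out an open set. Formally, if \<open>G = (x j - p)^s * H\<close> with \<open>s \<ge> 1\<close>,
  then comparing the lowest powers in the derivative of \<open>G\<close> along \<open>a\<close> gives \<open>s * a j * H = 0\<close> on
  the hyperplane, so \<open>H\<close> vanishes there too and \<open>G\<close> is divisible by arbitrarily high powers of
  \<open>x j - p\<close>.
\<close>

lemma polyfun_zero_if_flow_zero:
  fixes G :: "('p \<Rightarrow> 'k::field_char_0) \<Rightarrow> 'k"
  assumes S: "finite S" "j \<in> S" and a: "\<And>i. polyfun (a i)" and G: "polyfun G"
    and rel: "\<And>x. (\<Sum>i\<in>S. a i x * pd i G x) = 0"
    and x0: "a j x0 \<noteq> 0" "x0 j = p" and G0: "\<And>x. G (x(j := p)) = 0"
  shows "G x = 0"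
proof -
  have div: "\<exists>H. polyfun H \<and> (\<forall>x. G x = (x j - p) ^ Suc s * H x)" for s
  proof (induction s)
    case 0
    then show ?case using polyfun_factor[OF G, of j p] G0 by auto
  next
    case (Suc s)
    then obtain H where H: "polyfun H" and GH: "G = (\<lambda>x. (x j - p) ^ Suc s * H x)" by blast
    have P: "polyfun (\<lambda>x. (x j - p) ^ n)" for n by (intro polyfun_intros)
    have pdG: "pd i G x = (if i = j then of_nat (Suc s) * (x j - p) ^ s * H x else 0)
        + (x j - p) ^ Suc s * pd i H x" for i x
      unfolding GH by (subst pd_mult[OF P H], subst pd_power_minus_const) auto
    let ?R = "\<lambda>x. of_nat (Suc s) * (a j x * H x) + (x j - p) * (\<Sum>i\<in>S. a i x * pd i H x)"
    have "(x j - p) ^ s * ?R x = 0" for x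
    proof -
      have "0 = (\<Sum>i\<in>S. a i x * pd i G x)" by (simp add: rel)
      also have "\<dots> = (\<Sum>i\<in>S. (if i = j then a j x * (of_nat (Suc s) * (x j - p) ^ s * H x) else 0)
          + (x j - p) ^ Suc s * (a i x * pd i H x))"
        by (intro sum.cong refl) (simp add: pdG algebra_simps)
      also have "\<dots> = a j x * (of_nat (Suc s) * (x j - p) ^ s * H x)
          + (x j - p) ^ Suc s * (\<Sum>i\<in>S. a i x * pd i H x)"
        using S by (simp add: sum.distrib sum_distrib_left)
      also have "\<dots> = (x j - p) ^ s * ?R x" by (simp add: algebra_simps)
      finally show ?thesis by simp
    qed
    moreover have "polyfun ?R" by (intro polyfun_intros polyfun_pd a H)
    ultimately have "(\<forall>x. (x j - p) ^ s = 0) \<or> (\<forall>x. ?R x = 0)"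
      by (intro polyfun_domain[OF P])
    moreover have "\<not> (\<forall>x::'p \<Rightarrow> 'k. (x j - p) ^ s = 0)" by (auto intro: exI[of _ "\<lambda>i. p + 1"])
    ultimately have R: "?R x = 0" for x by blast
    have "a j (x(j := p)) * H (x(j := p)) = 0" for x
    proof -
      have "of_nat (Suc s) * (a j (x(j := p)) * H (x(j := p))) = (0::'k)" using R[of "x(j := p)"] by simp
      then show ?thesis using of_nat_eq_0_iff[where 'a='k, of "Suc s"] by (simp del: of_nat_Suc)
    qed
    moreover have "polyfun (\<lambda>x. a j (x(j := p)))" "polyfun (\<lambda>x. H (x(j := p)))"
      by (intro polyfun_upd a H)+
    moreover have "a j (x0(j := p)) \<noteq> 0" using x0 by auto
    ultimately have H0: "H (x(j := p)) = 0" for x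
      using polyfun_domain[of "\<lambda>x. a j (x(j := p))" "\<lambda>x. H (x(j := p))"] by blast
    obtain H' where H': "polyfun H'" "\<And>x. H x = H (x(j := p)) + (x j - p) * H' x"
      using polyfun_factor[OF H, of j p] by blast
    have "G x = (x j - p) ^ Suc (Suc s) * H' x" for x
    proof -
      have "H x = (x j - p) * H' x" using H'(2)[of x] H0 by simp
      then show ?thesis by (simp add: GH)
    qed
    then show ?case using H'(1) by blast
  qed
  (* The order of vanishing of \<open>G\<close> at \<open>x j = p\<close> along a line exceeds the degree \<open>degree q\<close>. *)
  obtain q where q: "\<And>s. G (x(j := p + s)) = poly q s" using polyfun_coordinate_line[OF G] by blast
  obtain H where H: "polyfun H" "\<And>x. G x = (x j - p) ^ Suc (degree q) * H x" using div by blast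
  obtain r where r: "\<And>s. H (x(j := p + s)) = poly r s" using polyfun_coordinate_line[OF H(1)] by blast
  have "q - monom 1 (Suc (degree q)) * r = 0"
    by (rule poly_fun_zero) (simp add: H(2)[of "x(j := p + _)"] poly_monom flip: q r)
  then have qr: "q = monom 1 (Suc (degree q)) * r" by simp
  have "r = 0"
  proof (rule ccontr)
    assume "r \<noteq> 0"
    then have "degree (monom 1 (Suc (degree q)) * r) = Suc (degree q) + degree r"
      by (subst degree_mult_eq) (auto simp: degree_monom_eq)
    with qr show False by simp
  qed
  then have "q = 0" using qr by simp
  then show ?thesis using q[of "x j - p"] by simp
qed

text \<open>
  Gaussian elimination without division: if the rows are dependent at every point, then there is a
  dependence with polynomial coefficients that holds identically. An entry \<open>P\<close> that is not
  identically zero serves as pivot.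
\<close>

lemma generic_dependence:
  fixes M :: "'i \<Rightarrow> 'r \<Rightarrow> ('p \<Rightarrow> 'k::field_char_0) \<Rightarrow> 'k"
  assumes "finite S" and "\<And>i r. polyfun (M i r)"
    and "\<And>x. \<exists>c. (\<exists>i\<in>S. c i \<noteq> 0) \<and> (\<forall>r. (\<Sum>i\<in>S. c i * M i r x) = 0)"
  shows "\<exists>a. (\<forall>i. polyfun (a i)) \<and> (\<exists>i\<in>S. \<exists>x. a i x \<noteq> 0) \<and> (\<forall>r x. (\<Sum>i\<in>S. a i x * M i r x) = 0)"
  using assms
proof (induction S arbitrary: M rule: finite_induct)
  case empty then show ?case by simp
next
  case (insert i0 S)
  show ?case
  proof (cases "\<forall>r x. M i0 r x = 0")
    case True
    have "(\<Sum>i\<in>insert i0 S. (if i = i0 then 1 else 0) * M i r x) = 0" for r x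
      using insert.hyps True by (auto intro!: sum.neutral)
    then show ?thesis
      by (intro exI[of _ "\<lambda>i x. if i = i0 then 1 else 0"]) (auto intro: polyfun.const)
  next
    case False
    then obtain r0 x0 where x0: "M i0 r0 x0 \<noteq> 0" by blast
    define P where "P = M i0 r0"
    (* The additional factor \<open>P x\<close> makes the eliminated matrix vanish where the pivot does, so that
       its rows are dependent at these points too. *)
    define M' where "M' i r x = P x * (P x * M i r x - M i r0 x * M i0 r x)" for i r x
    have polM': "polyfun (M' i r)" for i r
      unfolding M'_def P_def by (intro polyfun_intros insert.prems)
    have indep: "\<exists>i\<in>S. c i \<noteq> 0" if c: "\<exists>i\<in>insert i0 S. c i \<noteq> 0"
        "\<And>r. (\<Sum>i\<in>insert i0 S. c i * M i r x) = 0" and Px: "P x \<noteq> 0" for c x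
    proof (rule ccontr)
      assume n: "\<not> ?thesis"
      then have "(\<Sum>i\<in>S. c i * M i r0 x) = 0" by (intro sum.neutral) auto
      then have "c i0 = 0" using c(2)[of r0] Px insert.hyps by (simp add: P_def)
      with n c(1) show False by auto
    qed
    have "\<exists>c. (\<exists>i\<in>S. c i \<noteq> 0) \<and> (\<forall>r. (\<Sum>i\<in>S. c i * M' i r x) = 0)" for x
    proof (cases "P x = 0")
      case True
      have "S \<noteq> {}"
      proof -
        obtain c where "\<exists>i\<in>insert i0 S. c i \<noteq> 0" "\<And>r. (\<Sum>i\<in>insert i0 S. c i * M i r x0) = 0"
          using insert.prems(2)[of x0] by blast
        from indep[OF this] x0 show ?thesis by (auto simp: P_def)
      qed
      with True show ?thesis by (intro exI[of _ "\<lambda>i. 1"]) (auto simp: M'_def)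
    next
      case False
      obtain c where c: "\<exists>i\<in>insert i0 S. c i \<noteq> 0" "\<And>r. (\<Sum>i\<in>insert i0 S. c i * M i r x) = 0"
        using insert.prems(2)[of x] by blast
      have e: "(\<Sum>i\<in>S. c i * M i r x) = - (c i0 * M i0 r x)" for r
        using c(2)[of r] insert.hyps by (simp add: eq_neg_iff_add_eq_0 add.commute)
      have "(\<Sum>i\<in>S. c i * M' i r x) = P x * (P x * (\<Sum>i\<in>S. c i * M i r x) - (\<Sum>i\<in>S. c i * M i r0 x) * M i0 r x)" for r
        unfolding M'_def by (simp add: sum_distrib_left sum_distrib_right sum_subtractf algebra_simps)
      then have "(\<Sum>i\<in>S. c i * M' i r x) = 0" for r by (simp add: e P_def)
      then show ?thesis using indep[OF c False] by blast
    qed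
    from insert.IH[OF polM' this] obtain a where a: "\<And>i. polyfun (a i)" "\<exists>i\<in>S. \<exists>x. a i x \<noteq> 0"
      "\<And>r x. (\<Sum>i\<in>S. a i x * M' i r x) = 0" by blast
    define b where "b i x = (if i = i0 then - P x * (\<Sum>i\<in>S. a i x * M i r0 x) else P x * P x * a i x)" for i x
    have "polyfun (b i)" for i
    proof -
      have "polyfun (\<lambda>x. (0 - P x) * (\<Sum>i\<in>S. a i x * M i r0 x))" "polyfun (\<lambda>x. P x * P x * a i x)"
        unfolding P_def by (intro polyfun_intros insert.prems a)+
      then show ?thesis unfolding b_def by (cases "i = i0") simp_all
    qed
    moreover have "(\<Sum>i\<in>insert i0 S. b i x * M i r x) = 0" for r x
    proof -
      have "(\<Sum>i\<in>S. b i x * M i r x) = (\<Sum>i\<in>S. P x * P x * a i x * M i r x)"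
        using insert.hyps by (intro sum.cong) (auto simp: b_def)
      then have "(\<Sum>i\<in>insert i0 S. b i x * M i r x) = (\<Sum>i\<in>S. a i x * M' i r x)"
        using insert.hyps
        by (simp add: b_def M'_def sum_distrib_left sum_distrib_right sum_subtractf sum_negf algebra_simps)
      then show ?thesis by (simp add: a)
    qed
    moreover have "\<exists>i\<in>insert i0 S. \<exists>x. b i x \<noteq> 0"
    proof -
      obtain i x where i: "i \<in> S" "a i x \<noteq> 0" using a(2) by blast
      have "\<exists>x. P x * P x * a i x \<noteq> 0"
      proof (rule ccontr)
        assume "\<not> ?thesis"
        then have 0: "(P x * P x) * a i x = 0" for x by blast
        have PP: "polyfun (\<lambda>x. P x * P x)" unfolding P_def by (intro polyfun_intros insert.prems)
        from polyfun_domain[OF PP a(1) 0] have "(\<forall>x. P x * P x = 0) \<or> (\<forall>x. a i x = 0)" .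
        moreover have "P x0 * P x0 \<noteq> 0" using x0 by (simp add: P_def)
        ultimately show False using i(2) by blast
      qed
      then show ?thesis using i insert.hyps by (auto simp: b_def intro!: bexI[of _ i])
    qed
    ultimately show ?thesis by blast
  qed
qed

lemma underdetermined_system:
  fixes M :: "'i \<Rightarrow> 'r \<Rightarrow> 'k::field"
  assumes "finite R" "finite S" "card R < card S"
  shows "\<exists>c. (\<exists>i\<in>S. c i \<noteq> 0) \<and> (\<forall>r\<in>R. (\<Sum>i\<in>S. c i * M i r) = 0)"
  using assms
proof (induction R arbitrary: S M rule: finite_induct)
  case empty
  then have "S \<noteq> {}" by auto
  then show ?case by (intro exI[of _ "\<lambda>_. 1"]) auto
next
  case (insert r0 R)
  show ?case
  proof (cases "\<forall>i\<in>S. M i r0 = 0")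
    case True
    obtain c where "\<exists>i\<in>S. c i \<noteq> 0" "\<forall>r\<in>R. (\<Sum>i\<in>S. c i * M i r) = 0"
      using insert.IH[of S M] insert.prems insert.hyps by auto
    with True show ?thesis by (intro exI[of _ c]) (auto intro!: sum.neutral)
  next
    case False
    then obtain i0 where i0: "i0 \<in> S" "M i0 r0 \<noteq> 0" by blast
    have "card R < card (S - {i0})" using insert i0 by simp
    then obtain c where c: "\<exists>i\<in>S - {i0}. c i \<noteq> 0"
      "\<And>r. r \<in> R \<Longrightarrow> (\<Sum>i\<in>S - {i0}. c i * (M i r - M i r0 / M i0 r0 * M i0 r)) = 0"
      using insert.IH[of "S - {i0}" "\<lambda>i r. M i r - M i r0 / M i0 r0 * M i0 r"] insert.prems by auto
    define d where "d = c(i0 := - (\<Sum>i\<in>S - {i0}. c i * M i r0) / M i0 r0)"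
    have d: "(\<Sum>i\<in>S. d i * M i r) = (\<Sum>i\<in>S - {i0}. c i * (M i r - M i r0 / M i0 r0 * M i0 r))" for r
    proof -
      have "(\<Sum>i\<in>S. d i * M i r) = d i0 * M i0 r + (\<Sum>i\<in>S - {i0}. d i * M i r)"
        using i0 insert.prems by (intro sum.remove) auto
      also have "(\<Sum>i\<in>S - {i0}. d i * M i r) = (\<Sum>i\<in>S - {i0}. c i * M i r)"
        by (intro sum.cong) (auto simp: d_def)
      also have "d i0 * M i0 r = - (\<Sum>i\<in>S - {i0}. c i * (M i r0 / M i0 r0 * M i0 r))"
        by (simp add: d_def sum_distrib_right sum_divide_distrib sum_distrib_left mult_ac)
      finally show ?thesis by (simp add: sum_subtractf right_diff_distrib)
    qed
    have "(\<Sum>i\<in>S. d i * M i r) = 0" if "r \<in> insert r0 R" for r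
      using that c(2) i0 by (auto simp: d)
    moreover have "\<exists>i\<in>S. d i \<noteq> 0" using c(1) by (auto simp: d_def)
    ultimately show ?thesis by blast
  qed
qed

text \<open>
  If more than \<open>\<rho>\<close> variables remain, then by \<open>generic_dependence\<close> some non-zero polynomial vector
  field \<open>a\<close> annihilates all components of \<open>\<phi>\<close>, hence by the chain rule every polynomial in them.
  Some component \<open>a j\<close> is not zero at a point \<open>x0\<close>, and by \<open>polyfun_zero_if_flow_zero\<close> a polynomial
  in \<open>\<phi>\<close> is determined by its values on the hyperplane \<open>x j = x0 j\<close>. So \<open>x j\<close> can be frozen.
\<close>

lemma rank_reduction:
  fixes \<phi> :: "('p \<Rightarrow> 'k::field_char_0) \<Rightarrow> 'r \<Rightarrow> 'k"
  assumes "finite S" and "\<And>r. polyfun (\<lambda>x. \<phi> x r)"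
    and "\<And>x T. T \<subseteq> S \<Longrightarrow> card T > \<rho> \<Longrightarrow>
      \<exists>c. (\<exists>i\<in>T. c i \<noteq> 0) \<and> (\<forall>r. (\<Sum>i\<in>T. c i * pd i (\<lambda>x. \<phi> x r) x) = 0)"
  shows "\<exists>S' p. S' \<subseteq> S \<and> card S' \<le> \<rho> \<and>
    (\<forall>F. polyfun F \<longrightarrow> (\<forall>x. (\<forall>i\<in>S - S'. x i = p i) \<longrightarrow> F (\<phi> x) = 0) \<longrightarrow> (\<forall>x. F (\<phi> x) = 0))"
  using assms
proof (induction S arbitrary: \<phi> rule: finite_psubset_induct)
  case (psubset S)
  show ?case
  proof (cases "card S \<le> \<rho>")
    case True
    then show ?thesis by (intro exI[of _ S]) auto
  next
    case False
    have "\<And>x. \<exists>c. (\<exists>i\<in>S. c i \<noteq> 0) \<and> (\<forall>r. (\<Sum>i\<in>S. c i * pd i (\<lambda>x. \<phi> x r) x) = 0)"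
      using psubset.prems(2) False by auto
    from generic_dependence[OF psubset.hyps, where M="\<lambda>i r. pd i (\<lambda>x. \<phi> x r)", OF polyfun_pd[OF psubset.prems(1)] this]
    obtain a where a: "\<And>i. polyfun (a i)"
      "\<exists>i\<in>S. \<exists>x. a i x \<noteq> 0" "\<And>r x. (\<Sum>i\<in>S. a i x * pd i (\<lambda>x. \<phi> x r) x) = 0"
      by blast
    then obtain j x0 where j: "j \<in> S" "a j x0 \<noteq> 0" by blast
    define p0 where "p0 = x0 j"
    let ?\<phi> = "\<lambda>x. \<phi> (x(j := p0))"
    have "\<exists>S' p. S' \<subseteq> S - {j} \<and> card S' \<le> \<rho> \<and>
      (\<forall>F. polyfun F \<longrightarrow> (\<forall>x. (\<forall>i\<in>S - {j} - S'. x i = p i) \<longrightarrow> F (?\<phi> x) = 0) \<longrightarrow> (\<forall>x. F (?\<phi> x) = 0))"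
    proof (rule psubset.IH)
      show "S - {j} \<subset> S" using j by auto
      show "polyfun (\<lambda>x. \<phi> (x(j := p0)) r)" for r
        using polyfun_upd[of "\<lambda>x. \<phi> x r" j p0, OF psubset.prems(1)] .
      fix x T assume T: "T \<subseteq> S - {j}" "card T > \<rho>"
      then have "T \<subseteq> S" by auto
      note this T(2)
      then have "\<exists>c. (\<exists>i\<in>T. c i \<noteq> 0) \<and> (\<forall>r. (\<Sum>i\<in>T. c i * pd i (\<lambda>x. \<phi> x r) (x(j := p0))) = 0)"
        by (rule psubset.prems(2))
      then obtain c where c: "\<exists>i\<in>T. c i \<noteq> 0" "\<And>r. (\<Sum>i\<in>T. c i * pd i (\<lambda>x. \<phi> x r) (x(j := p0))) = 0"
        by blast
      have "pd i (\<lambda>x. \<phi> (x(j := p0)) r) x = pd i (\<lambda>x. \<phi> x r) (x(j := p0))" if "i \<in> T" for i r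
        using T that by (intro pd_upd_other) auto
      then have "(\<Sum>i\<in>T. c i * pd i (\<lambda>x. \<phi> (x(j := p0)) r) x) = 0" for r
        using c(2)[of r] by simp
      with c(1) show "\<exists>c. (\<exists>i\<in>T. c i \<noteq> 0) \<and> (\<forall>r. (\<Sum>i\<in>T. c i * pd i (\<lambda>x. \<phi> (x(j := p0)) r) x) = 0)"
        by blast
    qed
    then obtain S' p where S': "S' \<subseteq> S - {j}" "card S' \<le> \<rho>" and
      *: "\<And>F. polyfun F \<Longrightarrow> (\<And>x. (\<forall>i\<in>S - {j} - S'. x i = p i) \<Longrightarrow> F (?\<phi> x) = 0) \<Longrightarrow> (\<forall>x. F (?\<phi> x) = 0)"
      by blast
    have res: "F (\<phi> y) = 0" if F: "polyfun F"
      and 0: "\<forall>x. (\<forall>i\<in>S - S'. x i = (p(j := p0)) i) \<longrightarrow> F (\<phi> x) = 0" for F y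
    proof -
      have z: "\<forall>x. F (?\<phi> x) = 0"
        using 0 S' by (intro *[OF F]) auto
      show ?thesis
      proof (rule polyfun_zero_if_flow_zero[where G="\<lambda>x. F (\<phi> x)" and S=S and a=a and j=j and ?x0.0=x0 and p=p0])
        show "(\<Sum>i\<in>S. a i x * pd i (\<lambda>x. F (\<phi> x)) x) = 0" for x
          by (rule pd_chain_zero[OF F psubset.prems(1) a(3)])
        show "polyfun (\<lambda>x. F (\<phi> x))" by (rule polyfun_comp[OF F psubset.prems(1)])
        show "F (\<phi> (x(j := p0))) = 0" for x using z by blast
      qed (simp_all add: psubset.hyps j a(1) p0_def)
    qed
    show ?thesis
    proof (intro exI conjI allI impI)
      show "S' \<subseteq> S" "card S' \<le> \<rho>" using S' by auto
      fix F y
      assume "polyfun F" "\<forall>x. (\<forall>i\<in>S - S'. x i = (p(j := p0)) i) \<longrightarrow> F (\<phi> x) = 0"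
      then show "F (\<phi> y) = 0" by (rule res)
    qed
  qed
qed

section \<open>Algebraic dependence by counting\<close>

definition coord_degree_le :: "nat \<Rightarrow> (('p \<Rightarrow> 'k::field) \<Rightarrow> 'k) \<Rightarrow> bool" where
  "coord_degree_le D f \<longleftrightarrow> (\<forall>x i. \<exists>q. degree q \<le> D \<and> (\<forall>s. f (x(i := s)) = poly q s))"

lemma coord_degree_mono: "coord_degree_le D f \<Longrightarrow> D \<le> E \<Longrightarrow> coord_degree_le E f"
  unfolding coord_degree_le_def by (meson le_trans)

lemma coord_degree_const: "coord_degree_le 0 (\<lambda>x. c)"
  unfolding coord_degree_le_def by (intro allI exI[of _ "[:c:]"]) simp

lemma coord_degree_add:
  assumes "coord_degree_le D f" "coord_degree_le D g"
  shows "coord_degree_le D (\<lambda>x. f x + g x)"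
  unfolding coord_degree_le_def
proof (intro allI)
  fix x i
  obtain q r where "degree q \<le> D" "\<forall>s. f (x(i := s)) = poly q s" "degree r \<le> D" "\<forall>s. g (x(i := s)) = poly r s"
    using assms unfolding coord_degree_le_def by metis
  then show "\<exists>q. degree q \<le> D \<and> (\<forall>s. f (x(i := s)) + g (x(i := s)) = poly q s)"
    by (intro exI[of _ "q + r"]) (simp add: degree_add_le)
qed

lemma coord_degree_mult:
  assumes "coord_degree_le D f" "coord_degree_le E g"
  shows "coord_degree_le (D + E) (\<lambda>x. f x * g x)"
  unfolding coord_degree_le_def
proof (intro allI)
  fix x i
  obtain q r where "degree q \<le> D" "\<forall>s. f (x(i := s)) = poly q s" "degree r \<le> E" "\<forall>s. g (x(i := s)) = poly r s"
    using assms unfolding coord_degree_le_def by metis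
  then show "\<exists>q. degree q \<le> D + E \<and> (\<forall>s. f (x(i := s)) * g (x(i := s)) = poly q s)"
    by (intro exI[of _ "q * r"]) (auto intro: order.trans[OF degree_mult_le])
qed

lemma coord_degree_power:
  assumes "coord_degree_le D f"
  shows "coord_degree_le (n * D) (\<lambda>x. f x ^ n)"
proof (induction n)
  case 0 show ?case using coord_degree_const[of 1] by simp
next
  case (Suc n) show ?case using coord_degree_mult[OF assms Suc] by simp
qed

lemma coord_degree_prod:
  assumes "finite I" "\<And>i. i \<in> I \<Longrightarrow> coord_degree_le D (f i)"
  shows "coord_degree_le (card I * D) (\<lambda>x. \<Prod>i\<in>I. f i x)"
  using assms
proof (induction I rule: finite_induct)
  case empty show ?case using coord_degree_const[of 1] by simp
next
  case (insert i I)
  have "coord_degree_le D (f i)" "coord_degree_le (card I * D) (\<lambda>x. \<Prod>i\<in>I. f i x)"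
    using insert by simp_all
  from coord_degree_mult[OF this] show ?case using insert.hyps by simp
qed

lemma coord_degree_sum:
  assumes "\<And>i. i \<in> I \<Longrightarrow> coord_degree_le D (f i)"
  shows "coord_degree_le D (\<lambda>x. \<Sum>i\<in>I. f i x)"
proof (cases "finite I")
  case True
  from this assms show ?thesis
  proof (induction I rule: finite_induct)
    case empty show ?case using coord_degree_mono[OF coord_degree_const[of 0]] by simp
  next
    case (insert i I)
    have "coord_degree_le D (f i)" "coord_degree_le D (\<lambda>x. \<Sum>i\<in>I. f i x)"
      using insert by simp_all
    from coord_degree_add[OF this] show ?case using insert.hyps by simp
  qed
next
  case False
  then show ?thesis using coord_degree_mono[OF coord_degree_const[of 0]] by simp
qed

lemma coord_degree_var: "coord_degree_le 1 (\<lambda>x :: 'p \<Rightarrow> 'k::field. x j)"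
  unfolding coord_degree_le_def
proof (intro allI)
  fix x :: "'p \<Rightarrow> 'k" and i
  show "\<exists>q. degree q \<le> 1 \<and> (\<forall>s. (x(i := s)) j = poly q s)"
    by (cases "i = j") (auto intro: exI[of _ "[:0, 1:]"] exI[of _ "[:x j:]"])
qed

lemma polyfun_coord_degree: "polyfun f \<Longrightarrow> \<exists>D. coord_degree_le D f"
proof (induction rule: polyfun.induct)
  case (const c) show ?case by (rule exI, rule coord_degree_const)
next
  case (var j) show ?case by (rule exI, rule coord_degree_var)
next
  case (add f g)
  then obtain D E where "coord_degree_le D f" "coord_degree_le E g" by blast
  then have "coord_degree_le (max D E) f" "coord_degree_le (max D E) g"
    using coord_degree_mono[of D f "max D E"] coord_degree_mono[of E g "max D E"] by simp_all
  from coord_degree_add[OF this] show ?case by blast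
next
  case (mult f g)
  then obtain D E where "coord_degree_le D f" "coord_degree_le E g" by blast
  from coord_degree_mult[OF this] show ?case by blast
qed

text \<open>
  Variables outside \<open>S\<close> are fixed to \<open>p\<close>; the others are treated one at a time, each with more
  sample values than the degree.
\<close>

lemma zero_on_grid:
  fixes f :: "('p \<Rightarrow> 'k::field_char_0) \<Rightarrow> 'k"
  assumes "finite S" "coord_degree_le M f"
    and "\<And>x. (\<forall>i\<in>S. x i \<in> of_nat ` {..M}) \<Longrightarrow> (\<forall>i. i \<notin> S \<longrightarrow> x i = p i) \<Longrightarrow> f x = 0"
    and "\<forall>i. i \<notin> S \<longrightarrow> x i = p i"
  shows "f x = 0"
  using assms
proof (induction S arbitrary: p x rule: finite_induct)
  case empty then show ?case by simp
next
  case (insert i S)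
  obtain q where q: "degree q \<le> M" "\<And>s. f (x(i := s)) = poly q s"
    using insert.prems(1) unfolding coord_degree_le_def by blast
  have "poly q s = 0" if s: "s \<in> of_nat ` {..M}" for s
  proof -
    have "f (x(i := s)) = 0"
    proof (rule insert.IH[where p="p(i := s)"])
      fix y assume "\<forall>j\<in>S. y j \<in> of_nat ` {..M}" "\<forall>j. j \<notin> S \<longrightarrow> y j = (p(i := s)) j"
      then show "f y = 0" using s insert.hyps by (intro insert.prems(2)) auto
    qed (use insert in auto)
    then show ?thesis by (simp add: q)
  qed
  then have sub: "of_nat ` {..M} \<subseteq> {s. poly q s = 0}" by auto
  have "q = 0"
  proof (rule ccontr)
    assume "q \<noteq> 0"
    then have "card (of_nat ` {..M} :: 'k set) \<le> degree q"
      using card_mono[OF poly_roots_finite sub] card_poly_roots_bound[of q] by simp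
    moreover have "card (of_nat ` {..M} :: 'k set) = Suc M"
      by (subst card_image) (auto intro: inj_of_nat inj_on_subset)
    ultimately show False using q(1) by simp
  qed
  then show ?case using q(2)[of "x i"] by simp
qed

text \<open>
  An exponent vector with \<open>l\<close> entries less than \<open>m\<close> is encoded as the number \<open>N < m ^ l\<close> with
  these base \<open>m\<close> digits.
\<close>

definition digit :: "nat \<Rightarrow> nat \<Rightarrow> nat \<Rightarrow> nat" where
  "digit m i N = N div m ^ i mod m"

definition digit_sum :: "nat \<Rightarrow> nat \<Rightarrow> nat \<Rightarrow> nat" where
  "digit_sum m l N = (\<Sum>i<l. digit m i N)"

lemma digits_expansion: "N < m ^ l \<Longrightarrow> (\<Sum>i<l. digit m i N * m ^ i) = N"
proof -
  have "(\<Sum>i<l. digit m i N * m ^ i) = N mod m ^ l"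
  proof (induction l)
    case (Suc l)
    have "N mod m ^ Suc l = m ^ l * (N div m ^ l mod m) + N mod m ^ l"
      using mod_mult2_eq[of N "m ^ l" m] by (simp add: mult.commute)
    then show ?case using Suc by (simp add: digit_def mult.commute)
  qed simp
  then show "N < m ^ l \<Longrightarrow> ?thesis" by simp
qed

lemma digit_less: "m > 0 \<Longrightarrow> digit m i N < m"
  by (simp add: digit_def)

lemma digit_sum_le: "m > 0 \<Longrightarrow> digit_sum m l N \<le> l * m"
  unfolding digit_sum_def using sum_bounded_above[of "{..<l}" "\<lambda>i. digit m i N" m] digit_less
  by (simp add: less_imp_le)

text \<open>
  On a slice with \<open>card S\<close> free variables, \<open>l = card S + 1\<close> polynomials \<open>g i\<close> satisfy a relation,
  homogenized here by \<open>h\<close>. The \<open>m ^ l\<close> products in the sum have degree proportional to \<open>m\<close>, so a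
  combination of them that vanishes on a grid with about \<open>m ^ (l - 1)\<close> points vanishes on the slice,
  and for large \<open>m\<close> there are more products than grid points. With \<open>h = 1\<close> this is ordinary
  algebraic dependence.
\<close>

lemma algebraic_dependence:
  fixes h :: "('p \<Rightarrow> 'k::field_char_0) \<Rightarrow> 'k"
  assumes S: "finite S" and h: "polyfun h" and g: "\<And>i. polyfun (g i)"
  defines "l \<equiv> Suc (card S)"
  shows "\<exists>m c. m > 0 \<and> (\<exists>N<m ^ l. c N \<noteq> 0) \<and>
    (\<forall>x. (\<forall>i. i \<notin> S \<longrightarrow> x i = p i) \<longrightarrow>
      (\<Sum>N<m ^ l. c N * (h x ^ (l * m - digit_sum m l N) * (\<Prod>i<l. g i x ^ digit m i N))) = 0)"
proof -
  obtain Dh where Dh: "coord_degree_le Dh h" using polyfun_coord_degree[OF h] by blast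
  obtain Dg where Dg: "\<And>i. coord_degree_le (Dg i) (g i)" using polyfun_coord_degree[OF g] by metis
  define D where "D = Dh + (\<Sum>i<l. Dg i)"
  have Dh': "coord_degree_le D h" using Dh by (rule coord_degree_mono) (simp add: D_def)
  have Dg': "coord_degree_le D (g i)" if "i < l" for i
  proof (rule coord_degree_mono[OF Dg])
    show "Dg i \<le> D" using that member_le_sum[of i "{..<l}" Dg] by (simp add: D_def)
  qed
  (* The products have degree at most \<open>M\<close> in each variable, and a grid of side \<open>M + 1 \<le> C * m\<close>
     has at most \<open>(C * m) ^ card S < m ^ l\<close> points as soon as \<open>m > C ^ card S\<close>. *)
  define C where "C = 2 * l * D + 1"
  define m where "m = Suc (C ^ card S)"
  define M where "M = 2 * l * m * D"
  define t where "t N x = h x ^ (l * m - digit_sum m l N) * (\<Prod>i<l. g i x ^ digit m i N)" for N x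
  have tdeg: "coord_degree_le M (t N)" for N
  proof -
    have m: "m > 0" by (simp add: m_def)
    have 1: "coord_degree_le (l * m * D) (\<lambda>x. h x ^ (l * m - digit_sum m l N))"
      by (rule coord_degree_mono[OF coord_degree_power[OF Dh']]) simp
    have "coord_degree_le (card {..<l} * (m * D)) (\<lambda>x. \<Prod>i<l. g i x ^ digit m i N)"
    proof (rule coord_degree_prod)
      fix i assume "i \<in> {..<l}"
      then show "coord_degree_le (m * D) (\<lambda>x. g i x ^ digit m i N)"
        using digit_less[OF m, of i N] coord_degree_mono[OF coord_degree_power[OF Dg'], of i "digit m i N" "m * D"]
        by (simp add: less_imp_le)
    qed simp
    from coord_degree_mult[OF 1 this]
    have "coord_degree_le (l * m * D + card {..<l} * (m * D)) (t N)" unfolding t_def .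
    then show ?thesis by (rule coord_degree_mono) (simp add: M_def)
  qed
  define Gr where "Gr = (S \<rightarrow>\<^sub>E (of_nat ` {..M} :: 'k set))"
  have "card Gr = Suc M ^ card S"
    unfolding Gr_def using S by (subst card_PiE) (auto simp: card_image inj_on_def)
  also have "\<dots> \<le> (C * m) ^ card S"
  proof (intro power_mono)
    have "m > 0" by (simp add: m_def)
    then show "Suc M \<le> C * m" by (simp add: M_def C_def algebra_simps)
  qed simp
  also have "\<dots> < m * m ^ card S"
    by (simp add: power_mult_distrib) (simp add: m_def)
  finally have "card Gr < card {..<m ^ l}" by (simp add: l_def)
  moreover have "finite Gr" unfolding Gr_def using S by (intro finite_PiE) auto
  ultimately obtain c where c: "\<exists>N\<in>{..<m ^ l}. c N \<noteq> 0"
    "\<And>y. y \<in> Gr \<Longrightarrow> (\<Sum>N<m ^ l. c N * t N (\<lambda>i. if i \<in> S then y i else p i)) = 0"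
    using underdetermined_system[of Gr "{..<m ^ l}" "\<lambda>N y. t N (\<lambda>i. if i \<in> S then y i else p i)"] by auto
  have "(\<Sum>N<m ^ l. c N * t N x) = 0" if x: "\<forall>i. i \<notin> S \<longrightarrow> x i = p i" for x
  proof (rule zero_on_grid[OF S _ _ x])
    show "coord_degree_le M (\<lambda>x. \<Sum>N<m ^ l. c N * t N x)"
    proof (rule coord_degree_sum)
      show "coord_degree_le M (\<lambda>x. c N * t N x)" for N
        using coord_degree_mult[OF coord_degree_const tdeg, of "c N" N] by simp
    qed
    fix y :: "'p \<Rightarrow> 'k" assume y: "\<forall>i\<in>S. y i \<in> of_nat ` {..M}" "\<forall>i. i \<notin> S \<longrightarrow> y i = p i"
    have "restrict y S \<in> Gr" using y by (auto simp: Gr_def)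
    moreover have "(\<lambda>i. if i \<in> S then restrict y S i else p i) = y" using y by auto
    ultimately show "(\<Sum>N<m ^ l. c N * t N y) = 0" using c(2)[of "restrict y S"] by simp
  qed
  moreover have "m > 0" by (simp add: m_def)
  ultimately show ?thesis using c(1) unfolding t_def by (intro exI[of _ m] exI[of _ c]) auto
qed

text \<open>
  The homogeneous part of degree \<open>a\<close> of the polynomial in \<open>l\<close> variables whose coefficients are
  \<open>c N\<close>, with exponents the digits of \<open>N\<close>.
\<close>

definition digit_poly :: "nat \<Rightarrow> nat \<Rightarrow> (nat \<Rightarrow> 'k::field) \<Rightarrow> nat \<Rightarrow> (nat \<Rightarrow> 'k) \<Rightarrow> 'k" where
  "digit_poly m l c a y = (\<Sum>N | N < m ^ l \<and> digit_sum m l N = a. c N * (\<Prod>i<l. y i ^ digit m i N))"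

lemma sum_by_digit_sum:
  assumes "m > 0"
  shows "(\<Sum>N<m ^ l. f N) = (\<Sum>a\<le>l * m. \<Sum>N | N < m ^ l \<and> digit_sum m l N = a. f N)"
  using sum.group[of "{..<m ^ l}" "{..l * m}" "digit_sum m l" f] digit_sum_le[OF assms]
  by (simp add: image_subset_iff)

text \<open>
  By Kronecker substitution: for \<open>y i = s ^ (m ^ i)\<close> the monomial with exponents the digits of \<open>N\<close>
  becomes \<open>s ^ N\<close>, so no two monomials cancel.
\<close>

lemma digit_poly_nonzero:
  fixes c :: "nat \<Rightarrow> 'k::field_char_0"
  assumes "m > 0" "N < m ^ l" "c N \<noteq> 0"
  shows "\<exists>a\<le>l * m. \<exists>y. digit_poly m l c a y \<noteq> 0"
proof (rule ccontr)
  assume "\<not> ?thesis"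
  then have z: "digit_poly m l c a y = 0" if "a \<le> l * m" for a y using that by blast
  define q where "q = (\<Sum>N<m ^ l. monom (c N) N)"
  have "poly q s = 0" for s
  proof -
    have "poly q s = (\<Sum>N<m ^ l. c N * (\<Prod>i<l. (s ^ (m ^ i)) ^ digit m i N))"
      unfolding q_def poly_sum
    proof (intro sum.cong refl)
      fix N assume "N \<in> {..<m ^ l}"
      then have "(\<Sum>i<l. m ^ i * digit m i N) = N" using digits_expansion[of N m l] by (simp add: mult.commute)
      then show "poly (monom (c N) N) s = c N * (\<Prod>i<l. (s ^ (m ^ i)) ^ digit m i N)"
        by (simp add: poly_monom flip: power_mult power_sum)
    qed
    also have "\<dots> = (\<Sum>a\<le>l * m. digit_poly m l c a (\<lambda>i. s ^ (m ^ i)))"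
      by (subst sum_by_digit_sum[OF assms(1)]) (simp add: digit_poly_def)
    also have "\<dots> = 0" by (intro sum.neutral) (auto simp: z)
    finally show ?thesis .
  qed
  then have "q = 0" by (intro poly_fun_zero)
  moreover have "coeff q N = c N" using assms(2) by (simp add: q_def coeff_sum)
  ultimately show False using assms(3) by simp
qed

section \<open>Forms and the Zariski topology\<close>

definition eval_monom :: "('i \<Rightarrow>\<^sub>0 'k::field) \<Rightarrow> ('i \<Rightarrow>\<^sub>0 nat) \<Rightarrow> 'k" where
  "eval_monom x m = (\<Prod>i\<in>Poly_Mapping.keys m. Poly_Mapping.lookup x i ^ Poly_Mapping.lookup m i)"

lemma eval_monom_superset:
  assumes "finite A" "Poly_Mapping.keys m \<subseteq> A"
  shows "eval_monom x m = (\<Prod>i\<in>A. Poly_Mapping.lookup x i ^ Poly_Mapping.lookup m i)"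
  unfolding eval_monom_def using assms by (intro prod.mono_neutral_left) (auto simp: in_keys_iff)

lemma eval_monom_add: "eval_monom x (m + m') = eval_monom x m * eval_monom x m'"
proof -
  let ?A = "Poly_Mapping.keys m \<union> Poly_Mapping.keys m'"
  have "Poly_Mapping.keys (m + m') \<subseteq> ?A" by (rule keys_add)
  then show ?thesis
    by (subst (1 2 3) eval_monom_superset[of ?A])
      (auto simp: lookup_add power_add prod.distrib)
qed

lemma poly_eval_superset:
  assumes "finite A" "Poly_Mapping.keys F \<subseteq> A"
  shows "poly_eval F x = (\<Sum>m\<in>A. Poly_Mapping.lookup F m * eval_monom x m)"
  unfolding poly_eval_def eval_monom_def[symmetric] using assms
  by (intro sum.mono_neutral_left) (auto simp: in_keys_iff)

lemma poly_eval_add: "poly_eval (F + G) x = poly_eval F x + poly_eval G x"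
proof -
  let ?A = "Poly_Mapping.keys F \<union> Poly_Mapping.keys G"
  have "Poly_Mapping.keys (F + G) \<subseteq> ?A" by (rule keys_add)
  then show ?thesis
    by (subst (1 2 3) poly_eval_superset[of ?A])
      (auto simp: lookup_add distrib_right sum.distrib)
qed

lemma poly_eval_zero [simp]: "poly_eval 0 x = 0"
  by (simp add: poly_eval_def)

lemma poly_eval_sum: "poly_eval (\<Sum>i\<in>I. F i) x = (\<Sum>i\<in>I. poly_eval (F i) x)"
  by (induction I rule: infinite_finite_induct) (auto simp: poly_eval_add)

lemma poly_eval_single: "poly_eval (Poly_Mapping.single m c) x = c * eval_monom x m"
  by (subst poly_eval_superset[of "{m}"]) auto

lemma poly_mapping_expand: "F = (\<Sum>m\<in>Poly_Mapping.keys F. Poly_Mapping.single m (Poly_Mapping.lookup F m))"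
proof (rule poly_mapping_eqI)
  fix k
  have "Poly_Mapping.lookup (\<Sum>m\<in>Poly_Mapping.keys F. Poly_Mapping.single m (Poly_Mapping.lookup F m)) k
      = (\<Sum>m\<in>Poly_Mapping.keys F. if m = k then Poly_Mapping.lookup F m else 0)"
    unfolding lookup_sum by (intro sum.cong refl) (simp add: lookup_single when_def)
  then show "Poly_Mapping.lookup F k = Poly_Mapping.lookup (\<Sum>m\<in>Poly_Mapping.keys F. Poly_Mapping.single m (Poly_Mapping.lookup F m)) k"
    by (simp add: in_keys_iff)
qed

lemma poly_eval_mult: "poly_eval (F * G) x = poly_eval F x * poly_eval G x"
proof -
  let ?F = "\<lambda>m. Poly_Mapping.lookup F m" and ?G = "\<lambda>m. Poly_Mapping.lookup G m"
  have "F * G = (\<Sum>m\<in>Poly_Mapping.keys F. Poly_Mapping.single m (?F m)) * (\<Sum>m\<in>Poly_Mapping.keys G. Poly_Mapping.single m (?G m))"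
    using poly_mapping_expand[of F] poly_mapping_expand[of G] by simp
  also have "\<dots> = (\<Sum>m\<in>Poly_Mapping.keys F. \<Sum>m'\<in>Poly_Mapping.keys G. Poly_Mapping.single (m + m') (?F m * ?G m'))"
    by (simp add: sum_product mult_single)
  finally have "poly_eval (F * G) x = (\<Sum>m\<in>Poly_Mapping.keys F. \<Sum>m'\<in>Poly_Mapping.keys G. ?F m * ?G m' * (eval_monom x m * eval_monom x m'))"
    by (simp add: poly_eval_sum poly_eval_single eval_monom_add)
  also have "\<dots> = (\<Sum>m\<in>Poly_Mapping.keys F. ?F m * eval_monom x m) * (\<Sum>m'\<in>Poly_Mapping.keys G. ?G m' * eval_monom x m')"
    by (simp add: sum_product mult_ac)
  finally show ?thesis by (simp add: poly_eval_superset[OF finite_keys subset_refl])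
qed

definition is_form :: "nat \<Rightarrow> (('i \<Rightarrow>\<^sub>0 'k::field) \<Rightarrow> 'k) \<Rightarrow> bool" where
  "is_form n f \<longleftrightarrow> (\<exists>F\<in>forms n. f = poly_eval F)"

lemma is_form_zero: "is_form n (\<lambda>x. 0)"
  unfolding is_form_def by (intro bexI[of _ 0]) (auto simp: forms_def)

lemma is_form_const: "is_form 0 (\<lambda>x. c)"
  unfolding is_form_def
  by (intro bexI[of _ "Poly_Mapping.single 0 c"] ext)
    (auto simp: forms_def monom_degree_def poly_eval_single eval_monom_def)

lemma is_form_coord: "is_form 1 (\<lambda>x. Poly_Mapping.lookup x r)"
  unfolding is_form_def
  by (intro bexI[of _ "Poly_Mapping.single (Poly_Mapping.single r 1) 1"] ext)
    (auto simp: forms_def monom_degree_def poly_eval_single eval_monom_def)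

lemma is_form_add: "is_form n f \<Longrightarrow> is_form n g \<Longrightarrow> is_form n (\<lambda>x. f x + g x)"
proof -
  assume "is_form n f" "is_form n g"
  then obtain F G where FG: "F \<in> forms n" "G \<in> forms n" "f = poly_eval F" "g = poly_eval G"
    unfolding is_form_def by blast
  then have "F + G \<in> forms n" using keys_add[of F G] by (auto simp: forms_def)
  then show ?thesis unfolding is_form_def using FG by (intro bexI[of _ "F + G"] ext) (auto simp: poly_eval_add)
qed

lemma monom_degree_add: "monom_degree (m + m') = monom_degree m + monom_degree m'"
proof -
  let ?A = "Poly_Mapping.keys m \<union> Poly_Mapping.keys m'"
  have *: "monom_degree q = (\<Sum>i\<in>?A. Poly_Mapping.lookup q i)" if "Poly_Mapping.keys q \<subseteq> ?A" for q :: "'a \<Rightarrow>\<^sub>0 nat"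
    unfolding monom_degree_def using that by (intro sum.mono_neutral_left) (auto simp: in_keys_iff)
  show ?thesis using keys_add[of m m'] by (simp add: * lookup_add sum.distrib)
qed

lemma is_form_mult: "is_form n f \<Longrightarrow> is_form m g \<Longrightarrow> is_form (n + m) (\<lambda>x. f x * g x)"
proof -
  assume "is_form n f" "is_form m g"
  then obtain F G where FG: "F \<in> forms n" "G \<in> forms m" "f = poly_eval F" "g = poly_eval G"
    unfolding is_form_def by blast
  then have "F * G \<in> forms (n + m)" using keys_mult[of F G] by (fastforce simp: forms_def monom_degree_add)
  then show ?thesis unfolding is_form_def using FG by (intro bexI[of _ "F * G"] ext) (auto simp: poly_eval_mult)
qed

lemma is_form_cmult: "is_form n f \<Longrightarrow> is_form n (\<lambda>x. c * f x)"
  using is_form_mult[OF is_form_const] by fastforce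

lemma is_form_power: "is_form n f \<Longrightarrow> is_form (k * n) (\<lambda>x. f x ^ k)"
proof (induction k)
  case 0 show ?case using is_form_const[of 1] by simp
next
  case (Suc k) then show ?case using is_form_mult[of n f "k * n" "\<lambda>x. f x ^ k"] by simp
qed

lemma is_form_sum:
  assumes "\<And>i. i \<in> I \<Longrightarrow> is_form n (f i)"
  shows "is_form n (\<lambda>x. \<Sum>i\<in>I. f i x)"
proof (cases "finite I")
  case True
  from this assms show ?thesis
  proof (induction I rule: finite_induct)
    case empty show ?case using is_form_zero by simp
  next
    case (insert i I) then show ?case using is_form_add[of n "f i" "\<lambda>x. \<Sum>i\<in>I. f i x"] by simp
  qed
qed (use is_form_zero in simp)

lemma is_form_prod:
  assumes "finite I" "\<And>i. i \<in> I \<Longrightarrow> is_form (n i) (f i)"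
  shows "is_form (\<Sum>i\<in>I. n i) (\<lambda>x. \<Prod>i\<in>I. f i x)"
  using assms
proof (induction I rule: finite_induct)
  case empty show ?case using is_form_const[of 1] by simp
next
  case (insert i I) then show ?case using is_form_mult[of "n i" "f i" "\<Sum>i\<in>I. n i" "\<lambda>x. \<Prod>i\<in>I. f i x"] by simp
qed

lemma eval_monom_scale: "eval_monom (pm_scale c x) m = c ^ monom_degree m * eval_monom x m"
  by (simp add: eval_monom_def monom_degree_def power_mult_distrib prod.distrib power_sum)

lemma is_form_scale: "is_form n f \<Longrightarrow> f (pm_scale c x) = c ^ n * f x"
  unfolding is_form_def
  by (auto simp: poly_eval_superset[OF finite_keys subset_refl] eval_monom_scale forms_def sum_distrib_left mult_ac
      intro!: sum.cong)

lemma is_form_polyfun: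
  assumes "is_form n f"
  shows "\<exists>P. polyfun P \<and> (\<forall>x. f x = P (Poly_Mapping.lookup x))"
proof -
  obtain F where F: "f = poly_eval F" using assms unfolding is_form_def by blast
  show ?thesis unfolding F poly_eval_def
    by (intro exI[of _ "\<lambda>v. \<Sum>m\<in>Poly_Mapping.keys F. Poly_Mapping.lookup F m * (\<Prod>i\<in>Poly_Mapping.keys m. v i ^ Poly_Mapping.lookup m i)"]
        conjI polyfun_intros allI refl)
qed

lemma is_form_comp_polyfun:
  assumes "is_form n f" and "\<And>r. polyfun (\<lambda>x. Poly_Mapping.lookup (\<phi> x) r)"
  shows "polyfun (\<lambda>x. f (\<phi> x))"
proof -
  obtain P where P: "polyfun P" "\<And>x. f x = P (Poly_Mapping.lookup x)" using is_form_polyfun[OF assms(1)] by blast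
  show ?thesis unfolding P(2)
    using polyfun_comp[OF P(1), of "\<lambda>x. Poly_Mapping.lookup (\<phi> x)"] assms(2) by simp
qed

definition vanishes :: "(('i \<Rightarrow>\<^sub>0 'k::field) \<Rightarrow> 'k) \<Rightarrow> ('i \<Rightarrow>\<^sub>0 'k) set \<Rightarrow> bool" where
  "vanishes f L \<longleftrightarrow> (\<forall>x\<in>L. f x = 0)"

lemma vanishes_span: "is_form n f \<Longrightarrow> vanishes f (pm.span {x}) \<longleftrightarrow> f x = 0"
  by (auto simp: vanishes_def pm.span_singleton is_form_scale)

lemma projectivization_iff: "L \<in> pm.projectivization V \<longleftrightarrow> (\<exists>x\<in>V. x \<noteq> 0 \<and> L = pm.span {x})"
  by (auto simp: pm.projectivization_def)

lemma vanishes_mult: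
  assumes "is_form n f" "is_form m g" "L \<in> pm.projectivization V"
  shows "vanishes (\<lambda>x. f x * g x) L \<longleftrightarrow> vanishes f L \<or> vanishes g L"
  using assms(3) vanishes_span[OF is_form_mult[OF assms(1,2)]] vanishes_span[OF assms(1)] vanishes_span[OF assms(2)]
  by (auto simp: projectivization_iff)

lemma vanishes_power:
  assumes "is_form n f" "L \<in> pm.projectivization V" "k > 0"
  shows "vanishes (\<lambda>x. f x ^ k) L \<longleftrightarrow> vanishes f L"
  using assms by (auto simp: vanishes_def)

lemma openin_nonvanishing:
  assumes "is_form n f"
  shows "openin (zariski V) {L \<in> pm.projectivization V. \<not> vanishes f L}"
proof -
  obtain F where F: "F \<in> forms n" "f = poly_eval F" using assms unfolding is_form_def by blast
  then have "{L \<in> pm.projectivization V. \<not> vanishes f L} = {L \<in> pm.projectivization V. \<exists>x\<in>L. poly_eval F x \<noteq> 0}"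
    by (auto simp: vanishes_def)
  with F show ?thesis unfolding zariski_def by (intro topology_generated_by_Basis) blast
qed

lemma closedin_vanishing:
  assumes "is_form n f"
  shows "closedin (zariski V) {L \<in> pm.projectivization V. vanishes f L}"
proof -
  have "{L \<in> pm.projectivization V. vanishes f L} = topspace (zariski V) - {L \<in> pm.projectivization V. \<not> vanishes f L}"
    by (auto simp: topspace_zariski)
  then show ?thesis using closedin_diff[OF closedin_topspace openin_nonvanishing[OF assms, of V]] by simp
qed

text \<open>
  The generating open sets are closed under finite intersections because forms can be multiplied,
  so they form a base.
\<close>

lemma openin_zariski_base:
  assumes "openin (zariski V) U" "L \<in> U"
  shows "\<exists>n f. is_form n f \<and> \<not> vanishes f L \<and> (\<forall>L'\<in>pm.projectivization V. \<not> vanishes f L' \<longrightarrow> L' \<in> U)"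
proof -
  have U: "U \<subseteq> pm.projectivization V" using openin_subset[OF assms(1)] by (simp add: topspace_zariski)
  have "generate_topology_on {{L \<in> pm.projectivization V. \<exists>x\<in>L. poly_eval F x \<noteq> 0} | F. \<exists>n. F \<in> forms n} U"
    using assms(1) unfolding zariski_def by (rule openin_topology_generated_by)
  then show ?thesis using assms(2) U
  proof (induction arbitrary: L)
    case Empty then show ?case by simp
  next
    case (Int a b)
    have L: "L \<in> pm.projectivization V" using Int.prems by blast
    have "a' \<subseteq> pm.projectivization V"
      if "generate_topology_on {{L \<in> pm.projectivization V. \<exists>x\<in>L. poly_eval F x \<noteq> 0} | F. \<exists>n. F \<in> forms n} a'" for a'
    proof -
      have "openin (zariski V) a'" using that by (simp add: zariski_def openin_topology_generated_by_iff)
      then show ?thesis using openin_subset topspace_zariski by metis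
    qed
    then have sub: "a \<subseteq> pm.projectivization V" "b \<subseteq> pm.projectivization V" using Int.hyps by blast+
    obtain n f where f: "is_form n f" "\<not> vanishes f L" "\<forall>L'\<in>pm.projectivization V. \<not> vanishes f L' \<longrightarrow> L' \<in> a"
      using Int.IH(1)[of L] Int.prems sub by blast
    obtain m g where g: "is_form m g" "\<not> vanishes g L" "\<forall>L'\<in>pm.projectivization V. \<not> vanishes g L' \<longrightarrow> L' \<in> b"
      using Int.IH(2)[of L] Int.prems sub by blast
    show ?case
      using is_form_mult[OF f(1) g(1)] vanishes_mult[OF f(1) g(1)] f g L
      by (intro exI[of _ "n + m"] exI[of _ "\<lambda>x. f x * g x"]) blast
  next
    case (UN K)
    then obtain k where k: "k \<in> K" "L \<in> k" by blast
    then have "k \<subseteq> pm.projectivization V" using UN.prems by blast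
    then show ?case using UN.IH[OF k] k(1) by blast
  next
    case (Basis s)
    then obtain F n where F: "F \<in> forms n" "s = {L \<in> pm.projectivization V. \<exists>x\<in>L. poly_eval F x \<noteq> 0}" by blast
    then show ?case using Basis.prems
      by (intro exI[of _ n] exI[of _ "poly_eval F"]) (auto simp: is_form_def vanishes_def)
  qed
qed

lemma closedin_separating_form:
  assumes "closedin (zariski V) A" "L \<in> pm.projectivization V" "L \<notin> A"
  shows "\<exists>n f. is_form n f \<and> (\<forall>L'\<in>A. vanishes f L') \<and> \<not> vanishes f L"
proof -
  have o: "openin (zariski V) (pm.projectivization V - A)"
    using assms(1) by (simp add: closedin_def topspace_zariski)
  have A: "A \<subseteq> pm.projectivization V" using closedin_subset[OF assms(1)] by (simp add: topspace_zariski)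
  show ?thesis using openin_zariski_base[OF o, of L] assms(2,3) A by blast
qed

text \<open>
  This and the next lemma say that the forms vanishing on \<open>Z\<close> make up a prime ideal iff \<open>Z\<close> is
  irreducible.
\<close>

lemma irreducible_form_product:
  assumes "irreducible_space (subtopology (zariski V) Z)" "Z \<subseteq> pm.projectivization V"
    and "is_form n f" "is_form m g" "\<And>L. L \<in> Z \<Longrightarrow> vanishes (\<lambda>x. f x * g x) L"
  shows "(\<forall>L\<in>Z. vanishes f L) \<or> (\<forall>L\<in>Z. vanishes g L)"
proof -
  have top: "topspace (subtopology (zariski V) Z) = Z"
    using assms(2) by (auto simp: topspace_zariski)
  let ?A = "\<lambda>f. {L \<in> pm.projectivization V. vanishes f L} \<inter> Z"
  have "closedin (subtopology (zariski V) Z) (?A f)" "closedin (subtopology (zariski V) Z) (?A g)"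
    using closedin_vanishing[OF assms(3)] closedin_vanishing[OF assms(4)] by (auto simp: closedin_subtopology)
  moreover have "Z = ?A f \<union> ?A g"
    using assms(2,5) vanishes_mult[OF assms(3,4)] by blast
  ultimately have "?A f = Z \<or> ?A g = Z"
    using assms(1) unfolding irreducible_space_def top by blast
  then show ?thesis by blast
qed

lemma irreducible_if_form_product:
  assumes "Z \<subseteq> pm.projectivization V" "Z \<noteq> {}"
    and prod: "\<And>n m f g. is_form n f \<Longrightarrow> is_form m g \<Longrightarrow> (\<And>L. L \<in> Z \<Longrightarrow> vanishes (\<lambda>x. f x * g x) L)
      \<Longrightarrow> (\<forall>L\<in>Z. vanishes f L) \<or> (\<forall>L\<in>Z. vanishes g L)"
  shows "irreducible_space (subtopology (zariski V) Z)"
proof -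
  have top: "topspace (subtopology (zariski V) Z) = Z"
    using assms(1) by (auto simp: topspace_zariski)
  show ?thesis unfolding irreducible_space_def top
  proof (intro conjI allI impI assms(2))
    fix A B assume AB: "closedin (subtopology (zariski V) Z) A \<and> closedin (subtopology (zariski V) Z) B \<and> Z = A \<union> B"
    obtain A' where A': "closedin (zariski V) A'" "A = A' \<inter> Z" using AB by (auto simp: closedin_subtopology)
    obtain B' where B': "closedin (zariski V) B'" "B = B' \<inter> Z" using AB by (auto simp: closedin_subtopology)
    show "A = Z \<or> B = Z"
    proof (rule ccontr)
      assume "\<not> ?thesis"
      then obtain L M where L: "L \<in> Z" "L \<notin> A'" and M: "M \<in> Z" "M \<notin> B'" using A' B' by blast
      obtain n f where f: "is_form n f" "\<forall>L\<in>A'. vanishes f L" "\<not> vanishes f L"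
        using closedin_separating_form[OF A'(1)] L assms(1) by blast
      obtain m g where g: "is_form m g" "\<forall>L\<in>B'. vanishes g L" "\<not> vanishes g M"
        using closedin_separating_form[OF B'(1)] M assms(1) by blast
      have "vanishes (\<lambda>x. f x * g x) N" if N: "N \<in> Z" for N
      proof -
        have "N \<in> A' \<or> N \<in> B'" using N AB A'(2) B'(2) by blast
        then have "vanishes f N \<or> vanishes g N" using f(2) g(2) by blast
        then show ?thesis by (auto simp: vanishes_def)
      qed
      from prod[OF f(1) g(1) this] show False using L M f g by blast
    qed
  qed
qed

section \<open>Chains of irreducible closed sets are bounded by the rank\<close>

text \<open>
  Homogeneous polynomial functions of degree \<open>a\<close> in \<open>y 0, \<dots>, y j\<close>. The last rule splits off the part
  divisible by the last variable. This is the step of the induction along a chain in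
  \<open>chain_forms_independent\<close>: on the smaller sets of the chain the last form vanishes, and on the
  irreducible set itself it can be cancelled.
\<close>

inductive hform :: "nat \<Rightarrow> nat \<Rightarrow> ((nat \<Rightarrow> 'k::field) \<Rightarrow> 'k) \<Rightarrow> bool" where
  power: "hform 0 a (\<lambda>y. c * y 0 ^ a)"
| const: "hform (Suc j) 0 (\<lambda>y. c)"
| step: "hform j (Suc a) Q \<Longrightarrow> hform (Suc j) a R \<Longrightarrow> hform (Suc j) (Suc a) (\<lambda>y. Q y + y (Suc j) * R y)"

lemma hform_zero: "hform j a (\<lambda>y. 0)"
proof (induction j arbitrary: a)
  case 0 show ?case using hform.power[of a 0] by simp
next
  case (Suc j)
  note IH = Suc.IH
  show ?case
  proof (induction a)
    case 0 show ?case by (rule hform.const)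
  next
    case (Suc a) show ?case using hform.step[OF IH[of "Suc a"] Suc.IH] by simp
  qed
qed

lemma hform_add: "hform j a P \<Longrightarrow> hform j a Q \<Longrightarrow> hform j a (\<lambda>y. P y + Q y)"
proof (induction arbitrary: Q rule: hform.induct)
  case (power a c)
  from power.prems obtain c' where "Q = (\<lambda>y. c' * y 0 ^ a)" by (cases rule: hform.cases) auto
  then show ?case using hform.power[of a "c + c'"] by (simp add: distrib_right)
next
  case (const j c)
  from const.prems obtain c' where "Q = (\<lambda>y. c')" by (cases rule: hform.cases) auto
  then show ?case using hform.const[of j "c + c'"] by simp
next
  case (step j a Q1 R1)
  from step.prems obtain Q2 R2 where Q: "Q = (\<lambda>y. Q2 y + y (Suc j) * R2 y)" "hform j (Suc a) Q2" "hform (Suc j) a R2"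
    by (cases rule: hform.cases) auto
  have "(\<lambda>y. Q1 y + y (Suc j) * R1 y + Q y) = (\<lambda>y. (Q1 y + Q2 y) + y (Suc j) * (R1 y + R2 y))"
    by (rule ext) (simp add: Q(1) algebra_simps)
  then show ?case using hform.step[OF step.IH(1)[OF Q(2)] step.IH(2)[OF Q(3)]] by simp
qed

lemma hform_sum:
  assumes "\<And>i. i \<in> I \<Longrightarrow> hform j a (P i)"
  shows "hform j a (\<lambda>y. \<Sum>i\<in>I. P i y)"
proof (cases "finite I")
  case True
  from this assms show ?thesis
  proof (induction I rule: finite_induct)
    case empty show ?case using hform_zero by simp
  next
    case (insert i I) then show ?case using hform_add[of j a "P i" "\<lambda>y. \<Sum>i\<in>I. P i y"] by simp
  qed
qed (use hform_zero in simp)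

lemma hform_monomial: "hform j (\<Sum>i<Suc j. \<alpha> i) (\<lambda>y. c * (\<Prod>i<Suc j. y i ^ \<alpha> i))"
proof (induction j arbitrary: \<alpha>)
  case 0 show ?case using hform.power[of "\<alpha> 0" c] by simp
next
  case (Suc j)
  have IHj: "\<And>\<alpha>. hform j (\<Sum>i<Suc j. \<alpha> i) (\<lambda>y. c * (\<Prod>i<Suc j. y i ^ \<alpha> i))" by (rule Suc.IH)
  define b where "b = \<alpha> (Suc j)"
  have "\<alpha> (Suc j) = b \<longrightarrow> ?case"
  proof (induction b arbitrary: \<alpha>)
    case 0
    show ?case
    proof
      assume z: "\<alpha> (Suc j) = 0"
      show "hform (Suc j) (\<Sum>i<Suc (Suc j). \<alpha> i) (\<lambda>y. c * (\<Prod>i<Suc (Suc j). y i ^ \<alpha> i))"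
      proof (cases "\<Sum>i<Suc j. \<alpha> i")
        case 0
        then have "\<forall>i<Suc (Suc j). \<alpha> i = 0" using z by (auto simp: less_Suc_eq)
        then have "(\<Prod>i<Suc (Suc j). y i ^ \<alpha> i) = 1" "(\<Sum>i<Suc (Suc j). \<alpha> i) = 0" for y :: "nat \<Rightarrow> 'a"
          by (intro prod.neutral sum.neutral; simp)+
        then show ?thesis using hform.const[of j c] by simp
      next
        case (Suc s)
        then show ?thesis using hform.step[of j s, OF _ hform_zero] IHj[of \<alpha>] z by simp
      qed
    qed
  next
    case (Suc b)
    show ?case
    proof
      assume z: "\<alpha> (Suc j) = Suc b"
      let ?\<beta> = "\<alpha>(Suc j := b)"
      have R: "hform (Suc j) (\<Sum>i<Suc (Suc j). ?\<beta> i) (\<lambda>y. c * (\<Prod>i<Suc (Suc j). y i ^ ?\<beta> i))"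
        using Suc.IH[of ?\<beta>] by simp
      have e: "(\<Sum>i<Suc (Suc j). \<alpha> i) = Suc (\<Sum>i<Suc (Suc j). ?\<beta> i)" using z by simp
      have "(\<lambda>y::nat \<Rightarrow> 'a. c * (\<Prod>i<Suc (Suc j). y i ^ \<alpha> i)) = (\<lambda>y. 0 + y (Suc j) * (c * (\<Prod>i<Suc (Suc j). y i ^ ?\<beta> i)))"
        using z by (intro ext) simp
      then show "hform (Suc j) (\<Sum>i<Suc (Suc j). \<alpha> i) (\<lambda>y. c * (\<Prod>i<Suc (Suc j). y i ^ \<alpha> i))"
        unfolding e using hform.step[OF hform_zero R] by simp
    qed
  qed
  then show ?case by (simp add: b_def)
qed

lemma hform_digit_poly: "hform j a (digit_poly m (Suc j) c a)"
proof -
  have "hform j a (\<lambda>y. c N * (\<Prod>i<Suc j. y i ^ digit m i N))" if "digit_sum m (Suc j) N = a" for N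
    using hform_monomial[of j "\<lambda>i. digit m i N" "c N"] that by (simp add: digit_sum_def)
  then show ?thesis unfolding digit_poly_def [abs_def] by (intro hform_sum) auto
qed

lemma hform_is_form:
  assumes "hform j a P" "\<And>i. i \<le> j \<Longrightarrow> is_form A (F i)"
  shows "is_form (a * A) (\<lambda>x. P (\<lambda>i. F i x))"
  using assms
proof (induction rule: hform.induct)
  case (power a c)
  then show ?case using is_form_cmult[OF is_form_power[of A "F 0" a], of c] by simp
next
  case (const j c)
  then show ?case using is_form_const[of c] by simp
next
  case (step j a Q R)
  have "is_form (Suc a * A) (\<lambda>x. Q (\<lambda>i. F i x))" "is_form (a * A) (\<lambda>x. R (\<lambda>i. F i x))" "is_form A (F (Suc j))"
    using step by simp_all
  then show ?case
    using is_form_add[of "Suc a * A" "\<lambda>x. Q (\<lambda>i. F i x)" "\<lambda>x. F (Suc j) x * R (\<lambda>i. F i x)"]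
      is_form_mult[of A "F (Suc j)" "a * A" "\<lambda>x. R (\<lambda>i. F i x)"] by simp
qed

definition irreducible_chain :: "'a topology \<Rightarrow> nat \<Rightarrow> (nat \<Rightarrow> 'a set) \<Rightarrow> bool" where
  "irreducible_chain T n Z \<longleftrightarrow> (\<forall>i\<le>n. closedin T (Z i) \<and> irreducible_space (subtopology T (Z i)))
     \<and> (\<forall>i<n. Z i \<subset> Z (Suc i))"

lemma krull_dim_chain: "krull_dim T = Sup {enat n | n. \<exists>Z. irreducible_chain T n Z}"
  by (simp add: krull_dim_def irreducible_chain_def)

text \<open>
  For each member of the chain there is a form that vanishes on all smaller members but not on it.
  Multiplication by a coordinate makes its degree positive, and powers bring all forms to the same
  degree \<open>A\<close>.
\<close>

lemma chain_separating_forms: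
  fixes V :: "('i \<Rightarrow>\<^sub>0 'k::field) set"
  assumes Y: "Y \<subseteq> pm.projectivization V" and Z: "irreducible_chain (subtopology (zariski V) Y) n Z"
  shows "\<exists>A F. A > 0 \<and> (\<forall>i\<le>n. is_form A (F i) \<and> (\<exists>L\<in>Z i. \<not> vanishes (F i) L)
      \<and> (\<forall>j<i. \<forall>L\<in>Z j. vanishes (F i) L))"
proof -
  have ZY: "Z i \<subseteq> Y" if "i \<le> n" for i
    using Z that closedin_subset unfolding irreducible_chain_def by fastforce
  have mono: "Z i \<subseteq> Z j" if "i \<le> j" "j \<le> n" for i j
    using that
  proof (induction j rule: dec_induct)
    case (step k) then show ?case using Z unfolding irreducible_chain_def by (meson Suc_le_eq Suc_leD order.trans psubset_imp_subset)
  qed simp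
  have ne: "Z i \<noteq> {}" if "i \<le> n" for i
    using Z that ZY[OF that] Y unfolding irreducible_chain_def irreducible_space_def
    by (auto simp: subtopology_subtopology)
  have ex: "\<exists>d f. d > 0 \<and> is_form d f \<and> (\<exists>L\<in>Z i. \<not> vanishes f L) \<and> (\<forall>j<i. \<forall>L\<in>Z j. vanishes f L)" if i: "i \<le> n" for i
  proof -
    obtain L n' f where L: "L \<in> Z i" and f: "is_form n' f" "\<not> vanishes f L" "\<forall>j<i. \<forall>L\<in>Z j. vanishes f L"
    proof (cases i)
      case 0
      obtain L where L: "L \<in> Z 0" using ne[of 0] by auto
      then have "L \<in> pm.projectivization V" using ZY[of 0] Y by auto
      then obtain x where "L = pm.span {x}" by (auto simp: projectivization_iff)
      then have "\<not> vanishes (\<lambda>x. 1 :: 'k) L" by (simp add: vanishes_span[OF is_form_const])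
      then show ?thesis using that[OF _ is_form_const] L 0 by auto
    next
      case (Suc i')
      then have "Z i' \<subset> Z i" "closedin (subtopology (zariski V) Y) (Z i')"
        using Z i unfolding irreducible_chain_def by auto
      then obtain L T where L: "L \<in> Z i" "L \<notin> Z i'" and T: "closedin (zariski V) T" "Z i' = T \<inter> Y"
        by (auto simp: closedin_subtopology)
      have LY: "L \<in> Y" using L ZY i by auto
      then obtain n' f where f: "is_form n' f" "\<forall>L'\<in>T. vanishes f L'" "\<not> vanishes f L"
        using closedin_separating_form[OF T(1), of L] Y L T(2) by blast
      have "vanishes f L'" if "j < i" "L' \<in> Z j" for j L'
        using mono[of j i'] that i Suc T(2) f(2) by auto
      then show ?thesis using that[OF L(1) f(1,3)] by blast
    qed
    have LV: "L \<in> pm.projectivization V" using L ZY[OF i] Y by auto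
    then obtain x where x: "x \<noteq> 0" "L = pm.span {x}" by (auto simp: projectivization_iff)
    from x(1) obtain r where r: "Poly_Mapping.lookup x r \<noteq> 0"
      by (metis lookup_zero poly_mapping_eqI)
    let ?g = "\<lambda>x. f x * Poly_Mapping.lookup x r"
    have g: "is_form (n' + 1) ?g" by (rule is_form_mult[OF f(1) is_form_coord])
    have "\<not> vanishes ?g L" using f(2) r x(2) by (simp add: vanishes_span[OF g] vanishes_span[OF f(1)])
    moreover have "\<forall>j<i. \<forall>L\<in>Z j. vanishes ?g L" using f(3) by (simp add: vanishes_def)
    ultimately show ?thesis using g L by (intro exI[of _ "n' + 1"] exI[of _ ?g]) auto
  qed
  then obtain d f where df: "\<And>i. i \<le> n \<Longrightarrow> d i > 0" "\<And>i. i \<le> n \<Longrightarrow> is_form (d i) (f i)"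
    "\<And>i. i \<le> n \<Longrightarrow> \<exists>L\<in>Z i. \<not> vanishes (f i) L" "\<And>i. i \<le> n \<Longrightarrow> \<forall>j<i. \<forall>L\<in>Z j. vanishes (f i) L"
    by metis
  define A where "A = (\<Prod>i\<le>n. d i)"
  have A: "A > 0" using df(1) by (simp add: A_def prod_pos)
  have dvd: "d i dvd A" if "i \<le> n" for i using that by (auto simp: A_def intro: dvd_prodI)
  have "is_form A (\<lambda>x. f i x ^ (A div d i)) \<and> (\<exists>L\<in>Z i. \<not> vanishes (\<lambda>x. f i x ^ (A div d i)) L)
      \<and> (\<forall>j<i. \<forall>L\<in>Z j. vanishes (\<lambda>x. f i x ^ (A div d i)) L)" if i: "i \<le> n" for i
  proof -
    have pos: "A div d i > 0" using dvd_div_mult_self[OF dvd[OF i]] A by (intro gr0I) auto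
    have V: "L \<in> pm.projectivization V" if "L \<in> Z j" "j \<le> n" for L j using that ZY Y by blast
    have "is_form (A div d i * d i) (\<lambda>x. f i x ^ (A div d i))" by (rule is_form_power[OF df(2)[OF i]])
    then have 1: "is_form A (\<lambda>x. f i x ^ (A div d i))" using dvd[OF i] by simp
    obtain L where L: "L \<in> Z i" "\<not> vanishes (f i) L" using df(3)[OF i] by blast
    have 2: "\<not> vanishes (\<lambda>x. f i x ^ (A div d i)) L"
      using vanishes_power[OF df(2)[OF i] V[OF L(1) i] pos] L(2) by simp
    have 3: "vanishes (\<lambda>x. f i x ^ (A div d i)) L" if "j < i" "L \<in> Z j" for j L
      using df(4)[OF i] that pos by (auto simp: vanishes_def)
    show ?thesis using 1 2 3 L(1) by blast
  qed
  then show ?thesis using A by (intro exI[of _ A] exI[of _ "\<lambda>i x. f i x ^ (A div d i)"]) blast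
qed

text \<open>
  A relation \<open>P = Q + y j * R\<close> between the forms, with \<open>Q\<close> not involving \<open>y j\<close>, holds for \<open>Q\<close> on the
  smaller sets of the chain because the last form vanishes there; by induction \<open>Q = 0\<close>. Then
  \<open>F j * R\<close> vanishes on the irreducible set \<open>Z j\<close>, where \<open>F j\<close> does not, so \<open>R\<close> does and \<open>R = 0\<close> by
  induction on the degree.
\<close>

lemma chain_forms_independent:
  fixes V :: "('i \<Rightarrow>\<^sub>0 'k::field) set"
  assumes Y: "Y \<subseteq> pm.projectivization V" and Z: "irreducible_chain (subtopology (zariski V) Y) n Z"
    and F: "\<And>i. i \<le> n \<Longrightarrow> is_form A (F i)" "\<And>i. i \<le> n \<Longrightarrow> \<exists>L\<in>Z i. \<not> vanishes (F i) L"
      "\<And>i j L. i \<le> n \<Longrightarrow> j < i \<Longrightarrow> L \<in> Z j \<Longrightarrow> vanishes (F i) L"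
    and P: "hform j a P" "j \<le> n" "\<And>L. L \<in> Z j \<Longrightarrow> vanishes (\<lambda>x. P (\<lambda>i. F i x)) L"
  shows "P y = 0"
proof -
  have ZV: "Z i \<subseteq> pm.projectivization V" if "i \<le> n" for i
    using Z Y that closedin_subset[of _ "Z i"] unfolding irreducible_chain_def by fastforce
  have ZY: "Z i \<subseteq> Y" if "i \<le> n" for i
    using Z that closedin_subset[of _ "Z i"] unfolding irreducible_chain_def by fastforce
  have irr: "irreducible_space (subtopology (zariski V) (Z i))" if "i \<le> n" for i
  proof -
    have "irreducible_space (subtopology (subtopology (zariski V) Y) (Z i))"
      using Z that unfolding irreducible_chain_def by blast
    then show ?thesis using ZY[OF that] by (simp add: subtopology_subtopology inf.absorb2)
  qed
  show ?thesis using P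
  proof (induction arbitrary: y rule: hform.induct)
    case (power a c)
    obtain L where L: "L \<in> Z 0" "\<not> vanishes (F 0) L" using F(2)[of 0] by auto
    then obtain x where "x \<in> L" "F 0 x \<noteq> 0" by (auto simp: vanishes_def)
    moreover have "c * F 0 x ^ a = 0" using power.prems(2)[OF L(1)] \<open>x \<in> L\<close> unfolding vanishes_def by (rule bspec)
    ultimately have "c = 0" by simp
    then show ?case by simp
  next
    case (const j c)
    obtain L where L: "L \<in> Z (Suc j)" "\<not> vanishes (F (Suc j)) L" using F(2)[of "Suc j"] const.prems by auto
    then obtain x where "x \<in> L" by (auto simp: vanishes_def)
    then show ?case using const.prems(2)[OF L(1)] by (auto simp: vanishes_def)
  next
    case (step j a Q R)
    have j: "Suc j \<le> n" "j \<le> n" using step.prems by auto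
    have sub: "Z j \<subseteq> Z (Suc j)"
      using Z j(1) unfolding irreducible_chain_def by (simp add: psubset_imp_subset)
    have Q: "Q y = 0" for y
    proof (rule step.IH(1)[OF j(2)])
      fix L assume L: "L \<in> Z j"
      have "vanishes (F (Suc j)) L" using F(3)[OF j(1) _ L] by simp
      moreover have "vanishes (\<lambda>x. Q (\<lambda>i. F i x) + F (Suc j) x * R (\<lambda>i. F i x)) L"
        using step.prems(2)[of L] L sub by blast
      ultimately show "vanishes (\<lambda>x. Q (\<lambda>i. F i x)) L" by (auto simp: vanishes_def)
    qed
    have FR: "vanishes (\<lambda>x. F (Suc j) x * R (\<lambda>i. F i x)) L" if "L \<in> Z (Suc j)" for L
      using step.prems(2)[OF that] by (simp add: Q)
    have Rf: "is_form (a * A) (\<lambda>x. R (\<lambda>i. F i x))"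
      using step.hyps(2) by (rule hform_is_form) (use F(1) j in auto)
    have "\<not> (\<forall>L\<in>Z (Suc j). vanishes (F (Suc j)) L)" using F(2)[OF j(1)] by blast
    then have "\<forall>L\<in>Z (Suc j). vanishes (\<lambda>x. R (\<lambda>i. F i x)) L"
      using irreducible_form_product[OF irr[OF j(1)] ZV[OF j(1)] F(1)[OF j(1)] Rf FR] by blast
    then have "R y = 0" for y using step.IH(2)[OF j(1)] by blast
    then show ?case by (simp add: Q)
  qed
qed

lemma digit_poly_scale: "digit_poly m l c a (\<lambda>i. s * y i) = s ^ a * digit_poly m l c a y"
  unfolding digit_poly_def sum_distrib_left
proof (intro sum.cong refl)
  fix N assume "N \<in> {N. N < m ^ l \<and> digit_sum m l N = a}"
  then have "(\<Prod>i<l. (s * y i) ^ digit m i N) = s ^ a * (\<Prod>i<l. y i ^ digit m i N)"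
    by (simp add: power_mult_distrib prod.distrib digit_sum_def flip: power_sum)
  then show "c N * (\<Prod>i<l. (s * y i) ^ digit m i N) = s ^ a * (c N * (\<Prod>i<l. y i ^ digit m i N))"
    by (simp add: mult_ac)
qed

text \<open>
  If \<open>n \<ge> \<rho>\<close>, then the forms belonging to a chain, composed with \<open>\<phi>\<close>, would satisfy a polynomial
  relation on the slice with at most \<open>\<rho>\<close> free variables that \<open>rank_reduction\<close> provides, hence
  everywhere. Since the image of \<open>\<phi>\<close> is a cone, the homogeneous parts of the relation hold as well,
  and they contradict \<open>chain_forms_independent\<close>. The image of \<open>\<phi>\<close> is meant to be dense in the cone
  over \<open>Y\<close>, and this is what the assumption on vanishing forms says.
\<close>

theorem chain_length_less_rank:
  fixes \<phi> :: "('p \<Rightarrow> 'k::field_char_0) \<Rightarrow> ('i \<Rightarrow>\<^sub>0 'k)"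
  assumes S: "finite S" and \<phi>: "\<And>r. polyfun (\<lambda>x. Poly_Mapping.lookup (\<phi> x) r)"
    and dep: "\<And>x y. (\<forall>i\<in>S. x i = y i) \<Longrightarrow> \<phi> x = \<phi> y"
    and rank: "\<And>x T. T \<subseteq> S \<Longrightarrow> card T > \<rho> \<Longrightarrow>
      \<exists>c. (\<exists>i\<in>T. c i \<noteq> 0) \<and> (\<forall>r. (\<Sum>i\<in>T. c i * pd i (\<lambda>x. Poly_Mapping.lookup (\<phi> x) r) x) = 0)"
    and Y: "Y \<subseteq> pm.projectivization V"
    and dense: "\<And>n f L. is_form n f \<Longrightarrow> (\<forall>x. f (\<phi> x) = 0) \<Longrightarrow> L \<in> Y \<Longrightarrow> vanishes f L"
    and cone: "\<And>t x. \<exists>x'. \<phi> x' = pm_scale t (\<phi> x)"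
    and Z: "irreducible_chain (subtopology (zariski V) Y) n Z"
  shows "n < \<rho>"
proof (rule ccontr)
  assume "\<not> n < \<rho>"
  obtain S' p where S': "S' \<subseteq> S" "card S' \<le> \<rho>" and red:
    "\<And>G. polyfun G \<Longrightarrow> (\<And>x. (\<forall>i\<in>S - S'. x i = p i) \<Longrightarrow> G (Poly_Mapping.lookup (\<phi> x)) = 0) \<Longrightarrow>
      (\<forall>x. G (Poly_Mapping.lookup (\<phi> x)) = 0)"
    using rank_reduction[of S "\<lambda>x. Poly_Mapping.lookup (\<phi> x)" \<rho>, OF S \<phi> rank] by blast
  define j where "j = card S'"
  have jn: "j \<le> n" using S' \<open>\<not> n < \<rho>\<close> by (simp add: j_def)
  have fS': "finite S'" using S S' finite_subset by blast
  obtain A F where A: "A > 0" and F: "\<And>i. i \<le> n \<Longrightarrow> is_form A (F i)" "\<And>i. i \<le> n \<Longrightarrow> \<exists>L\<in>Z i. \<not> vanishes (F i) L"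
      "\<And>i j L. i \<le> n \<Longrightarrow> j < i \<Longrightarrow> L \<in> Z j \<Longrightarrow> vanishes (F i) L"
    using chain_separating_forms[OF Y Z] by blast
  define G where "G i = (if i \<le> n then F i else (\<lambda>x. 0))" for i
  have G: "is_form A (G i)" for i by (simp add: G_def F(1) is_form_zero)
  let ?l = "Suc j"
  have Gp: "polyfun (\<lambda>x. G i (\<phi> x))" for i by (rule is_form_comp_polyfun[OF G \<phi>])
  obtain m c where m: "m > 0" and c: "\<exists>N<m ^ ?l. c N \<noteq> 0" and
    0: "\<And>x. (\<forall>i. i \<notin> S' \<longrightarrow> x i = p i) \<Longrightarrow> (\<Sum>N<m ^ ?l. c N * (\<Prod>i<?l. G i (\<phi> x) ^ digit m i N)) = 0"
    using algebraic_dependence[OF fS' polyfun.const[of 1], of "\<lambda>i x. G i (\<phi> x)" p, OF Gp] unfolding j_def by auto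
  have all0: "(\<Sum>N<m ^ ?l. c N * (\<Prod>i<?l. G i (\<phi> x) ^ digit m i N)) = 0" for x
  proof -
    obtain Q where Q: "\<And>i. polyfun (Q i)" "\<And>i x. G i x = Q i (Poly_Mapping.lookup x)"
      using is_form_polyfun[OF G] by metis
    have "polyfun (\<lambda>v. \<Sum>N<m ^ ?l. c N * (\<Prod>i<?l. Q i v ^ digit m i N))"
      by (intro polyfun_intros Q)
    then have "\<forall>x. (\<Sum>N<m ^ ?l. c N * (\<Prod>i<?l. Q i (Poly_Mapping.lookup (\<phi> x)) ^ digit m i N)) = 0"
    proof (rule red)
      fix x :: "'p \<Rightarrow> 'k" assume x: "\<forall>i\<in>S - S'. x i = p i"
      define x' where "x' i = (if i \<in> S then x i else p i)" for i
      have "\<phi> x = \<phi> x'" by (rule dep) (simp add: x'_def)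
      moreover have "\<forall>i. i \<notin> S' \<longrightarrow> x' i = p i" using x by (auto simp: x'_def)
      ultimately show "(\<Sum>N<m ^ ?l. c N * (\<Prod>i<?l. Q i (Poly_Mapping.lookup (\<phi> x)) ^ digit m i N)) = 0"
        using 0[of x'] by (simp add: Q(2))
    qed
    then show ?thesis by (simp add: Q(2))
  qed
  (* Along the line spanned by \<open>\<phi> x\<close> the relation is a polynomial in the scaling factor, and its
     coefficients are the homogeneous parts. *)
  have D0: "digit_poly m ?l c a (\<lambda>i. G i (\<phi> x)) = 0" if a: "a \<le> ?l * m" for a x
  proof -
    define q where "q = (\<Sum>a\<le>?l * m. monom (digit_poly m ?l c a (\<lambda>i. G i (\<phi> x))) (a * A))"
    have "poly q t = 0" for t
    proof -
      obtain x' where x': "\<phi> x' = pm_scale t (\<phi> x)" using cone by blast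
      have "0 = (\<Sum>N<m ^ ?l. c N * (\<Prod>i<?l. G i (\<phi> x') ^ digit m i N))" by (simp only: all0)
      also have "\<dots> = (\<Sum>a\<le>?l * m. digit_poly m ?l c a (\<lambda>i. G i (\<phi> x')))"
        by (subst sum_by_digit_sum[OF m]) (simp add: digit_poly_def)
      also have "\<dots> = (\<Sum>a\<le>?l * m. t ^ (a * A) * digit_poly m ?l c a (\<lambda>i. G i (\<phi> x)))"
        by (simp add: x' is_form_scale[OF G] digit_poly_scale mult.commute flip: power_mult)
      also have "\<dots> = poly q t" by (simp add: q_def poly_sum poly_monom mult.commute)
      finally show ?thesis by simp
    qed
    then have "q = 0" by (intro poly_fun_zero)
    moreover have "coeff q (a * A) = (\<Sum>b\<le>?l * m. if b = a then digit_poly m ?l c b (\<lambda>i. G i (\<phi> x)) else 0)"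
      unfolding q_def coeff_sum using A by (intro sum.cong) auto
    ultimately show ?thesis using a by simp
  qed
  have "digit_poly m ?l c a y = 0" if a: "a \<le> ?l * m" for a y
  proof (rule chain_forms_independent[OF Y Z F hform_digit_poly jn])
    have ff: "is_form (a * A) (\<lambda>x. digit_poly m ?l c a (\<lambda>i. G i x))"
      by (rule hform_is_form[OF hform_digit_poly G])
    have "Z j \<subseteq> Y" using Z jn closedin_subset[of _ "Z j"] unfolding irreducible_chain_def by fastforce
    moreover fix L assume "L \<in> Z j"
    ultimately have "vanishes (\<lambda>x. digit_poly m ?l c a (\<lambda>i. G i x)) L"
      using dense[OF ff, of L] D0[OF a] by blast
    moreover have "digit_poly m ?l c a (\<lambda>i. G i x) = digit_poly m ?l c a (\<lambda>i. F i x)" for x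
      unfolding digit_poly_def using jn by (intro sum.cong refl arg_cong2[where f=times] prod.cong) (auto simp: G_def)
    ultimately show "vanishes (\<lambda>x. digit_poly m ?l c a (\<lambda>i. F i x)) L" by simp
  qed
  moreover obtain N where "N < m ^ ?l" "c N \<noteq> 0" using c by blast
  ultimately show False using digit_poly_nonzero[OF m, of N ?l c] by blast
qed

section \<open>Chains of the length given by the rank\<close>

lemma polyfun_line_derivative:
  fixes f :: "('p \<Rightarrow> 'k::field_char_0) \<Rightarrow> 'k"
  assumes "polyfun f" and I: "finite I" "\<And>i. i \<notin> I \<Longrightarrow> w i = 0"
  shows "\<exists>q. (\<forall>s. f (\<lambda>i. p i + s * w i) = poly q s) \<and> coeff q 1 = (\<Sum>i\<in>I. w i * pd i f p)"
  using assms(1)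
proof induction
  case (const c)
  show ?case by (intro exI[of _ "[:c:]"]) simp
next
  case (var i)
  have "(\<Sum>j\<in>I. w j * (if j = i then 1 else 0)) = (\<Sum>j\<in>I. if j = i then w j else 0)"
    by (intro sum.cong) auto
  also have "\<dots> = w i" using I(1) I(2)[of i] by (cases "i \<in> I") simp_all
  finally show ?case by (intro exI[of _ "[:p i, w i:]"]) simp
next
  case (add f g)
  then obtain q r where "\<forall>s. f (\<lambda>i. p i + s * w i) = poly q s" "coeff q 1 = (\<Sum>i\<in>I. w i * pd i f p)"
    "\<forall>s. g (\<lambda>i. p i + s * w i) = poly r s" "coeff r 1 = (\<Sum>i\<in>I. w i * pd i g p)" by blast
  then show ?case using add.hyps
    by (intro exI[of _ "q + r"]) (simp add: distrib_left sum.distrib)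
next
  case (mult f g)
  then obtain q r where q: "\<forall>s. f (\<lambda>i. p i + s * w i) = poly q s" "coeff q 1 = (\<Sum>i\<in>I. w i * pd i f p)"
    and r: "\<forall>s. g (\<lambda>i. p i + s * w i) = poly r s" "coeff r 1 = (\<Sum>i\<in>I. w i * pd i g p)" by blast
  have "f p = coeff q 0" "g p = coeff r 0"
    using q(1)[rule_format, of 0] r(1)[rule_format, of 0] by (simp_all add: poly_0_coeff_0)
  then have "coeff (q * r) 1 = (\<Sum>i\<in>I. w i * pd i f p) * g p + f p * (\<Sum>i\<in>I. w i * pd i g p)"
    using q(2) r(2) by (simp add: coeff_mult mult.commute add.commute)
  also have "\<dots> = (\<Sum>i\<in>I. w i * pd i (\<lambda>x. f x * g x) p)"
    using mult.hyps by (simp add: sum_distrib_left sum_distrib_right sum.distrib[symmetric] algebra_simps)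
  finally show ?case using q(1) r(1) by (intro exI[of _ "q * r"]) simp
qed

lemma pd_linear_combination:
  fixes f :: "'r \<Rightarrow> ('p \<Rightarrow> 'k::field_char_0) \<Rightarrow> 'k"
  assumes "finite C" "\<And>r. polyfun (f r)"
  shows "pd i (\<lambda>x. \<Sum>r\<in>C. y r * f r x) x = (\<Sum>r\<in>C. y r * pd i (f r) x)"
  using assms(1)
proof (induction C rule: finite_induct)
  case (insert r C)
  have "pd i (\<lambda>x. y r * f r x + (\<Sum>r\<in>C. y r * f r x)) x
      = pd i (\<lambda>x. y r * f r x) x + pd i (\<lambda>x. \<Sum>r\<in>C. y r * f r x) x"
    by (rule pd_add) (intro polyfun_intros assms(2))+
  also have "pd i (\<lambda>x. y r * f r x) x = y r * pd i (f r) x"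
    by (subst pd_mult[OF polyfun.const assms(2)]) simp
  finally show ?case using insert by simp
qed simp

text \<open>
  The linear forms \<open>y0\<close> and \<open>y i\<close> are dual to the vector \<open>\<phi> p\<close> and to the partial derivatives at \<open>p\<close>
  in the directions \<open>b j\<close>; their existence says that these \<open>n + 1\<close> vectors are independent. Let \<open>Z j\<close>
  be the closure in \<open>Y\<close> of the image of the slice through \<open>p\<close> on which only the variables
  \<open>b 0, \<dots>, b (j - 1)\<close> vary. It is irreducible because polynomial functions form a domain. Suppose
  \<open>Z j\<close> equals \<open>Z (j + 1)\<close>. On the smaller slice, with \<open>j\<close> variables, the linear
  forms \<open>y i\<close> with \<open>i \<le> j\<close> satisfy a relation homogenized by \<open>y0\<close>; this is a form
  vanishing on \<open>Z j\<close>, hence on the larger slice. But at \<open>p\<close> on the larger slice \<open>y0\<close> has the value 1 and the \<open>y i\<close> are to first order the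
  increments of the free variables, so the lowest homogeneous part of the
  relation would have to vanish identically.
\<close>

theorem krull_dim_ge_rank:
  fixes \<phi> :: "('p \<Rightarrow> 'k::field_char_0) \<Rightarrow> ('i \<Rightarrow>\<^sub>0 'k)"
  assumes \<phi>: "\<And>r. polyfun (\<lambda>x. Poly_Mapping.lookup (\<phi> x) r)"
    and b: "inj_on b {..<n}" and C: "finite C"
    and y0: "(\<Sum>r\<in>C. y0 r * Poly_Mapping.lookup (\<phi> p) r) = 1"
      "\<And>j. j < n \<Longrightarrow> (\<Sum>r\<in>C. y0 r * pd (b j) (\<lambda>x. Poly_Mapping.lookup (\<phi> x) r) p) = 0"
    and y: "\<And>i. i < n \<Longrightarrow> (\<Sum>r\<in>C. y i r * Poly_Mapping.lookup (\<phi> p) r) = 0"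
      "\<And>i j. i < n \<Longrightarrow> j < n \<Longrightarrow>
        (\<Sum>r\<in>C. y i r * pd (b j) (\<lambda>x. Poly_Mapping.lookup (\<phi> x) r) p) = (if i = j then 1 else 0)"
    and Y: "Y \<subseteq> pm.projectivization V" and img: "\<And>x. \<phi> x \<noteq> 0 \<Longrightarrow> pm.span {\<phi> x} \<in> Y"
  shows "enat n \<le> krull_dim (subtopology (zariski V) Y)"
proof -
  define Sl where "Sl j = {x. \<forall>i. i \<notin> b ` {..<j} \<longrightarrow> x i = p i}" for j
  define Z where "Z j = {L \<in> Y. \<forall>m f. is_form m f \<longrightarrow> (\<forall>x\<in>Sl j. f (\<phi> x) = 0) \<longrightarrow> vanishes f L}" for j
  have Sl_mono: "Sl j \<subseteq> Sl (Suc j)" for j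
  proof -
    have "b ` {..<j} \<subseteq> b ` {..<Suc j}" by auto
    then show ?thesis unfolding Sl_def by blast
  qed
  have p: "p \<in> Sl j" for j by (simp add: Sl_def)
  have "\<phi> p \<noteq> 0" using y0(1) by auto
  have imgZ: "pm.span {\<phi> x} \<in> Z j" if "x \<in> Sl j" "\<phi> x \<noteq> 0" for x j
    using that img by (auto simp: Z_def vanishes_span)
  have zero: "f 0 = 0" if "L \<in> Y" "vanishes f L" for f L
  proof -
    have "L \<in> pm.projectivization V" using that Y by blast
    then have "0 \<in> L" by (auto simp: projectivization_iff intro: pm.span_zero)
    then show ?thesis using that by (simp add: vanishes_def)
  qed
  have ZY: "Z j \<subseteq> Y" for j by (auto simp: Z_def)
  have van: "f (\<phi> x) = 0" if f: "is_form m f" and v: "\<And>L. L \<in> Z j \<Longrightarrow> vanishes f L" and x: "x \<in> Sl j" for m f j x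
  proof (cases "\<phi> x = 0")
    case True
    have "pm.span {\<phi> p} \<in> Z j" using imgZ[OF p \<open>\<phi> p \<noteq> 0\<close>] .
    then show ?thesis using zero[OF _ v] ZY True by auto
  next
    case False
    then show ?thesis using v[OF imgZ[OF x False]] vanishes_span[OF f] by simp
  qed
  have closed: "closedin (subtopology (zariski V) Y) (Z j)" for j
  proof -
    let ?Fam = "{{L \<in> pm.projectivization V. vanishes f L} | f m. is_form m f \<and> (\<forall>x\<in>Sl j. f (\<phi> x) = 0)}"
    have "?Fam \<noteq> {}" using is_form_zero by fastforce
    then have "closedin (zariski V) (\<Inter>?Fam)"
      using closedin_vanishing by (intro closedin_Inter) auto
    moreover have "Z j = (\<Inter>?Fam) \<inter> Y" using Y unfolding Z_def by blast
    ultimately show ?thesis by (auto simp: closedin_subtopology)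
  qed
  have irr: "irreducible_space (subtopology (subtopology (zariski V) Y) (Z j))" for j
  proof -
    have "irreducible_space (subtopology (zariski V) (Z j))"
    proof (rule irreducible_if_form_product)
      show "Z j \<subseteq> pm.projectivization V" using ZY Y by blast
      show "Z j \<noteq> {}" using imgZ[OF p \<open>\<phi> p \<noteq> 0\<close>] by blast
      fix m m' f g
      assume f: "is_form m f" and g: "is_form m' g" and fg: "\<And>L. L \<in> Z j \<Longrightarrow> vanishes (\<lambda>x. f x * g x) L"
      define \<sigma> where "\<sigma> x i = (if i \<in> b ` {..<j} then x i else p i)" for x :: "'p \<Rightarrow> 'k" and i
      have \<sigma>: "polyfun (\<lambda>x. \<sigma> x i)" for i
        unfolding \<sigma>_def by (intro polyfun_intros)
      have \<sigma>Sl: "\<sigma> x \<in> Sl j" for x by (simp add: Sl_def \<sigma>_def)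
      have fixed: "\<sigma> x = x" if "x \<in> Sl j" for x using that by (auto simp: Sl_def \<sigma>_def)
      have "f (\<phi> (\<sigma> x)) * g (\<phi> (\<sigma> x)) = 0" for x
        using van[OF is_form_mult[OF f g] fg \<sigma>Sl] by simp
      moreover have "polyfun (\<lambda>x. f (\<phi> (\<sigma> x)))" "polyfun (\<lambda>x. g (\<phi> (\<sigma> x)))"
        by (rule polyfun_comp[where \<phi>=\<sigma>, OF is_form_comp_polyfun[OF f \<phi>] \<sigma>],
            rule polyfun_comp[where \<phi>=\<sigma>, OF is_form_comp_polyfun[OF g \<phi>] \<sigma>])
      ultimately have "(\<forall>x. f (\<phi> (\<sigma> x)) = 0) \<or> (\<forall>x. g (\<phi> (\<sigma> x)) = 0)"
        by (intro polyfun_domain)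
      then have "(\<forall>x\<in>Sl j. f (\<phi> x) = 0) \<or> (\<forall>x\<in>Sl j. g (\<phi> x) = 0)" using fixed by metis
      then show "(\<forall>L\<in>Z j. vanishes f L) \<or> (\<forall>L\<in>Z j. vanishes g L)"
        using f g unfolding Z_def by blast
    qed
    then show ?thesis using ZY[of j] by (simp add: subtopology_subtopology inf.absorb2)
  qed
  have "Z j \<subset> Z (Suc j)" if j: "j < n" for j
  proof
    show "Z j \<subseteq> Z (Suc j)" using Sl_mono[of j] unfolding Z_def by blast
    show "Z j \<noteq> Z (Suc j)"
    proof
      assume eq: "Z j = Z (Suc j)"
      let ?l = "Suc j"
      define H where "H v = (\<Sum>r\<in>C. y0 r * Poly_Mapping.lookup v r)" for v
      define G where "G i v = (\<Sum>r\<in>C. y i r * Poly_Mapping.lookup v r)" for i v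
      have Hf: "is_form 1 H" unfolding H_def [abs_def] by (intro is_form_sum is_form_cmult is_form_coord)
      have Gf: "is_form 1 (G i)" for i unfolding G_def [abs_def] by (intro is_form_sum is_form_cmult is_form_coord)
      have Hp: "polyfun (\<lambda>x. H (\<phi> x))" by (rule is_form_comp_polyfun[OF Hf \<phi>])
      have Gp: "polyfun (\<lambda>x. G i (\<phi> x))" for i by (rule is_form_comp_polyfun[OF Gf \<phi>])
      have inj: "inj_on b {..<j}" "inj_on b {..<?l}" using b j by (auto intro: inj_on_subset)
      have card: "card (b ` {..<j}) = j" using card_image[OF inj(1)] by simp
      obtain m c where m: "m > 0" and c: "\<exists>N<m ^ ?l. c N \<noteq> 0" and
        0: "\<And>x. (\<forall>i. i \<notin> b ` {..<j} \<longrightarrow> x i = p i) \<Longrightarrow>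
          (\<Sum>N<m ^ ?l. c N * (H (\<phi> x) ^ (?l * m - digit_sum m ?l N) * (\<Prod>i<?l. G i (\<phi> x) ^ digit m i N))) = 0"
        using algebraic_dependence[of "b ` {..<j}" "\<lambda>x. H (\<phi> x)" "\<lambda>i x. G i (\<phi> x)" p, OF _ Hp Gp]
        unfolding card by auto
      define f where "f v = (\<Sum>N<m ^ ?l. c N * (H v ^ (?l * m - digit_sum m ?l N) * (\<Prod>i<?l. G i v ^ digit m i N)))" for v
      have "is_form (?l * m) f"
        unfolding f_def [abs_def]
      proof (intro is_form_sum is_form_cmult)
        fix N
        have "is_form (\<Sum>i<?l. digit m i N * 1) (\<lambda>v. \<Prod>i<?l. G i v ^ digit m i N)"
          by (rule is_form_prod) (simp, rule is_form_power[OF Gf])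
        then have "is_form (digit_sum m ?l N) (\<lambda>v. \<Prod>i<?l. G i v ^ digit m i N)"
          by (simp only: digit_sum_def mult_1_right)
        from is_form_mult[OF is_form_power[OF Hf, of "?l * m - digit_sum m ?l N"] this]
        show "is_form (?l * m) (\<lambda>v. H v ^ (?l * m - digit_sum m ?l N) * (\<Prod>i<?l. G i v ^ digit m i N))"
          using digit_sum_le[OF m, of ?l N] by simp
      qed
      then have fz: "f (\<phi> x) = 0" if "x \<in> Sl (Suc j)" for x
      proof (rule van[OF _ _ that])
        fix L assume "L \<in> Z (Suc j)"
        then have "L \<in> Z j" using eq by simp
        moreover have "\<forall>x\<in>Sl j. f (\<phi> x) = 0" using 0 unfolding f_def Sl_def by blast
        ultimately show "vanishes f L" using \<open>is_form (?l * m) f\<close> unfolding Z_def by blast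
      qed
      obtain a0 where "\<exists>w. digit_poly m ?l c a0 w \<noteq> 0" "a0 \<le> ?l * m"
        using c digit_poly_nonzero[OF m, of _ ?l c] by blast
      (* The lowest degree in which the relation has a non-zero part, and a vector \<open>w\<close> where this part
         does not vanish. *)
      define a where "a = (LEAST a. \<exists>w. digit_poly m ?l c a w \<noteq> 0)"
      obtain w where w: "digit_poly m ?l c a w \<noteq> 0"
        using LeastI_ex[of "\<lambda>a. \<exists>w. digit_poly m ?l c a w \<noteq> 0"] \<open>\<exists>w. digit_poly m ?l c a0 w \<noteq> 0\<close>
        unfolding a_def by blast
      have less_a: "digit_poly m ?l c b w = 0" if "b < a" for b w
        using not_less_Least[of b "\<lambda>a. \<exists>w. digit_poly m ?l c a w \<noteq> 0"] that unfolding a_def by blast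
      have a_le: "a \<le> ?l * m"
      proof -
        have "a \<le> a0" unfolding a_def by (rule Least_le) fact
        then show ?thesis using \<open>a0 \<le> ?l * m\<close> by (rule le_trans)
      qed
      define W where "W i = (if i \<in> b ` {..<?l} then w (inv_into {..<?l} b i) else 0)" for i
      have Wb: "W (b k) = w k" if "k < ?l" for k using that inj(2) by (simp add: W_def inv_into_f_f)
      (* On the line through \<open>p\<close> in direction \<open>w\<close> the relation is \<open>s ^ a\<close> times a polynomial \<open>R\<close> in \<open>s\<close>,
         with value the lowest part at \<open>w\<close> for \<open>s = 0\<close>. *)
      define x where "x s i = p i + s * W i" for s i
      have xSl: "x s \<in> Sl ?l" for s by (simp add: Sl_def x_def W_def)
      have sumW: "(\<Sum>i\<in>b ` {..<?l}. W i * D i) = (\<Sum>k<?l. w k * D (b k))" for D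
        by (subst sum.reindex[OF inj(2)]) (auto simp: Wb intro!: sum.cong)
      obtain hq where hq: "\<And>s. H (\<phi> (x s)) = poly hq s"
        using polyfun_line[OF Hp, of p W] unfolding x_def by blast
      have "H (\<phi> p) = 1" using y0(1) by (simp add: H_def)
      moreover have "x 0 = p" by (simp add: x_def fun_eq_iff)
      ultimately have hq0: "poly hq 0 = 1" using hq[of 0] by simp
      have "\<exists>u. (\<forall>s. G i (\<phi> (x s)) = s * poly u s) \<and> poly u 0 = w i" if i: "i < ?l" for i
      proof -
        obtain q where q: "\<And>s. G i (\<phi> (x s)) = poly q s"
          "coeff q 1 = (\<Sum>k\<in>b ` {..<?l}. W k * pd k (\<lambda>x. G i (\<phi> x)) p)"
          using polyfun_line_derivative[OF Gp[of i], of "b ` {..<?l}" W p] unfolding x_def by (auto simp: W_def)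
        have "poly q 0 = 0" using q(1)[of 0] y(1)[of i] i j \<open>x 0 = p\<close> by (simp add: G_def)
        then have q0: "coeff q 0 = 0" by (simp add: poly_0_coeff_0)
        have "pd (b k) (\<lambda>x. G i (\<phi> x)) p = (if i = k then 1 else 0)" if "k < ?l" for k
          unfolding G_def using y(2)[of i k] i that j by (subst pd_linear_combination[OF C \<phi>]) auto
        then have "coeff q 1 = (\<Sum>k\<in>{..<?l}. if i = k then w k else 0)"
          unfolding q(2) sumW by (intro sum.cong) auto
        also have "\<dots> = w i" using i by (subst sum.delta') simp_all
        finally have "coeff q 1 = w i" .
        obtain a0 u where qu: "q = pCons a0 u" by (cases q)
        have "a0 = 0" using q0 by (simp add: qu)
        moreover have "poly u 0 = w i" using \<open>coeff q 1 = w i\<close> by (simp add: qu poly_0_coeff_0)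
        ultimately show ?thesis using q(1) by (intro exI[of _ u]) (simp add: qu)
      qed
      then obtain u where u: "\<And>i s. i < ?l \<Longrightarrow> G i (\<phi> (x s)) = s * poly (u i) s" "\<And>i. i < ?l \<Longrightarrow> poly (u i) 0 = w i"
        by metis
      define R where "R = (\<Sum>e\<in>{a..?l * m}. monom 1 (e - a) * hq ^ (?l * m - e) *
        (\<Sum>N | N < m ^ ?l \<and> digit_sum m ?l N = e. [:c N:] * (\<Prod>i<?l. u i ^ digit m i N)))"
      have R: "poly R s = (\<Sum>e\<in>{a..?l * m}. s ^ (e - a) * poly hq s ^ (?l * m - e) * digit_poly m ?l c e (\<lambda>i. poly (u i) s))" for s
        unfolding R_def by (simp only: poly_sum poly_mult poly_monom poly_power poly_prod poly_pCons poly_0 digit_poly_def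
            mult_zero_right add_0_right mult_1_left)
      have "poly R s = 0" if s: "s \<noteq> 0" for s
      proof -
        have "0 = f (\<phi> (x s))" using fz[OF xSl] by simp
        also have "\<dots> = (\<Sum>e\<le>?l * m. \<Sum>N | N < m ^ ?l \<and> digit_sum m ?l N = e.
            c N * (H (\<phi> (x s)) ^ (?l * m - digit_sum m ?l N) * (\<Prod>i<?l. G i (\<phi> (x s)) ^ digit m i N)))"
          unfolding f_def by (rule sum_by_digit_sum[OF m])
        also have "\<dots> = (\<Sum>e\<le>?l * m. poly hq s ^ (?l * m - e) * digit_poly m ?l c e (\<lambda>i. s * poly (u i) s))"
          unfolding digit_poly_def sum_distrib_left
          by (intro sum.cong refl) (simp add: hq u(1) mult_ac)
        also have "\<dots> = (\<Sum>e\<le>?l * m. poly hq s ^ (?l * m - e) * (s ^ e * digit_poly m ?l c e (\<lambda>i. poly (u i) s)))"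
          by (simp only: digit_poly_scale)
        also have "\<dots> = (\<Sum>e\<in>{a..?l * m}. poly hq s ^ (?l * m - e) * (s ^ e * digit_poly m ?l c e (\<lambda>i. poly (u i) s)))"
          using less_a by (intro sum.mono_neutral_right) auto
        also have "\<dots> = s ^ a * poly R s"
          unfolding R sum_distrib_left
        proof (intro sum.cong refl)
          fix e assume "e \<in> {a..?l * m}"
          then have "s ^ e = s ^ a * s ^ (e - a)" by (simp flip: power_add)
          then show "poly hq s ^ (?l * m - e) * (s ^ e * digit_poly m ?l c e (\<lambda>i. poly (u i) s))
            = s ^ a * (s ^ (e - a) * poly hq s ^ (?l * m - e) * digit_poly m ?l c e (\<lambda>i. poly (u i) s))"
            by (simp add: mult_ac)
        qed
        finally show ?thesis using s by simp
      qed
      then have "R = 0" by (rule poly_fun_zero)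
      have "0 = poly R 0" by (simp add: \<open>R = 0\<close>)
      also have "\<dots> = (\<Sum>e\<in>{a..?l * m}. if e = a then digit_poly m ?l c a (\<lambda>i. poly (u i) 0) else 0)"
        unfolding R by (intro sum.cong refl) (auto simp: hq0)
      also have "\<dots> = digit_poly m ?l c a (\<lambda>i. poly (u i) 0)" using a_le by simp
      also have "\<dots> = digit_poly m ?l c a w"
        unfolding digit_poly_def by (intro sum.cong refl arg_cong2[where f=times] prod.cong) (auto simp: u(2))
      finally show False using w by simp
    qed
  qed
  then have "irreducible_chain (subtopology (zariski V) Y) n Z"
    using closed irr by (simp add: irreducible_chain_def)
  then show ?thesis unfolding krull_dim_chain by (intro Sup_upper) blast
qed

section \<open>Separating lattice points\<close>

type_synonym point = "nat \<times> nat \<times> nat"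

fun monomial :: "'k \<times> 'k \<times> 'k \<Rightarrow> point \<Rightarrow> 'k::field" where
  "monomial (a, b, c) (x, y, z) = a ^ x * b ^ y * c ^ z"

text \<open>
  Under the monomial map, scaling the coefficient and differentiating logarithmically in the three
  coordinates multiply the monomial with exponents \<open>\<alpha>\<close> by \<open>1, x, y, z\<close>.
\<close>

fun weight :: "nat \<Rightarrow> point \<Rightarrow> nat" where
  "weight j (x, y, z) = (if j = 0 then 1 else if j = 1 then x else if j = 2 then y else z)"

fun in_torus :: "'k \<times> 'k \<times> 'k::field \<Rightarrow> bool" where
  "in_torus (a, b, c) \<longleftrightarrow> a \<noteq> 0 \<and> b \<noteq> 0 \<and> c \<noteq> 0"

text \<open>
  Independence of the columns with index in \<open>C\<close> of the matrix whose \<open>4 * k\<close> rows span, for generic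
  points and up to a rescaling of the coordinates, the affine tangent space to the secant variety.
\<close>

definition separates :: "nat \<Rightarrow> (nat \<Rightarrow> 'k \<times> 'k \<times> 'k::field) \<Rightarrow> point set \<Rightarrow> bool" where
  "separates k q C \<longleftrightarrow> (\<forall>c. (\<forall>i<k. \<forall>j<4. (\<Sum>\<alpha>\<in>C. c \<alpha> * (of_nat (weight j \<alpha>) * monomial (q i) \<alpha>)) = 0)
     \<longrightarrow> (\<forall>\<alpha>\<in>C. c \<alpha> = 0))"

definition separable :: "'k::field itself \<Rightarrow> nat \<Rightarrow> point set \<Rightarrow> bool" where
  "separable _ k C \<longleftrightarrow> (\<exists>q :: nat \<Rightarrow> 'k \<times> 'k \<times> 'k. (\<forall>i<k. in_torus (q i)) \<and> separates k q C)"

text \<open>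
  Elimination with a pivot that is non-zero at 0: independence at \<open>s = 0\<close> persists wherever the
  product \<open>P\<close> of the pivots does not vanish, so for all but finitely many \<open>s\<close>.
\<close>

lemma independence_generic:
  fixes M :: "'i \<Rightarrow> 'r \<Rightarrow> 'k::field_char_0 poly"
  assumes "finite S"
    and "\<And>c. (\<And>r. r \<in> R \<Longrightarrow> (\<Sum>i\<in>S. c i * poly (M i r) 0) = 0) \<Longrightarrow> \<forall>i\<in>S. c i = 0"
  shows "\<exists>P. P \<noteq> 0 \<and> (\<forall>s. poly P s \<noteq> 0 \<longrightarrow>
    (\<forall>c. (\<forall>r\<in>R. (\<Sum>i\<in>S. c i * poly (M i r) s) = 0) \<longrightarrow> (\<forall>i\<in>S. c i = 0)))"
  using assms
proof (induction S arbitrary: M rule: finite_induct)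
  case empty show ?case by (intro exI[of _ 1]) simp
next
  case (insert i0 S)
  have "\<exists>r\<in>R. poly (M i0 r) 0 \<noteq> 0"
  proof (rule ccontr)
    assume "\<not> ?thesis"
    then have "(\<Sum>i\<in>insert i0 S. (if i = i0 then 1 else 0) * poly (M i r) 0) = 0" if "r \<in> R" for r
      using that insert.hyps by (auto intro!: sum.neutral)
    from insert.prems[OF this] show False by auto
  qed
  then obtain r0 where r0: "r0 \<in> R" "poly (M i0 r0) 0 \<noteq> 0" by blast
  define M' where "M' i r = M i0 r0 * M i r - M i r0 * M i0 r" for i r
  have M': "(\<Sum>i\<in>S. c i * poly (M' i r) s) = poly (M i0 r0) s * (\<Sum>i\<in>S. c i * poly (M i r) s)
      - (\<Sum>i\<in>S. c i * poly (M i r0) s) * poly (M i0 r) s" for c r s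
    unfolding M'_def by (simp add: sum_distrib_left sum_distrib_right sum_subtractf algebra_simps)
  have "\<exists>P. P \<noteq> 0 \<and> (\<forall>s. poly P s \<noteq> 0 \<longrightarrow>
    (\<forall>c. (\<forall>r\<in>R. (\<Sum>i\<in>S. c i * poly (M' i r) s) = 0) \<longrightarrow> (\<forall>i\<in>S. c i = 0)))"
  proof (rule insert.IH)
    fix c assume c: "\<And>r. r \<in> R \<Longrightarrow> (\<Sum>i\<in>S. c i * poly (M' i r) 0) = 0"
    define d where "d i = (if i = i0 then - (\<Sum>i\<in>S. c i * poly (M i r0) 0) else poly (M i0 r0) 0 * c i)" for i
    have "(\<Sum>i\<in>insert i0 S. d i * poly (M i r) 0) = 0" if "r \<in> R" for r
    proof -
      have "(\<Sum>i\<in>S. d i * poly (M i r) 0) = poly (M i0 r0) 0 * (\<Sum>i\<in>S. c i * poly (M i r) 0)"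
        unfolding sum_distrib_left using insert.hyps by (intro sum.cong) (auto simp: d_def)
      then show ?thesis using insert.hyps c[OF that] by (simp add: M' d_def)
    qed
    from insert.prems[OF this] have "\<forall>i\<in>S. d i = 0" by simp
    then show "\<forall>i\<in>S. c i = 0" using insert.hyps r0 by (auto simp: d_def split: if_splits)
  qed
  then obtain P where P: "P \<noteq> 0" and P': "\<forall>s. poly P s \<noteq> 0 \<longrightarrow>
    (\<forall>c. (\<forall>r\<in>R. (\<Sum>i\<in>S. c i * poly (M' i r) s) = 0) \<longrightarrow> (\<forall>i\<in>S. c i = 0))"
    by (elim exE conjE)
  show ?case
  proof (intro exI[of _ "M i0 r0 * P"] conjI allI impI)
    show "M i0 r0 * P \<noteq> 0" using P r0(2) by auto
    fix s c assume s: "poly (M i0 r0 * P) s \<noteq> 0" and c: "\<forall>r\<in>R. (\<Sum>i\<in>insert i0 S. c i * poly (M i r) s) = 0"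
    have e: "(\<Sum>i\<in>S. c i * poly (M i r) s) = - (c i0 * poly (M i0 r) s)" if "r \<in> R" for r
      using c[rule_format, OF that] insert.hyps by (simp add: eq_neg_iff_add_eq_0 add.commute)
    have "(\<Sum>i\<in>S. c i * poly (M' i r) s) = 0" if "r \<in> R" for r
      unfolding M' using e[OF that] e[OF r0(1)] by simp
    moreover have "poly P s \<noteq> 0" using s by auto
    ultimately have S: "\<forall>i\<in>S. c i = 0" using P'[THEN spec[of _ s], THEN mp, THEN spec[of _ c]] by simp
    then have "(\<Sum>i\<in>S. c i * poly (M i r0) s) = 0" by (intro sum.neutral) auto
    then have "c i0 = 0" using e[OF r0(1)] s by simp
    then show "\<forall>i\<in>insert i0 S. c i = 0" using S by simp
  qed
qed

fun affine_form :: "nat \<times> nat \<times> nat \<times> nat \<Rightarrow> point \<Rightarrow> nat" where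
  "affine_form (p0, p1, p2, p3) (x, y, z) = p0 + p1 * x + p2 * y + p3 * z"

text \<open>
  A one-parameter group of the torus. On the monomial with exponents \<open>\<alpha>\<close> it acts by the power of \<open>s\<close>
  given by the affine form, up to the constant term.
\<close>

fun torus_shift :: "nat \<times> nat \<times> nat \<times> nat \<Rightarrow> 'k::field \<Rightarrow> 'k \<times> 'k \<times> 'k \<Rightarrow> 'k \<times> 'k \<times> 'k" where
  "torus_shift (p0, p1, p2, p3) s (a, b, c) = (a * s ^ p1, b * s ^ p2, c * s ^ p3)"

lemma monomial_torus_shift:
  "s ^ fst p * monomial (torus_shift p s q) \<alpha> = s ^ affine_form p \<alpha> * monomial q \<alpha>"
  by (cases p; cases q; cases \<alpha>) (simp add: power_mult_distrib power_add power_mult[symmetric] mult_ac)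

lemma in_torus_shift: "in_torus q \<Longrightarrow> s \<noteq> 0 \<Longrightarrow> in_torus (torus_shift p s q)"
  by (cases p; cases q) simp

text \<open>
  Shift the points of the first family by the one-parameter group of \<open>f1\<close>, those of the second by
  that of \<open>f2\<close>, and divide the column of \<open>\<alpha>\<close> by \<open>s\<close> to the power \<open>min (f1 \<alpha>) (f2 \<alpha>)\<close>. On \<open>C1\<close> the first
  exponent is smaller, on \<open>C2\<close> the second, so for \<open>s = 0\<close> the matrix is block diagonal with
  the two given independent blocks.
\<close>

lemma separable_cut_affine:
  assumes sep: "separable TYPE('k::field_char_0) k1 C1" "separable TYPE('k) k2 C2"
    and fin: "finite C1" "finite C2"
    and C1: "\<And>\<alpha>. \<alpha> \<in> C1 \<Longrightarrow> affine_form f1 \<alpha> < affine_form f2 \<alpha>"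
    and C2: "\<And>\<alpha>. \<alpha> \<in> C2 \<Longrightarrow> affine_form f2 \<alpha> < affine_form f1 \<alpha>"
  shows "separable TYPE('k) (k1 + k2) (C1 \<union> C2)"
proof -
  obtain q1 :: "nat \<Rightarrow> 'k \<times> 'k \<times> 'k" where q1: "\<And>i. i < k1 \<Longrightarrow> in_torus (q1 i)" "separates k1 q1 C1"
    using sep(1) unfolding separable_def by blast
  obtain q2 :: "nat \<Rightarrow> 'k \<times> 'k \<times> 'k" where q2: "\<And>i. i < k2 \<Longrightarrow> in_torus (q2 i)" "separates k2 q2 C2"
    using sep(2) unfolding separable_def by blast
  define q where "q i = (if i < k1 then q1 i else q2 (i - k1))" for i
  define f where "f i = (if i < k1 then f1 else f2)" for i
  define mn where "mn \<alpha> = min (affine_form f1 \<alpha>) (affine_form f2 \<alpha>)" for \<alpha>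
  define M :: "point \<Rightarrow> nat \<times> nat \<Rightarrow> 'k poly" where
    "M \<alpha> = (\<lambda>(i, j). monom (of_nat (weight j \<alpha>) * monomial (q i) \<alpha>) (affine_form (f i) \<alpha> - mn \<alpha>))" for \<alpha>
  let ?R = "{(i, j). i < k1 + k2 \<and> j < (4::nat)}"
  have disj: "C1 \<inter> C2 = {}" using C1 C2 by (meson disjoint_iff less_asym)
  have "\<exists>P. P \<noteq> 0 \<and> (\<forall>s. poly P s \<noteq> 0 \<longrightarrow>
    (\<forall>c. (\<forall>r\<in>?R. (\<Sum>\<alpha>\<in>C1 \<union> C2. c \<alpha> * poly (M \<alpha> r) s) = 0) \<longrightarrow> (\<forall>\<alpha>\<in>C1 \<union> C2. c \<alpha> = 0)))"
  proof (rule independence_generic)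
    show "finite (C1 \<union> C2)" using fin by simp
    fix c assume c: "\<And>r. r \<in> ?R \<Longrightarrow> (\<Sum>\<alpha>\<in>C1 \<union> C2. c \<alpha> * poly (M \<alpha> r) 0) = 0"
    have "(\<Sum>\<alpha>\<in>C1. c \<alpha> * (of_nat (weight j \<alpha>) * monomial (q1 i) \<alpha>)) = 0" if i: "i < k1" "j < 4" for i j
    proof -
      have "0 = (\<Sum>\<alpha>\<in>C1 \<union> C2. c \<alpha> * poly (M \<alpha> (i, j)) 0)" using c[of "(i, j)"] i by simp
      also have "\<dots> = (\<Sum>\<alpha>\<in>C1. c \<alpha> * poly (M \<alpha> (i, j)) 0) + (\<Sum>\<alpha>\<in>C2. c \<alpha> * poly (M \<alpha> (i, j)) 0)"
        by (rule sum.union_disjoint[OF fin disj])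
      also have "(\<Sum>\<alpha>\<in>C2. c \<alpha> * poly (M \<alpha> (i, j)) 0) = 0"
        using C2 i by (intro sum.neutral) (auto simp: M_def poly_monom f_def mn_def)
      also have "(\<Sum>\<alpha>\<in>C1. c \<alpha> * poly (M \<alpha> (i, j)) 0) = (\<Sum>\<alpha>\<in>C1. c \<alpha> * (of_nat (weight j \<alpha>) * monomial (q1 i) \<alpha>))"
        using C1 i by (intro sum.cong refl) (auto simp: M_def poly_monom f_def q_def mn_def min_def less_imp_le)
      finally show ?thesis by simp
    qed
    then have 1: "\<forall>\<alpha>\<in>C1. c \<alpha> = 0" using q1(2) unfolding separates_def by blast
    have "(\<Sum>\<alpha>\<in>C2. c \<alpha> * (of_nat (weight j \<alpha>) * monomial (q2 i) \<alpha>)) = 0" if i: "i < k2" "j < 4" for i j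
    proof -
      have "0 = (\<Sum>\<alpha>\<in>C1 \<union> C2. c \<alpha> * poly (M \<alpha> (k1 + i, j)) 0)" using c[of "(k1 + i, j)"] i by simp
      also have "\<dots> = (\<Sum>\<alpha>\<in>C1. c \<alpha> * poly (M \<alpha> (k1 + i, j)) 0) + (\<Sum>\<alpha>\<in>C2. c \<alpha> * poly (M \<alpha> (k1 + i, j)) 0)"
        by (rule sum.union_disjoint[OF fin disj])
      also have "(\<Sum>\<alpha>\<in>C1. c \<alpha> * poly (M \<alpha> (k1 + i, j)) 0) = 0"
        using 1 by (intro sum.neutral) auto
      also have "(\<Sum>\<alpha>\<in>C2. c \<alpha> * poly (M \<alpha> (k1 + i, j)) 0) = (\<Sum>\<alpha>\<in>C2. c \<alpha> * (of_nat (weight j \<alpha>) * monomial (q2 i) \<alpha>))"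
        using C2 i by (intro sum.cong refl) (force simp: M_def poly_monom f_def q_def mn_def min_def)
      finally show ?thesis by simp
    qed
    then have 2: "\<forall>\<alpha>\<in>C2. c \<alpha> = 0" using q2(2) unfolding separates_def by blast
    show "\<forall>\<alpha>\<in>C1 \<union> C2. c \<alpha> = 0" using 1 2 by blast
  qed
  then obtain P where P: "P \<noteq> 0" and P': "\<forall>s. poly P s \<noteq> 0 \<longrightarrow>
    (\<forall>c. (\<forall>r\<in>?R. (\<Sum>\<alpha>\<in>C1 \<union> C2. c \<alpha> * poly (M \<alpha> r) s) = 0) \<longrightarrow> (\<forall>\<alpha>\<in>C1 \<union> C2. c \<alpha> = 0))"
    by (elim exE conjE)
  obtain s where s: "s \<noteq> 0" "poly P s \<noteq> 0" using poly_fun_zero[of P] P by blast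
  define q' where "q' i = torus_shift (f i) s (q i)" for i
  have "separates (k1 + k2) q' (C1 \<union> C2)"
    unfolding separates_def
  proof (intro allI impI)
    fix c assume c: "\<forall>i<k1 + k2. \<forall>j<4. (\<Sum>\<alpha>\<in>C1 \<union> C2. c \<alpha> * (of_nat (weight j \<alpha>) * monomial (q' i) \<alpha>)) = 0"
    have "(\<Sum>\<alpha>\<in>C1 \<union> C2. (c \<alpha> * s ^ mn \<alpha>) * poly (M \<alpha> r) s) = 0" if r: "r \<in> ?R" for r
    proof -
      obtain i j where ij: "r = (i, j)" "i < k1 + k2" "j < 4" using r by auto
      have "(c \<alpha> * s ^ mn \<alpha>) * poly (M \<alpha> r) s
          = s ^ fst (f i) * (c \<alpha> * (of_nat (weight j \<alpha>) * monomial (q' i) \<alpha>))" for \<alpha>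
      proof -
        have "mn \<alpha> + (affine_form (f i) \<alpha> - mn \<alpha>) = affine_form (f i) \<alpha>"
          by (simp add: mn_def f_def)
        then have "s ^ mn \<alpha> * s ^ (affine_form (f i) \<alpha> - mn \<alpha>) = s ^ affine_form (f i) \<alpha>"
          by (simp flip: power_add)
        moreover have "s ^ fst (f i) * monomial (q' i) \<alpha> = s ^ affine_form (f i) \<alpha> * monomial (q i) \<alpha>"
          unfolding q'_def by (rule monomial_torus_shift)
        ultimately show ?thesis
          by (simp add: ij M_def poly_monom)
      qed
      then have "(\<Sum>\<alpha>\<in>C1 \<union> C2. (c \<alpha> * s ^ mn \<alpha>) * poly (M \<alpha> r) s)
        = s ^ fst (f i) * (\<Sum>\<alpha>\<in>C1 \<union> C2. c \<alpha> * (of_nat (weight j \<alpha>) * monomial (q' i) \<alpha>))"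
        by (simp only: sum_distrib_left)
      then show ?thesis using c ij by simp
    qed
    then have "\<forall>\<alpha>\<in>C1 \<union> C2. c \<alpha> * s ^ mn \<alpha> = 0"
      using P'[THEN spec[of _ s], THEN mp, OF s(2), THEN spec[of _ "\<lambda>\<alpha>. c \<alpha> * s ^ mn \<alpha>"]] by blast
    then show "\<forall>\<alpha>\<in>C1 \<union> C2. c \<alpha> = 0" using s(1) by simp
  qed
  moreover have "in_torus (q' i)" if "i < k1 + k2" for i
    unfolding q'_def using that q1(1) q2(1) s(1) by (intro in_torus_shift) (auto simp: q_def)
  ultimately show ?thesis unfolding separable_def by blast
qed

fun linear_value :: "int \<times> int \<times> int \<Rightarrow> point \<Rightarrow> int" where
  "linear_value (a, b, c) (x, y, z) = a * int x + b * int y + c * int z"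

text \<open>
  The plane at height \<open>m - 1/2\<close> contains no lattice point. Doubled, its equation has integer coefficients; their
  positive and negative parts give two affine forms that
  compare like \<open>h\<close> with \<open>m\<close> and have natural numbers as coefficients.
\<close>

lemma separable_cut:
  assumes sep: "separable TYPE('k::field_char_0) k1 C1" "separable TYPE('k) k2 C2"
    and fin: "finite C1" "finite C2"
    and C1: "\<And>\<alpha>. \<alpha> \<in> C1 \<Longrightarrow> linear_value h \<alpha> < m" and C2: "\<And>\<alpha>. \<alpha> \<in> C2 \<Longrightarrow> linear_value h \<alpha> \<ge> m"
  shows "separable TYPE('k) (k1 + k2) (C1 \<union> C2)"
proof -
  obtain a b c where h: "h = (a, b, c)" by (cases h)
  let ?f1 = "(nat (1 - 2 * m), nat (2 * a), nat (2 * b), nat (2 * c))"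
  let ?f2 = "(nat (2 * m - 1), nat (- 2 * a), nat (- 2 * b), nat (- 2 * c))"
  have *: "int (affine_form ?f1 \<alpha>) - int (affine_form ?f2 \<alpha>) = 2 * linear_value h \<alpha> - (2 * m - 1)" for \<alpha>
  proof -
    obtain x y z where \<alpha>: "\<alpha> = (x, y, z)" by (cases \<alpha>)
    have e: "int (nat t) = int (nat (- t)) + t" for t by simp
    show ?thesis
      unfolding \<alpha> h using e[of "2 * a"] e[of "2 * b"] e[of "2 * c"] e[of "1 - 2 * m"] by (simp add: algebra_simps)
  qed
  have "affine_form ?f1 \<alpha> < affine_form ?f2 \<alpha>" if "\<alpha> \<in> C1" for \<alpha>
    using *[of \<alpha>] C1[OF that] by linarith
  moreover have "affine_form ?f2 \<alpha> < affine_form ?f1 \<alpha>" if "\<alpha> \<in> C2" for \<alpha>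
    using *[of \<alpha>] C2[OF that] by linarith
  ultimately show ?thesis using separable_cut_affine[OF sep fin] by blast
qed

lemma separable_mono:
  assumes "separable TYPE('k::field) k C" "k \<le> l"
  shows "separable TYPE('k) l C"
proof -
  obtain q :: "nat \<Rightarrow> 'k \<times> 'k \<times> 'k" where q: "\<And>i. i < k \<Longrightarrow> in_torus (q i)" "separates k q C"
    using assms(1) unfolding separable_def by blast
  define q' where "q' i = (if i < k then q i else (1, 1, 1))" for i
  have "separates l q' C" using q(2) assms(2) unfolding separates_def by (simp add: q'_def)
  moreover have "in_torus (q' i)" for i using q(1) by (simp add: q'_def)
  ultimately show ?thesis unfolding separable_def by blast
qed

fun translate :: "point \<Rightarrow> point \<Rightarrow> point" where
  "translate (s, t, u) (x, y, z) = (x + s, y + t, z + u)"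

lemma inj_translate: "inj_on (translate \<tau>) C"
  by (cases \<tau>) (auto simp: inj_on_def)

lemma weight_translate: "j \<noteq> 0 \<Longrightarrow> weight j (translate \<tau> \<alpha>) = weight j \<alpha> + weight j \<tau>"
  by (cases \<tau>; cases \<alpha>) auto

lemma weight_0: "weight 0 \<alpha> = 1"
  by (cases \<alpha>) auto

lemma monomial_translate: "monomial q (translate \<tau> \<alpha>) = monomial q \<tau> * monomial q \<alpha>"
  by (cases \<tau>; cases \<alpha>; cases q) (auto simp: power_add)

lemma monomial_nonzero: "in_torus q \<Longrightarrow> monomial q \<alpha> \<noteq> 0"
  by (cases \<alpha>; cases q) auto

text \<open>
  Translation multiplies each row by a non-zero monomial and adds multiples of the row of weight 1
  to the other three rows of the same point.
\<close>

lemma separable_translate: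
  assumes "separable TYPE('k::field) k C"
  shows "separable TYPE('k) k (translate \<tau> ` C)"
proof -
  obtain q :: "nat \<Rightarrow> 'k \<times> 'k \<times> 'k" where q: "\<And>i. i < k \<Longrightarrow> in_torus (q i)" "separates k q C"
    using assms(1) unfolding separable_def by blast
  have "separates k q (translate \<tau> ` C)" unfolding separates_def
  proof (intro allI impI)
    fix c assume c: "\<forall>i<k. \<forall>j<4. (\<Sum>\<alpha>\<in>translate \<tau> ` C. c \<alpha> * (of_nat (weight j \<alpha>) * monomial (q i) \<alpha>)) = 0"
    let ?S = "\<lambda>i j. \<Sum>\<alpha>\<in>C. c (translate \<tau> \<alpha>) * (of_nat (weight j \<alpha>) * monomial (q i) \<alpha>)"
    have e: "(\<Sum>\<alpha>\<in>C. c (translate \<tau> \<alpha>) * (of_nat (weight j (translate \<tau> \<alpha>)) * (monomial (q i) \<tau> * monomial (q i) \<alpha>))) = 0"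
      if "i < k" "j < 4" for i j
      using c that by (simp add: sum.reindex[OF inj_translate] monomial_translate)
    have s0: "?S i 0 = 0" if i: "i < k" for i
    proof -
      have "monomial (q i) \<tau> * ?S i 0 = 0"
        using e[OF i, of 0] by (simp add: weight_0 sum_distrib_left mult_ac)
      then show ?thesis using monomial_nonzero[OF q(1)[OF i]] by simp
    qed
    have "?S i j = 0" if ij: "i < k" "j < 4" for i j
    proof (cases "j = 0")
      case True then show ?thesis using s0 ij by simp
    next
      case False
      have "monomial (q i) \<tau> * (?S i j + of_nat (weight j \<tau>) * ?S i 0) = 0"
        using e[OF ij] by (simp add: weight_0 weight_translate[OF False] sum_distrib_left sum.distrib algebra_simps)
      then show ?thesis using monomial_nonzero[OF q(1)[OF ij(1)]] s0[OF ij(1)] by simp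
    qed
    then have "\<forall>\<alpha>\<in>C. c (translate \<tau> \<alpha>) = 0" using q(2) unfolding separates_def
      by (elim allE[of _ "\<lambda>\<alpha>. c (translate \<tau> \<alpha>)"]) blast
    then show "\<forall>\<alpha>\<in>translate \<tau> ` C. c \<alpha> = 0" by simp
  qed
  then show ?thesis using q(1) unfolding separable_def by blast
qed

section \<open>Cutting plans\<close>

fun difference :: "point \<Rightarrow> point \<Rightarrow> int \<times> int \<times> int" where
  "difference (x, y, z) (x', y', z') = (int x - int x', int y - int y', int z - int z')"

fun cross_product :: "int \<times> int \<times> int \<Rightarrow> int \<times> int \<times> int \<Rightarrow> int \<times> int \<times> int" where
  "cross_product (u1, u2, u3) (v1, v2, v3) = (u2 * v3 - u3 * v2, u3 * v1 - u1 * v3, u1 * v2 - u2 * v1)"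

fun dot_product :: "int \<times> int \<times> int \<Rightarrow> int \<times> int \<times> int \<Rightarrow> int" where
  "dot_product (u1, u2, u3) (v1, v2, v3) = u1 * v1 + u2 * v2 + u3 * v3"

text \<open>
  Given by determinants of integers, so that it can be evaluated on explicit points.
\<close>

fun affine_independent :: "point list \<Rightarrow> bool" where
  "affine_independent [] \<longleftrightarrow> True"
| "affine_independent [a] \<longleftrightarrow> True"
| "affine_independent [a, b] \<longleftrightarrow> a \<noteq> b"
| "affine_independent [a, b, c] \<longleftrightarrow> cross_product (difference b a) (difference c a) \<noteq> (0, 0, 0)"
| "affine_independent [a, b, c, d] \<longleftrightarrow>
     dot_product (cross_product (difference b a) (difference c a)) (difference d a) \<noteq> 0"
| "affine_independent _ \<longleftrightarrow> False"

text \<open>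
  At the point \<open>(1, 1, 1)\<close> all monomials are 1, and a dependence between columns is an affine
  dependence between lattice points.
\<close>

lemma separable_affine_relations:
  assumes "\<And>c :: point \<Rightarrow> 'k::field. (\<And>j. j < 4 \<Longrightarrow> (\<Sum>\<alpha>\<in>C. c \<alpha> * of_nat (weight j \<alpha>)) = 0) \<Longrightarrow> \<forall>\<alpha>\<in>C. c \<alpha> = 0"
  shows "separable TYPE('k) 1 C"
  unfolding separable_def
proof (intro exI conjI)
  have "monomial (1, 1, 1) \<alpha> = (1::'k)" for \<alpha> by (cases \<alpha>) simp
  then show "separates 1 (\<lambda>i. (1, 1, 1) :: 'k \<times> 'k \<times> 'k) C"
    unfolding separates_def using assms by simp
qed simp

lemma linear_independence_det3:
  fixes b c d :: "'k::idom"
  assumes "b * u1 + c * v1 + d * w1 = 0" "b * u2 + c * v2 + d * w2 = 0" "b * u3 + c * v3 + d * w3 = 0"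
  defines "D \<equiv> (u2 * v3 - u3 * v2) * w1 + (u3 * v1 - u1 * v3) * w2 + (u1 * v2 - u2 * v1) * w3"
  assumes "D \<noteq> 0"
  shows "b = 0" "c = 0" "d = 0"
proof -
  have "b * D = 0" "c * D = 0" "d * D = 0"
    unfolding D_def using assms(1-3) by algebra+
  then show "b = 0" "c = 0" "d = 0" using \<open>D \<noteq> 0\<close> by auto
qed

lemma separable_affine_independent:
  assumes "affine_independent cs"
  shows "separable TYPE('k::field_char_0) 1 (set cs)"
proof (rule separable_affine_relations)
  fix c :: "point \<Rightarrow> 'k"
  assume c: "\<And>j. j < 4 \<Longrightarrow> (\<Sum>\<alpha>\<in>set cs. c \<alpha> * of_nat (weight j \<alpha>)) = 0"
  note c = c[of 0] c[of 1] c[of 2] c[of 3]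
  show "\<forall>\<alpha>\<in>set cs. c \<alpha> = 0"
    using assms
  proof (cases rule: affine_independent.cases[of cs])
    case (2 a) then show ?thesis using c by (cases a) simp
  next
    case (3 p q)
    obtain x y z x' y' z' where pq: "p = (x, y, z)" "q = (x', y', z')" by (cases p; cases q) auto
    have "p \<noteq> q" using 3 assms by simp
    then have eq: "c p + c q = 0" "c p * of_nat x + c q * of_nat x' = 0" "c p * of_nat y + c q * of_nat y' = 0"
      "c p * of_nat z + c q * of_nat z' = 0"
      using c 3 by (auto simp: pq)
    have "c q * (of_nat x' - of_nat x) = 0" "c q * (of_nat y' - of_nat y) = 0" "c q * (of_nat z' - of_nat z) = 0"
      using eq by algebra+
    then have "c q = 0" using \<open>p \<noteq> q\<close> by (auto simp: pq)
    then show ?thesis using eq 3 by simp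
  next
    case (4 p q r)
    obtain x y z x' y' z' x'' y'' z'' where pq: "p = (x, y, z)" "q = (x', y', z')" "r = (x'', y'', z'')"
      by (cases p; cases q; cases r) auto
    have ne: "cross_product (difference q p) (difference r p) \<noteq> (0, 0, 0)" using 4 assms by simp
    then have d: "p \<noteq> q" "p \<noteq> r" "q \<noteq> r" unfolding pq by (auto simp: mult.commute)
    have eq: "c p + (c q + c r) = 0" "c p * of_nat x + (c q * of_nat x' + c r * of_nat x'') = 0"
      "c p * of_nat y + (c q * of_nat y' + c r * of_nat y'') = 0" "c p * of_nat z + (c q * of_nat z' + c r * of_nat z'') = 0"
      using c d 4 by (auto simp: pq)
    define u1 u2 u3 v1 v2 v3 where uv: "u1 = int x' - int x" "u2 = int y' - int y" "u3 = int z' - int z"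
      "v1 = int x'' - int x" "v2 = int y'' - int y" "v3 = int z'' - int z"
    have e: "c q * of_int u1 + c r * of_int v1 = 0" "c q * of_int u2 + c r * of_int v2 = 0" "c q * of_int u3 + c r * of_int v3 = 0"
      using eq unfolding uv of_int_diff of_int_of_nat_eq by algebra+
    have "u2 * v3 - u3 * v2 \<noteq> 0 \<or> u3 * v1 - u1 * v3 \<noteq> 0 \<or> u1 * v2 - u2 * v1 \<noteq> 0"
      using ne unfolding pq uv by simp
    then have ne': "of_int u2 * of_int v3 - of_int u3 * of_int v2 \<noteq> (0::'k) \<or> of_int u3 * of_int v1 - of_int u1 * of_int v3 \<noteq> (0::'k)
      \<or> of_int u1 * of_int v2 - of_int u2 * of_int v1 \<noteq> (0::'k)"
      unfolding of_int_mult[symmetric] of_int_diff[symmetric] of_int_eq_0_iff .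
    have "c q * (of_int u2 * of_int v3 - of_int u3 * of_int v2) = 0" "c q * (of_int u3 * of_int v1 - of_int u1 * of_int v3) = 0"
      "c q * (of_int u1 * of_int v2 - of_int u2 * of_int v1) = 0"
      using e by algebra+
    then have "c q = 0" using ne' by auto
    moreover have "c r * (of_int u2 * of_int v3 - of_int u3 * of_int v2) = 0" "c r * (of_int u3 * of_int v1 - of_int u1 * of_int v3) = 0"
      "c r * (of_int u1 * of_int v2 - of_int u2 * of_int v1) = 0"
      using e by algebra+
    then have "c r = 0" using ne' by auto
    ultimately show ?thesis using eq(1) 4 by simp
  next
    case (5 p q r s)
    obtain x y z x' y' z' x'' y'' z'' x3 y3 z3 where pq: "p = (x, y, z)" "q = (x', y', z')" "r = (x'', y'', z'')"
      "s = (x3, y3, z3)"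
      by (cases p; cases q; cases r; cases s) auto
    have ne: "dot_product (cross_product (difference q p) (difference r p)) (difference s p) \<noteq> 0" using 5 assms by simp
    then have d: "p \<noteq> q" "p \<noteq> r" "q \<noteq> r" "p \<noteq> s" "q \<noteq> s" "r \<noteq> s" unfolding pq by (auto simp: algebra_simps)
    have eq: "c p + (c q + (c r + c s)) = 0" "c p * of_nat x + (c q * of_nat x' + (c r * of_nat x'' + c s * of_nat x3)) = 0"
      "c p * of_nat y + (c q * of_nat y' + (c r * of_nat y'' + c s * of_nat y3)) = 0"
      "c p * of_nat z + (c q * of_nat z' + (c r * of_nat z'' + c s * of_nat z3)) = 0"
      using c d 5 by (auto simp: pq)
    define u1 u2 u3 v1 v2 v3 w1 w2 w3 where uv: "u1 = int x' - int x" "u2 = int y' - int y" "u3 = int z' - int z"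
      "v1 = int x'' - int x" "v2 = int y'' - int y" "v3 = int z'' - int z"
      "w1 = int x3 - int x" "w2 = int y3 - int y" "w3 = int z3 - int z"
    have e: "c q * of_int u1 + c r * of_int v1 + c s * of_int w1 = 0" "c q * of_int u2 + c r * of_int v2 + c s * of_int w2 = 0"
      "c q * of_int u3 + c r * of_int v3 + c s * of_int w3 = 0"
      using eq unfolding uv of_int_diff of_int_of_nat_eq by algebra+
    have "(u2 * v3 - u3 * v2) * w1 + (u3 * v1 - u1 * v3) * w2 + (u1 * v2 - u2 * v1) * w3 \<noteq> 0"
      using ne unfolding pq uv by simp
    then have "of_int ((u2 * v3 - u3 * v2) * w1 + (u3 * v1 - u1 * v3) * w2 + (u1 * v2 - u2 * v1) * w3) \<noteq> (0::'k)"
      unfolding of_int_eq_0_iff .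
    then have D: "(of_int u2 * of_int v3 - of_int u3 * of_int v2) * of_int w1 + (of_int u3 * of_int v1 - of_int u1 * of_int v3) * of_int w2
      + (of_int u1 * of_int v2 - of_int u2 * of_int v1) * of_int w3 \<noteq> (0::'k)"
      unfolding of_int_add of_int_mult of_int_diff .
    from linear_independence_det3[OF e D] show ?thesis using eq(1) 5 by simp
  qed auto
qed

text \<open>
  \<open>Cut a b c m l r\<close> separates the points with \<open>a x + b y + c z < m\<close>, which are cut further according
  to \<open>l\<close>, from the others, which are cut according to \<open>r\<close>.
\<close>

datatype plan = Cell | Cut int int int int plan plan

fun cells :: "plan \<Rightarrow> point list \<Rightarrow> point list list" where
  "cells Cell ps = [ps]"
| "cells (Cut a b c m l r) ps =
     cells l (filter (\<lambda>p. linear_value (a, b, c) p < m) ps) @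
     cells r (filter (\<lambda>p. \<not> linear_value (a, b, c) p < m) ps)"

lemma mset_cells: "mset (concat (cells t ps)) = mset ps"
proof (induction t arbitrary: ps)
  case (Cut a b c m l r)
  then show ?case
    using multiset_partition[of "mset ps" "\<lambda>p. linear_value (a, b, c) p < m"] by (simp add: mset_filter)
qed simp

lemma set_cells: "cs \<in> set (cells t ps) \<Longrightarrow> set cs \<subseteq> set ps"
  using arg_cong[OF mset_cells[of t ps], of set_mset] by auto

text \<open>
  The predicate \<open>Q\<close> selects cells. It is used for all cells and for those with four points, and the
  planes that cut the whole set also cut a union of selected cells.
\<close>

lemma separable_cells:
  assumes "\<forall>cs\<in>set (cells t ps). affine_independent cs"
  shows "separable TYPE('k::field_char_0) (length (filter Q (cells t ps))) (\<Union>cs\<in>set (filter Q (cells t ps)). set cs)"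
  using assms
proof (induction t arbitrary: ps)
  case Cell
  have "separable TYPE('k) 0 {}" by (simp add: separable_def separates_def)
  moreover have "separable TYPE('k) 1 (set ps)" using Cell by (intro separable_affine_independent) simp
  ultimately show ?case by (cases "Q ps") simp_all
next
  case (Cut a b c m l r)
  let ?l = "filter (\<lambda>p. linear_value (a, b, c) p < m) ps" and ?r = "filter (\<lambda>p. \<not> linear_value (a, b, c) p < m) ps"
  let ?L = "\<Union>cs\<in>set (filter Q (cells l ?l)). set cs" and ?R = "\<Union>cs\<in>set (filter Q (cells r ?r)). set cs"
  have "separable TYPE('k) (length (filter Q (cells l ?l)) + length (filter Q (cells r ?r))) (?L \<union> ?R)"
  proof (rule separable_cut[where h="(a, b, c)" and m=m])
    show "separable TYPE('k) (length (filter Q (cells l ?l))) ?L" using Cut.prems by (intro Cut.IH) simp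
    show "separable TYPE('k) (length (filter Q (cells r ?r))) ?R" using Cut.prems by (intro Cut.IH) simp
    show "finite ?L" "finite ?R" by auto
    fix \<alpha>
    show "linear_value (a, b, c) \<alpha> < m" if "\<alpha> \<in> ?L" using that set_cells[of _ l ?l] by fastforce
    show "linear_value (a, b, c) \<alpha> \<ge> m" if "\<alpha> \<in> ?R" using that set_cells[of _ r ?r] by fastforce
  qed
  then show ?case by (simp only: cells.simps filter_append length_append set_append UN_Un)
qed

text \<open>
  With \<open>k\<close> points the rank is as large as possible on a set of \<open>4 * k + r\<close> lattice points, namely \<open>4 * k\<close>,
  and it is full with one more point, or already with \<open>k\<close> points if \<open>r = 0\<close>. For \<open>r < 4\<close> these two facts
  decide the rank for every number of points.
\<close>

definition tileable :: "'k::field itself \<Rightarrow> nat \<Rightarrow> point set \<Rightarrow> bool" where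
  "tileable T r A \<longleftrightarrow> finite A \<and> (\<exists>k. card A = 4 * k + r \<and> separable T (if r = 0 then k else Suc k) A
     \<and> (\<exists>A'\<subseteq>A. card A' = 4 * k \<and> separable T k A'))"

text \<open>
  Counting suffices to control the sizes: if there are \<open>n\<close> cells of four points and one other cell,
  then the other one consists of the remaining \<open>r\<close> points.
\<close>

definition tiles :: "plan \<Rightarrow> point list \<Rightarrow> nat \<Rightarrow> bool" where
  "tiles t ps r \<longleftrightarrow> (let cs = cells t ps; n = length (filter (\<lambda>c. length c = 4) cs) in
     length ps = 4 * n + r \<and> length cs = (if r = 0 then n else Suc n) \<and> list_all affine_independent cs)"

lemma tileable_if_tiles:
  assumes "tiles t ps r" "distinct ps"
  shows "tileable TYPE('k::field_char_0) r (set ps)"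
proof -
  define cs where "cs = cells t ps"
  define n where "n = length (filter (\<lambda>c. length c = 4) cs)"
  have ok: "\<forall>c\<in>set cs. affine_independent c" and n: "length ps = 4 * n + r" "length cs = (if r = 0 then n else Suc n)"
    using assms(1) by (auto simp: tiles_def Let_def cs_def n_def list_all_iff)
  have U: "(\<Union>c\<in>set cs. set c) = set ps"
    using arg_cong[OF mset_cells[of t ps], of set_mset] by (simp add: cs_def)
  have "separable TYPE('k) (length (filter (\<lambda>_. True) cs)) (\<Union>c\<in>set (filter (\<lambda>_. True) cs). set c)"
    using ok unfolding cs_def by (rule separable_cells)
  then have 1: "separable TYPE('k) (if r = 0 then n else Suc n) (set ps)" using U n by simp
  let ?f = "filter (\<lambda>c. length c = 4) cs"
  have 2: "separable TYPE('k) n (\<Union>c\<in>set ?f. set c)"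
    using ok unfolding n_def cs_def by (rule separable_cells)
  have "distinct (concat cs)"
    using assms(2) mset_cells[of t ps] by (metis cs_def mset_eq_imp_distinct_iff)
  then have "distinct (concat (filter Q cs))" for Q
    by (induction cs) auto
  then have "card (set (concat ?f)) = length (concat ?f)" by (rule distinct_card)
  also have "\<dots> = 4 * n" unfolding n_def by (induction cs) auto
  finally have "card (\<Union>c\<in>set ?f. set c) = 4 * n" by simp
  moreover have "(\<Union>c\<in>set ?f. set c) \<subseteq> set ps" using U by auto
  moreover have "card (set ps) = 4 * n + r" using n(1) distinct_card[OF assms(2)] by simp
  ultimately show ?thesis using 1 2 unfolding tileable_def by blast
qed

section \<open>Cutting plans for small prisms\<close>

definition prism :: "(nat \<times> nat) set \<Rightarrow> nat \<Rightarrow> point set" where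
  "prism P n = {(x, y, z). (x, y) \<in> P \<and> z < n}"

definition lattice_triangle :: "nat \<Rightarrow> (nat \<times> nat) set" where
  "lattice_triangle d = {(x, y). x + y \<le> d}"

text \<open>
  Lists make plans executable; the base of the prism is the region below the graph of \<open>h\<close>.
\<close>

definition prism_list :: "nat \<Rightarrow> (nat \<Rightarrow> nat) \<Rightarrow> nat \<Rightarrow> point list" where
  "prism_list w h n = concat (map (\<lambda>x. concat (map (\<lambda>y. map (\<lambda>z. (x, y, z)) [0..<n]) [0..<h x])) [0..<w])"

lemma set_prism_list: "set (prism_list w h n) = prism {(x, y). x < w \<and> y < h x} n"
  by (auto simp: prism_list_def prism_def image_iff)

lemma distinct_prism_list: "distinct (prism_list w h n)"
proof -
  have 1: "distinct (concat (map (\<lambda>y. map (\<lambda>z. (x, y, z)) [0..<n]) ys))" if "distinct ys" for x :: nat and ys :: "nat list"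
    using that by (induction ys) (auto simp: distinct_map inj_on_def)
  have "distinct (concat (map (\<lambda>x. concat (map (\<lambda>y. map (\<lambda>z. (x, y, z)) [0..<n]) [0..<h x])) xs))" if "distinct xs" for xs :: "nat list"
    using that by (induction xs) (auto simp: 1)
  then show ?thesis unfolding prism_list_def by simp
qed

definition triangle_prism_list :: "nat \<Rightarrow> nat \<Rightarrow> point list" where
  "triangle_prism_list d n = prism_list (Suc d) (\<lambda>x. Suc d - x) n"

text \<open>
  Width 8 makes the number of points a multiple of 8 whatever the other sides are, so that boxes
  can be cut into cells of four points.
\<close>

definition box_list :: "nat \<Rightarrow> nat \<Rightarrow> point list" where
  "box_list m n = prism_list 8 (\<lambda>x. m) n"

lemma set_triangle_prism_list: "set (triangle_prism_list d n) = prism (lattice_triangle d) n"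
proof -
  have "{(x, y). x < Suc d \<and> y < Suc d - x} = lattice_triangle d" by (auto simp: lattice_triangle_def)
  then show ?thesis by (simp add: triangle_prism_list_def set_prism_list)
qed

lemma card_triangle_prism: "card (prism (lattice_triangle d) n) = (\<Sum>x\<le>d. Suc d - x) * n"
proof -
  have t: "lattice_triangle d = (SIGMA x:{..d}. {..<Suc d - x})" by (auto simp: lattice_triangle_def)
  have "prism (lattice_triangle d) n = (\<lambda>((x, y), z). (x, y, z)) ` (lattice_triangle d \<times> {..<n})"
    by (force simp: prism_def image_iff)
  moreover have "inj_on (\<lambda>((x, y), z). (x, y, z)) (lattice_triangle d \<times> {..<n})" by (auto simp: inj_on_def)
  ultimately have "card (prism (lattice_triangle d) n) = card (lattice_triangle d) * n" by (simp add: card_image card_cartesian_product)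
  then show ?thesis unfolding t by simp
qed

lemma finite_triangle_prism: "finite (prism (lattice_triangle d) n)"
  unfolding set_triangle_prism_list[symmetric] by simp

text \<open>
  An entry \<open>(d, n, r, t)\<close> is a plan \<open>t\<close> for the prism with \<open>n\<close> layers over the triangle of side \<open>d\<close>, with
  remainder \<open>r\<close>. Entries with \<open>d \<le> 8\<close> and \<open>2 \<le> n \<le> 5\<close> cover the prisms that are not stacks of
  others. Lowering the side by 8 or the number of layers by 4 can lead to a prism
  that cannot be cut in this way; this is why \<open>(11, 2)\<close> and \<open>(10, 3)\<close>, which would lead to \<open>(3, 2)\<close> and \<open>(2, 3)\<close>, and
  \<open>(3, 6)\<close>, which would lead to \<open>(3, 2)\<close>, are listed too.
\<close>

definition triangle_prism_plans :: "(nat \<times> nat \<times> nat \<times> plan) list" where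
  "triangle_prism_plans = [
    (1, 2, 2, Cut 0 1 1 1 Cell Cell),
    (2, 2, 0, Cut 0 1 (-1) 1 (Cut 1 0 1 2 Cell Cell) Cell),
    (4, 2, 2, Cut 0 1 0 2 (Cut 1 0 0 2 (Cut 1 1 1 2 Cell Cell) (Cut 1 0 0 4 (Cut 1 (-1) (-1) 2 Cell Cell)
      Cell)) (Cut 0 1 (-1) 3 (Cut 1 0 1 2 Cell Cell) Cell)),
    (5, 2, 2, Cut 0 1 0 3 (Cut 1 0 0 3 (Cut 1 1 0 3 (Cut 1 0 (-1) 1 (Cut 0 1 1 2 Cell Cell) Cell) (Cut 1 0
      (-1) 2 Cell Cell)) (Cut 1 0 1 5 (Cut 0 1 (-1) 1 Cell Cell) Cell)) (Cut 0 1 1 5 (Cut 1 0 (-1) 1 Cell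
      Cell) Cell)),
    (6, 2, 0, Cut 1 0 0 4 (Cut 0 1 0 2 (Cut 1 0 0 2 (Cut 1 (-1) (-1) 0 Cell Cell) (Cut 1 (-1) 1 3 Cell Cell))
      (Cut 0 1 0 4 (Cut 1 0 0 2 (Cut 1 1 (-1) 3 Cell Cell) (Cut 1 (-1) (-1) 0 Cell Cell)) (Cut 1 0 1 2 (Cut 0
      1 (-1) 5 Cell Cell) Cell))) (Cut 1 0 1 6 (Cut 0 1 (-1) 1 Cell Cell) Cell)),
    (7, 2, 0, Cut 1 0 0 5 (Cut 0 1 0 5 (Cut 1 1 0 3 (Cut 1 0 (-1) 1 (Cut 0 1 1 2 Cell Cell) Cell) (Cut 1 (-1)
      0 0 (Cut 1 1 0 5 (Cut 0 1 1 4 Cell Cell) (Cut 1 0 1 3 Cell Cell)) (Cut 1 0 (-1) 3 (Cut 0 1 0 2 Cell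
      Cell) (Cut 0 1 (-1) 1 Cell (Cut 1 (-1) 0 2 Cell Cell))))) (Cut 1 0 (-1) 1 (Cut 0 1 1 7 Cell Cell) Cell))
      (Cut 0 1 (-1) 1 (Cut 1 0 1 7 Cell Cell) Cell)),
    (8, 2, 2, Cut 0 1 0 3 (Cut 1 0 0 4 (Cut 1 (-1) 0 1 (Cut 1 0 1 2 (Cut 0 1 1 2 Cell Cell) Cell) (Cut 1 0
      (-1) 2 Cell (Cut 0 1 (-1) 1 Cell Cell))) (Cut 1 (-1) 0 6 (Cut 2 1 0 11 (Cut 1 1 1 6 Cell Cell) (Cut 1 1
      1 8 Cell Cell)) (Cut 1 0 (-1) 7 Cell Cell))) (Cut 0 1 0 6 (Cut 1 0 0 3 (Cut 1 (-1) 0 (-2) (Cut 0 1 (-1)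
      4 Cell (Cut 1 0 (-1) 1 Cell Cell)) (Cut 0 1 1 4 Cell Cell)) (Cut 0 1 (-1) 4 (Cut 1 0 1 5 Cell Cell)
      Cell)) (Cut 0 1 (-1) 7 (Cut 1 0 1 2 Cell Cell) Cell))),
    (11, 2, 0, Cut 1 0 0 4 (Cut 0 1 0 5 (Cut 0 1 0 2 (Cut 1 0 0 2 (Cut 1 (-1) 1 1 Cell Cell) (Cut 1 (-1) 1 3
      Cell Cell)) (Cut 0 1 1 4 (Cut 1 1 0 5 (Cut 1 0 (-1) 1 Cell Cell) Cell) (Cut 1 0 (-1) 2 (Cut 1 1 0 5 Cell
      Cell) Cell))) (Cut 0 1 0 7 (Cut 1 0 0 2 (Cut 1 1 (-1) 6 Cell Cell) (Cut 1 (-1) (-1) (-3) Cell Cell))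
      (Cut 0 1 0 9 (Cut 1 0 0 2 (Cut 1 1 (-1) 8 Cell Cell) (Cut 1 1 1 11 Cell Cell)) (Cut 1 0 (-1) 1 (Cut 0 1
      1 11 Cell Cell) Cell)))) (Cut 0 1 0 5 (Cut 1 0 0 9 (Cut 1 (-1) 0 3 (Cut 0 1 1 4 Cell (Cut 1 0 1 6 Cell
      Cell)) (Cut 0 1 0 3 (Cut 1 1 0 8 (Cut 1 (-1) 0 5 (Cut 0 1 (-1) 1 Cell Cell) (Cut 1 0 (-1) 6 Cell Cell))
      (Cut 0 1 1 2 Cell (Cut 1 0 (-1) 7 Cell Cell))) (Cut 1 0 (-1) 7 Cell Cell))) (Cut 1 0 (-1) 10 (Cut 0 1 1
      2 Cell Cell) Cell)) (Cut 0 1 (-1) 6 (Cut 1 0 1 6 Cell Cell) Cell))),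
    (1, 3, 1, Cut 1 0 1 2 (Cut 0 1 (-1) 1 Cell Cell) Cell),
    (3, 3, 2, Cut 1 0 1 4 (Cut 0 1 1 2 (Cut 1 0 0 2 (Cut 1 0 1 1 Cell Cell) Cell) (Cut 1 1 0 2 Cell (Cut 0 1
      (-1) 2 (Cut 1 (-1) (-1) (-2) Cell Cell) Cell))) Cell),
    (4, 3, 1, Cut 1 0 (-1) 3 (Cut 1 0 0 4 (Cut 0 1 1 5 (Cut 2 (-1) 0 2 (Cut 1 0 1 2 (Cut 0 1 0 3 (Cut 0 1 1 2
      Cell Cell) Cell) (Cut 0 1 0 2 Cell Cell)) (Cut 0 1 1 3 (Cut 1 0 1 4 (Cut 1 (-1) (-1) 1 Cell Cell) Cell)
      Cell)) Cell) Cell) Cell),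
    (5, 3, 3, Cut 1 0 1 4 (Cut 0 1 1 3 (Cut 1 0 0 2 (Cut 1 0 1 2 (Cut 1 (-1) 0 0 Cell Cell) Cell) (Cut 1 (-1)
      0 2 Cell Cell)) (Cut 1 1 0 3 Cell (Cut 1 0 1 2 (Cut 0 1 (-1) 4 Cell Cell) (Cut 0 1 0 4 (Cut 1 (-1) (-1)
      (-2) Cell Cell) Cell)))) (Cut 0 1 0 2 (Cut 0 0 1 1 Cell (Cut 1 (-1) 0 3 Cell (Cut 1 0 1 6 Cell Cell)))
      Cell)),
    (6, 3, 0, Cut 1 (-1) 0 1 (Cut 0 1 (-1) 0 Cell (Cut 0 1 1 7 (Cut 1 2 0 8 (Cut 1 0 1 3 (Cut 1 (-1) 0 (-1)
      (Cut 0 1 1 4 Cell Cell) (Cut 1 1 1 3 Cell Cell)) Cell) (Cut 1 0 1 4 (Cut 1 0 (-1) 0 Cell (Cut 0 1 0 5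
      (Cut 1 2 (-1) 9 Cell Cell) Cell)) Cell)) Cell)) (Cut 0 1 (-1) 0 (Cut 1 0 0 4 (Cut 1 0 (-1) 1 Cell Cell)
      (Cut 1 0 1 7 Cell Cell)) (Cut 1 0 0 3 Cell (Cut 1 0 0 5 (Cut 1 (-1) 0 3 (Cut 1 0 (-1) 3 Cell Cell) Cell)
      Cell)))),
    (7, 3, 0, Cut 1 (-1) 0 1 (Cut 1 (-1) 0 (-1) (Cut 1 0 1 2 (Cut 0 1 0 5 (Cut 0 1 1 4 Cell Cell) (Cut 0 1
      (-1) 6 Cell Cell)) (Cut 0 1 0 6 (Cut 0 1 0 4 Cell (Cut 1 1 0 6 Cell (Cut 0 1 (-1) 4 Cell Cell))) Cell))
      (Cut 1 0 1 3 (Cut 0 1 0 2 (Cut 0 1 1 2 Cell Cell) Cell) (Cut 0 1 0 3 Cell (Cut 0 1 1 5 Cell Cell))))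
      (Cut 1 0 1 3 Cell (Cut 1 0 (-1) 6 (Cut 2 (-1) 0 7 (Cut 0 1 (-1) 2 (Cut 0 1 1 2 Cell (Cut 1 0 0 3 Cell
      (Cut 2 (-1) (-1) 4 Cell Cell))) Cell) (Cut 0 1 (-1) 1 (Cut 1 1 0 6 (Cut 1 0 1 6 Cell Cell) (Cut 1 (-1) 1
      7 Cell Cell)) Cell)) Cell))),
    (8, 3, 3, Cut 0 1 0 3 (Cut 1 0 1 9 (Cut 2 0 (-1) 4 (Cut 1 1 1 5 (Cut 0 1 (-1) 0 (Cut 1 0 1 3 Cell Cell)
      (Cut 1 1 0 2 Cell (Cut 1 0 1 2 Cell Cell))) Cell) (Cut 2 0 (-1) 9 (Cut 1 1 1 6 (Cut 2 0 1 8 (Cut 1 1 0 4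
      Cell Cell) Cell) (Cut 1 (-1) (-1) 1 Cell (Cut 1 1 0 6 Cell Cell))) (Cut 0 1 1 3 (Cut 1 0 1 7 (Cut 1 (-1)
      0 5 Cell Cell) (Cut 1 1 (-1) 7 Cell Cell)) Cell))) Cell) (Cut 0 1 1 7 (Cut 1 0 1 3 (Cut 0 1 0 5 (Cut 1 1
      0 5 (Cut 0 1 (-1) 3 Cell Cell) Cell) (Cut 1 (-1) 0 (-4) Cell Cell)) (Cut 1 0 (-1) 4 (Cut 0 1 (-1) 3 (Cut
      1 0 0 4 (Cut 1 1 0 6 Cell Cell) Cell) (Cut 1 (-1) 0 (-1) Cell Cell)) Cell)) (Cut 1 0 0 2 (Cut 0 0 1 1
      Cell (Cut 0 1 (-1) 6 (Cut 1 (-1) 0 (-5) Cell Cell) Cell)) Cell))),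
    (10, 3, 2, Cut 1 0 0 3 (Cut 0 1 0 4 (Cut 1 0 1 3 (Cut 0 1 0 2 (Cut 1 1 0 2 (Cut 0 1 (-1) 0 Cell Cell)
      Cell) (Cut 0 1 (-1) 2 Cell (Cut 1 1 0 4 Cell Cell))) (Cut 1 1 0 3 Cell (Cut 0 1 (-1) 1 Cell Cell))) (Cut
      0 1 (-1) 9 (Cut 1 2 0 14 (Cut 1 (-1) (-1) (-6) Cell (Cut 1 1 0 6 (Cut 1 0 (-1) 0 Cell Cell) (Cut 0 1 1 6
      Cell (Cut 1 0 1 3 Cell Cell)))) (Cut 1 0 (-1) 1 (Cut 0 0 1 1 Cell (Cut 1 2 0 17 (Cut 1 2 (-1) 14 Cell
      Cell) (Cut 1 (-1) (-1) (-9) Cell Cell))) (Cut 0 1 1 8 Cell Cell))) Cell)) (Cut 1 (-1) 0 3 (Cut 0 1 (-1)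
      1 Cell (Cut 0 1 (-1) 6 (Cut 1 2 0 13 (Cut 1 0 1 6 (Cut 1 (-1) 0 1 (Cut 0 1 1 5 Cell Cell) (Cut 1 1 (-1)
      6 Cell Cell)) Cell) (Cut 1 0 1 7 (Cut 1 0 1 5 Cell (Cut 0 1 0 6 (Cut 1 1 (-1) 9 Cell Cell) Cell)) Cell))
      Cell)) (Cut 1 (-1) 0 5 (Cut 0 1 1 3 (Cut 1 0 0 5 (Cut 1 0 1 5 Cell Cell) Cell) (Cut 1 0 0 6 Cell (Cut 1
      0 1 8 Cell Cell))) (Cut 0 1 (-1) 0 (Cut 1 0 0 8 (Cut 1 0 (-1) 5 Cell Cell) (Cut 1 0 1 11 Cell Cell))
      (Cut 1 0 0 7 Cell (Cut 1 0 0 9 (Cut 1 (-1) 0 7 (Cut 1 0 (-1) 7 Cell Cell) Cell) Cell)))))),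
    (1, 4, 0, Cut 1 0 (-1) 0 (Cut 0 1 1 3 Cell Cell) Cell),
    (3, 4, 0, Cut 0 1 0 2 (Cut 1 0 0 2 (Cut 0 0 1 2 (Cut 1 1 1 2 Cell Cell) (Cut 1 (-1) (-1) (-2) Cell Cell))
      (Cut 1 0 1 5 (Cut 0 1 (-1) 0 Cell Cell) Cell)) (Cut 1 0 1 3 (Cut 0 1 (-1) 2 Cell Cell) Cell)),
    (4, 4, 0, Cut 0 1 0 2 (Cut 1 0 0 3 (Cut 1 0 1 3 (Cut 0 1 1 2 (Cut 1 (-1) 0 1 Cell Cell) Cell) (Cut 0 1 1 3
      Cell (Cut 1 (-1) 0 1 Cell Cell))) (Cut 1 0 (-1) 3 (Cut 0 1 1 3 Cell Cell) Cell)) (Cut 0 0 1 2 (Cut 1 0 1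
      2 (Cut 0 1 (-1) 3 Cell Cell) Cell) (Cut 1 0 1 4 (Cut 0 1 (-1) 1 Cell Cell) Cell))),
    (5, 4, 0, Cut 0 1 0 2 (Cut 1 0 0 2 (Cut 0 0 1 2 (Cut 1 (-1) 1 1 Cell Cell) (Cut 1 (-1) 1 3 Cell Cell))
      (Cut 1 0 0 4 (Cut 0 0 1 2 (Cut 1 (-1) (-1) 2 Cell Cell) (Cut 1 1 (-1) 1 Cell Cell)) (Cut 1 0 (-1) 4 (Cut
      0 1 1 3 Cell Cell) Cell))) (Cut 0 1 0 4 (Cut 1 0 0 2 (Cut 0 0 1 2 (Cut 1 1 (-1) 3 Cell Cell) (Cut 1 1 1
      6 Cell Cell)) (Cut 1 0 1 5 (Cut 0 1 (-1) 2 Cell Cell) Cell)) (Cut 1 0 (-1) 0 (Cut 0 1 1 7 Cell Cell)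
      Cell))),
    (8, 4, 0, Cut 0 1 0 3 (Cut 1 0 0 4 (Cut 0 0 1 2 (Cut 1 (-1) 0 1 (Cut 0 1 1 2 Cell (Cut 1 0 1 2 Cell Cell))
      (Cut 0 1 1 2 (Cut 1 0 1 3 Cell Cell) Cell)) (Cut 0 1 1 4 (Cut 1 1 0 3 (Cut 1 0 (-1) (-1) Cell Cell)
      Cell) (Cut 1 (-1) 0 1 (Cut 1 0 1 4 Cell Cell) Cell))) (Cut 0 0 1 2 (Cut 1 (-1) 0 6 (Cut 1 (-2) 0 3 (Cut
      1 (-1) (-1) 3 Cell Cell) (Cut 1 0 1 6 Cell Cell)) (Cut 1 0 1 8 Cell Cell)) (Cut 1 (-1) 0 6 (Cut 2 1 0 11
      (Cut 1 1 (-1) 3 Cell Cell) (Cut 1 1 (-1) 5 Cell Cell)) (Cut 1 0 (-1) 5 Cell Cell)))) (Cut 1 0 0 2 (Cut 0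
      1 0 5 (Cut 0 0 1 2 (Cut 1 1 (-1) 4 Cell Cell) (Cut 1 1 (-1) 2 Cell Cell)) (Cut 0 1 0 7 (Cut 0 0 1 2 (Cut
      1 (-1) (-1) (-5) Cell Cell) (Cut 1 (-1) 1 (-2) Cell Cell)) (Cut 0 1 (-1) 7 (Cut 1 0 1 3 Cell Cell)
      Cell))) (Cut 0 1 0 5 (Cut 1 0 0 4 (Cut 0 0 1 2 (Cut 1 (-1) (-1) (-1) Cell Cell) (Cut 1 1 (-1) 4 Cell
      Cell)) (Cut 0 1 (-1) 3 (Cut 1 0 1 7 Cell Cell) Cell)) (Cut 0 1 (-1) 5 (Cut 1 0 1 5 Cell Cell) Cell)))),
    (1, 5, 3, Cut 0 0 1 1 Cell (Cut 0 1 (-1) (-1) (Cut 1 0 1 4 Cell Cell) Cell)),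
    (3, 5, 2, Cut 1 0 (-1) (-1) (Cut 0 1 0 2 (Cut 0 1 1 4 Cell (Cut 1 1 0 2 Cell Cell)) (Cut 0 1 1 6 Cell
      Cell)) (Cut 0 0 1 3 (Cut 0 1 0 3 (Cut 1 0 (-1) 2 (Cut 0 1 (-1) 0 (Cut 1 0 0 2 Cell Cell) (Cut 1 1 0 2
      Cell (Cut 1 0 1 2 Cell Cell))) Cell) Cell) Cell)),
    (4, 5, 3, Cut 1 0 0 3 (Cut 0 1 1 7 (Cut 0 1 (-1) 3 (Cut 0 1 2 7 (Cut 1 0 (-2) (-1) (Cut 1 (-2) 0 (-2) Cell
      (Cut 1 0 (-1) (-1) Cell (Cut 1 (-1) 0 1 Cell Cell))) (Cut 0 1 1 2 (Cut 1 1 0 2 Cell Cell) (Cut 1 (-1) 0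
      0 Cell Cell))) (Cut 1 0 1 5 (Cut 0 1 0 2 Cell (Cut 1 (-1) 1 1 Cell Cell)) (Cut 1 (-1) 0 1 Cell Cell)))
      Cell) Cell) (Cut 0 0 1 4 (Cut 1 0 1 6 (Cut 0 1 (-1) 0 Cell Cell) Cell) Cell)),
    (5, 5, 1, Cut 1 (-1) 0 0 (Cut 0 1 (-1) 4 (Cut 0 1 1 5 (Cut 0 0 1 2 (Cut 0 1 1 3 Cell (Cut 1 0 1 2 Cell
      Cell)) Cell) (Cut 0 1 0 2 Cell (Cut 0 1 1 8 (Cut 1 0 1 5 (Cut 0 1 (-1) 0 Cell (Cut 2 0 (-1) 0 (Cut 1 1
      (-1) 2 Cell Cell) Cell)) Cell) Cell))) Cell) (Cut 0 0 1 3 (Cut 0 1 (-1) 0 (Cut 1 0 0 3 (Cut 1 0 (-1) 0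
      Cell Cell) (Cut 1 0 1 6 Cell Cell)) (Cut 1 0 0 2 Cell (Cut 1 0 0 4 (Cut 1 1 0 4 Cell (Cut 1 0 1 4 Cell
      Cell)) Cell))) (Cut 1 0 0 3 (Cut 0 1 1 5 (Cut 1 0 1 5 Cell Cell) Cell) (Cut 1 0 (-1) 1 (Cut 0 1 1 5 Cell
      Cell) Cell)))),
    (8, 5, 1, Cut 0 1 0 3 (Cut 1 0 0 4 (Cut 0 0 1 3 (Cut 0 1 (-1) 0 (Cut 1 0 (-1) 1 (Cut 1 (-1) 0 1 Cell Cell)
      Cell) (Cut 1 0 0 2 (Cut 1 (-1) 0 0 (Cut 1 0 (-1) 0 Cell Cell) Cell) (Cut 1 0 1 4 (Cut 1 1 0 4 Cell Cell)
      Cell))) (Cut 0 1 1 5 (Cut 1 0 1 6 (Cut 1 (-1) 0 1 Cell Cell) Cell) (Cut 1 (-1) 0 1 (Cut 1 0 1 5 Cell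
      Cell) Cell))) (Cut 1 0 (-1) 7 (Cut 1 0 1 11 (Cut 1 0 (-2) 3 (Cut 0 1 2 7 (Cut 2 (-1) 0 11 (Cut 0 1 1 3
      Cell (Cut 1 (-1) 0 4 Cell Cell)) Cell) (Cut 1 0 (-1) 2 (Cut 1 1 0 6 Cell Cell) (Cut 1 (-1) 0 5 Cell
      Cell))) (Cut 0 1 (-1) 1 (Cut 1 0 0 6 Cell (Cut 1 1 1 9 Cell Cell)) (Cut 1 (-1) 0 4 Cell Cell))) Cell)
      Cell)) (Cut 1 (-1) 0 (-3) (Cut 0 1 (-1) 7 (Cut 0 1 1 8 (Cut 0 0 1 2 (Cut 0 1 (-1) 5 Cell (Cut 1 0 (-1) 1
      Cell Cell)) Cell) (Cut 0 1 0 5 Cell (Cut 0 1 1 11 (Cut 1 0 1 5 (Cut 0 1 (-1) 3 Cell (Cut 1 1 (-1) 5 Cell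
      (Cut 1 0 1 3 Cell Cell))) Cell) Cell))) Cell) (Cut 0 0 1 3 (Cut 0 1 1 5 (Cut 1 0 0 3 (Cut 1 0 1 2 Cell
      Cell) (Cut 1 0 (-1) 4 Cell Cell)) (Cut 1 0 0 2 Cell (Cut 1 0 0 4 (Cut 1 0 1 4 Cell (Cut 1 (-1) 0 (-1)
      Cell Cell)) Cell))) (Cut 1 0 0 3 (Cut 0 1 1 8 (Cut 1 0 1 5 Cell Cell) Cell) (Cut 0 1 1 8 (Cut 1 0 (-1) 1
      Cell Cell) Cell))))),
    (3, 6, 0, Cut 1 (-1) 0 1 (Cut 1 0 1 3 (Cut 0 1 0 2 (Cut 0 1 1 2 Cell Cell) (Cut 0 1 (-1) 2 Cell Cell))
      (Cut 0 1 1 7 (Cut 0 1 (-1) (-3) Cell (Cut 0 2 1 6 Cell (Cut 1 (-2) (-1) (-6) Cell Cell))) Cell)) (Cut 0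
      0 1 2 (Cut 1 0 (-1) 2 Cell Cell) (Cut 0 0 1 4 (Cut 1 0 1 5 Cell Cell) (Cut 1 0 1 7 Cell Cell))))]"

definition box_plans :: "(nat \<times> nat \<times> nat \<times> plan) list" where
  "box_plans = [
    (2, 2, 0, Cut 1 0 0 4 (Cut 1 0 0 2 (Cut 1 1 1 2 Cell Cell) (Cut 1 1 1 4 Cell Cell)) (Cut 1 0 0 6 (Cut 1
      (-1) 1 5 Cell Cell) (Cut 1 (-1) (-1) 6 Cell Cell))),
    (2, 3, 0, Cut 1 0 0 4 (Cut 0 1 (-1) 0 (Cut 1 0 (-1) 1 (Cut 1 (-1) 0 1 Cell Cell) Cell) (Cut 1 1 0 2 Cell
      (Cut 1 0 1 3 Cell Cell))) (Cut 0 1 1 2 (Cut 1 1 0 7 (Cut 1 0 (-1) 5 Cell Cell) Cell) (Cut 1 1 0 6 Cell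
      (Cut 1 0 (-1) 5 Cell Cell)))),
    (3, 2, 0, Cut 1 0 0 4 (Cut 0 1 1 2 (Cut 1 0 1 3 (Cut 1 (-1) 0 1 Cell Cell) Cell) (Cut 1 0 1 2 Cell (Cut 1
      (-1) 0 1 Cell Cell))) (Cut 1 (-1) 0 5 (Cut 1 0 (-1) 5 (Cut 0 1 (-1) 1 Cell Cell) Cell) (Cut 0 1 (-1) 1
      (Cut 1 0 (-1) 6 Cell Cell) Cell))),
    (3, 3, 0, Cut 1 0 0 4 (Cut 0 1 1 2 (Cut 1 (-1) 0 1 Cell (Cut 1 0 1 3 Cell Cell)) (Cut 1 0 0 2 (Cut 1 (-1)
      0 0 (Cut 1 0 1 2 Cell Cell) Cell) (Cut 1 1 0 4 Cell (Cut 1 0 (-1) 2 Cell Cell)))) (Cut 0 1 1 3 (Cut 1 0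
      0 6 (Cut 1 (-1) 0 4 Cell (Cut 1 0 1 6 Cell Cell)) (Cut 1 (-1) 0 6 Cell (Cut 1 0 1 8 Cell Cell))) (Cut 1
      0 1 7 Cell (Cut 1 (-1) 0 5 Cell Cell))))]"

lemma triangle_prism_plans_valid:
  "list_all (\<lambda>(d, n, r, t). tiles t (triangle_prism_list d n) r) triangle_prism_plans"
  by code_simp

lemma box_plans_valid: "list_all (\<lambda>(m, n, r, t). tiles t (box_list m n) r) box_plans"
  by code_simp

definition planned_triangle_prisms :: "(nat \<times> nat \<times> nat) list" where
  "planned_triangle_prisms = map (\<lambda>(d, n, r, t). (d, n, r)) triangle_prism_plans"

lemma planned_triangle_prisms_eq: "planned_triangle_prisms =
  [(1, 2, 2), (2, 2, 0), (4, 2, 2), (5, 2, 2), (6, 2, 0), (7, 2, 0), (8, 2, 2), (11, 2, 0), (1, 3, 1), (3, 3,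
    2), (4, 3, 1), (5, 3, 3), (6, 3, 0), (7, 3, 0), (8, 3, 3), (10, 3, 2), (1, 4, 0), (3, 4, 0), (4, 4, 0),
    (5, 4, 0), (8, 4, 0), (1, 5, 3), (3, 5, 2), (4, 5, 3), (5, 5, 1), (8, 5, 1), (3, 6, 0)]"
  by (simp add: planned_triangle_prisms_def triangle_prism_plans_def)

lemma tileable_triangle_prism_plan:
  assumes "(d, n, r) \<in> set planned_triangle_prisms"
  shows "tileable TYPE('k::field_char_0) r (prism (lattice_triangle d) n)"
proof -
  obtain t where "(d, n, r, t) \<in> set triangle_prism_plans"
    using assms unfolding planned_triangle_prisms_def by auto
  then have "tiles t (triangle_prism_list d n) r"
    using triangle_prism_plans_valid unfolding list_all_iff by blast
  moreover have "distinct (triangle_prism_list d n)"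
    unfolding triangle_prism_list_def by (rule distinct_prism_list)
  ultimately show ?thesis
    unfolding set_triangle_prism_list[symmetric] by (rule tileable_if_tiles)
qed

definition planar_box :: "nat \<Rightarrow> (nat \<times> nat) set" where
  "planar_box m = {(x, y). x < 8 \<and> y < m}"

lemma tileable_box_plan:
  assumes "(m, n) \<in> {2, 3} \<times> {2, 3}"
  shows "tileable TYPE('k::field_char_0) 0 (prism (planar_box m) n)"
proof -
  have "(m, n, 0) \<in> set (map (\<lambda>(m, n, r, t). (m, n, r)) box_plans)"
    using assms by (auto simp: box_plans_def)
  then obtain t where "(m, n, 0, t) \<in> set box_plans" by auto
  then have "tiles t (box_list m n) 0"
    using box_plans_valid unfolding list_all_iff by blast
  moreover have "distinct (box_list m n)"
    unfolding box_list_def by (rule distinct_prism_list)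
  moreover have "set (box_list m n) = prism (planar_box m) n"
    by (simp add: box_list_def set_prism_list planar_box_def)
  ultimately show ?thesis using tileable_if_tiles by metis
qed

section \<open>Composing prisms\<close>

text \<open>
  Two remainders would have to share a cell across the plane, so one part must have none. The
  condition on the plane is symmetric because either part may lie below it.
\<close>

lemma tileable_union:
  assumes A: "tileable TYPE('k::field_char_0) 0 A" and B: "tileable TYPE('k) r B"
    and cut: "(\<forall>\<alpha>\<in>A. linear_value h \<alpha> < m) \<and> (\<forall>\<alpha>\<in>B. linear_value h \<alpha> \<ge> m)
      \<or> (\<forall>\<alpha>\<in>B. linear_value h \<alpha> < m) \<and> (\<forall>\<alpha>\<in>A. linear_value h \<alpha> \<ge> m)"
  shows "tileable TYPE('k) r (A \<union> B)"
proof -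
  obtain k1 where k1: "finite A" "card A = 4 * k1" "separable TYPE('k) k1 A"
    using A unfolding tileable_def by auto
  obtain k2 B' where k2: "finite B" "card B = 4 * k2 + r" "separable TYPE('k) (if r = 0 then k2 else Suc k2) B"
    "B' \<subseteq> B" "card B' = 4 * k2" "separable TYPE('k) k2 B'"
    using B unfolding tileable_def by blast
  have fB': "finite B'" using k2 finite_subset by blast
  have sep: "separable TYPE('k) (k1 + l) (A \<union> C)" if "separable TYPE('k) l C" "C \<subseteq> B" for l C
  proof -
    have "finite C" using that(2) k2(1) finite_subset by blast
    then show ?thesis
      using cut
    proof (elim disjE conjE)
      assume "\<forall>\<alpha>\<in>A. linear_value h \<alpha> < m" "\<forall>\<alpha>\<in>B. linear_value h \<alpha> \<ge> m"
      with that show ?thesis by (intro separable_cut[OF k1(3) that(1) k1(1) \<open>finite C\<close>]) auto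
    next
      assume "\<forall>\<alpha>\<in>B. linear_value h \<alpha> < m" "\<forall>\<alpha>\<in>A. linear_value h \<alpha> \<ge> m"
      with that have "separable TYPE('k) (l + k1) (C \<union> A)"
        by (intro separable_cut[OF that(1) k1(3) \<open>finite C\<close> k1(1)]) auto
      then show ?thesis by (simp only: add.commute Un_commute)
    qed
  qed
  have disj: "A \<inter> B = {}" using cut by force
  then have "A \<inter> B' = {}" using k2(4) by blast
  have "card (A \<union> B) = 4 * (k1 + k2) + r" using card_Un_disjoint[OF k1(1) k2(1) disj] k1 k2 by simp
  moreover have "separable TYPE('k) (if r = 0 then k1 + k2 else Suc (k1 + k2)) (A \<union> B)"
    using sep[OF k2(3) subset_refl] by (auto split: if_splits)
  moreover have "separable TYPE('k) (k1 + k2) (A \<union> B')" using sep[OF k2(6,4)] .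
  moreover have "card (A \<union> B') = 4 * (k1 + k2)"
    using card_Un_disjoint[OF k1(1) fB' \<open>A \<inter> B' = {}\<close>] k1 k2 by simp
  moreover have "A \<union> B' \<subseteq> A \<union> B" using k2(4) by blast
  ultimately show ?thesis using k1(1) k2(1) unfolding tileable_def by blast
qed

lemma tileable_translate:
  assumes "tileable TYPE('k::field) r A"
  shows "tileable TYPE('k) r (translate \<tau> ` A)"
proof -
  obtain k A' where k: "finite A" "card A = 4 * k + r" "separable TYPE('k) (if r = 0 then k else Suc k) A"
    "A' \<subseteq> A" "card A' = 4 * k" "separable TYPE('k) k A'"
    using assms unfolding tileable_def by blast
  show ?thesis unfolding tileable_def
    using k by (intro conjI exI[of _ k] exI[of _ "translate \<tau> ` A'"] separable_translate)
      (auto simp: card_image inj_translate)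
qed

lemma tileable_stack:
  assumes "tileable TYPE('k::field_char_0) 0 (prism P n)" "tileable TYPE('k) r (prism P n')"
  shows "tileable TYPE('k) r (prism P (n + n'))"
proof -
  have "tileable TYPE('k) r (prism P n \<union> translate (0, 0, n) ` prism P n')"
    by (rule tileable_union[where h="(0, 0, 1)" and m="int n", OF assms(1) tileable_translate[OF assms(2)]])
      (auto simp: prism_def)
  moreover have "prism P (n + n') = prism P n \<union> translate (0, 0, n) ` prism P n'"
  proof (intro subset_antisym subsetI)
    fix p assume "p \<in> prism P (n + n')"
    then obtain x y z where p: "p = (x, y, z)" "(x, y) \<in> P" "z < n + n'" by (auto simp: prism_def)
    show "p \<in> prism P n \<union> translate (0, 0, n) ` prism P n'"
    proof (cases "z < n")
      case False
      then have "p = translate (0, 0, n) (x, y, z - n)" "(x, y, z - n) \<in> prism P n'"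
        using p by (auto simp: prism_def)
      then show ?thesis by blast
    qed (use p in \<open>auto simp: prism_def\<close>)
  qed (auto simp: prism_def)
  ultimately show ?thesis by simp
qed

text \<open>
  The vertical plane through \<open>(s, t)\<close> with normal direction \<open>(a, b)\<close> separates \<open>P\<close> from the copy of
  \<open>Q\<close> moved to \<open>(s, t)\<close>.
\<close>

lemma tileable_planar_union:
  assumes "tileable TYPE('k::field_char_0) 0 (prism P n)" "tileable TYPE('k) r (prism Q n)"
    and R: "R = P \<union> {(x, y). s \<le> x \<and> t \<le> y \<and> (x - s, y - t) \<in> Q}"
    and cut: "\<And>x y. (x, y) \<in> P \<Longrightarrow> a * x + b * y < s * a + t * b"
  shows "tileable TYPE('k) r (prism R n)"
proof -
  have "tileable TYPE('k) r (prism P n \<union> translate (s, t, 0) ` prism Q n)"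
  proof (rule tileable_union[where h="(int a, int b, 0)" and m="int (s * a + t * b)", OF assms(1) tileable_translate[OF assms(2)]])
    have "int a * int x + int b * int y < int (s * a + t * b)" if "(x, y) \<in> P" for x y
      using cut[OF that] by (metis of_nat_add of_nat_less_iff of_nat_mult)
    moreover have "int (s * a + t * b) \<le> int a * int (x + s) + int b * int (y + t)" for x y
      by (simp add: algebra_simps)
    ultimately show "(\<forall>\<alpha>\<in>prism P n. linear_value (int a, int b, 0) \<alpha> < int (s * a + t * b)) \<and>
        (\<forall>\<alpha>\<in>translate (s, t, 0) ` prism Q n. int (s * a + t * b) \<le> linear_value (int a, int b, 0) \<alpha>) \<or>
        (\<forall>\<alpha>\<in>translate (s, t, 0) ` prism Q n. linear_value (int a, int b, 0) \<alpha> < int (s * a + t * b)) \<and>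
        (\<forall>\<alpha>\<in>prism P n. int (s * a + t * b) \<le> linear_value (int a, int b, 0) \<alpha>)"
      by (auto simp: prism_def)
  qed
  moreover have "prism R n = prism P n \<union> translate (s, t, 0) ` prism Q n"
  proof (intro subset_antisym subsetI)
    fix p assume "p \<in> prism R n"
    then obtain x y z where p: "p = (x, y, z)" "(x, y) \<in> R" "z < n" by (auto simp: prism_def)
    show "p \<in> prism P n \<union> translate (s, t, 0) ` prism Q n"
    proof (cases "(x, y) \<in> P")
      case False
      then have "p = translate (s, t, 0) (x - s, y - t, z)" "(x - s, y - t, z) \<in> prism Q n"
        using p R by (auto simp: prism_def)
      then show ?thesis by blast
    qed (use p in \<open>auto simp: prism_def\<close>)
  qed (auto simp: prism_def R)
  ultimately show ?thesis by simp
qed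

lemma tileable_box:
  assumes "m \<ge> 2" "n \<in> {2, 3, 4, 5}"
  shows "tileable TYPE('k::field_char_0) 0 (prism (planar_box m) n)"
proof -
  have *: "tileable TYPE('k) 0 (prism (planar_box m) n)" if "n \<in> {2, 3}" for n
    using assms(1)
  proof (induction m rule: less_induct)
    case (less m)
    show ?case
    proof (cases "m \<le> 3")
      case True
      then have "m \<in> {2, 3}" using less.prems by auto
      then show ?thesis using that by (intro tileable_box_plan) auto
    next
      case False
      have "tileable TYPE('k) 0 (prism (planar_box (m - 2)) n)" using False by (intro less.IH) auto
      moreover have "tileable TYPE('k) 0 (prism (planar_box 2) n)" using that by (intro tileable_box_plan) auto
      ultimately show ?thesis
        by (rule tileable_planar_union[where s=0 and t="m - 2" and a=0 and b=1])
          (use False in \<open>auto simp: planar_box_def\<close>)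
    qed
  qed
  consider "n \<in> {2, 3}" | "n = 2 + 2" | "n = 2 + 3" using assms(2) by auto
  then show ?thesis
  proof cases
    case 2 then show ?thesis using tileable_stack[of "planar_box m" 2 0 2] *[of 2] by simp
  next
    case 3 then show ?thesis using tileable_stack[of "planar_box m" 2 0 3] *[of 2] *[of 3] by simp
  qed (rule *)
qed

lemma tileable_triangle_6:
  assumes "n \<in> {2, 3, 4, 5}"
  shows "tileable TYPE('k::field_char_0) 0 (prism (lattice_triangle 6) n)"
proof -
  have *: "tileable TYPE('k) 0 (prism (lattice_triangle 6) 2)" "tileable TYPE('k) 0 (prism (lattice_triangle 6) 3)"
    by (rule tileable_triangle_prism_plan, simp add: planned_triangle_prisms_eq)+
  consider "n \<in> {2, 3}" | "n = 2 + 2" | "n = 2 + 3" using assms by auto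
  then show ?thesis
  proof cases
    case 1 then show ?thesis using * by auto
  next
    case 2 then show ?thesis using tileable_stack[of "lattice_triangle 6" 2 0 2] * by simp
  next
    case 3 then show ?thesis using tileable_stack[of "lattice_triangle 6" 2 0 3] * by simp
  qed
qed

text \<open>
  The triangle of side \<open>d + 8\<close> is the triangle of side \<open>d\<close> moved by 8 together with a strip of
  width 8, and the strip is a box of height \<open>d + 2\<close> below a triangle of side 6. Triangles of side 6
  have 28 lattice points, so neither piece of the strip leaves a remainder.
\<close>

lemma tileable_add_strip:
  assumes "tileable TYPE('k::field_char_0) r (prism (lattice_triangle d) n)" "n \<in> {2, 3, 4, 5}"
  shows "tileable TYPE('k) r (prism (lattice_triangle (d + 8)) n)"
proof -
  let ?S = "{(x, y). x < 8 \<and> x + y \<le> d + 8}"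
  have "tileable TYPE('k) 0 (prism ?S n)"
    by (rule tileable_planar_union[where s=0 and t="d + 2" and a=0 and b=1,
          OF tileable_box[of "d + 2"] tileable_triangle_6])
      (use assms(2) in \<open>auto simp: planar_box_def lattice_triangle_def\<close>)
  then show ?thesis
    by (rule tileable_planar_union[where s=8 and t=0 and a=1 and b=0, OF _ assms(1)])
      (auto simp: lattice_triangle_def)
qed

text \<open>
  Removing a strip lowers the side by 8. For \<open>d = 10\<close> with odd \<open>n\<close> and for \<open>d = 11\<close> with \<open>n = 2\<close> this
  would end in an excluded case, so these prisms are cut directly. Some prisms with
  4 or 5 layers are stacks of thinner ones.
\<close>

lemma tileable_triangle_prism_thin:
  assumes "d \<ge> 1" "n \<in> {2, 3, 4, 5}" "\<not> (d = 2 \<and> odd n)" "\<not> (d = 3 \<and> n = 2)"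
  shows "\<exists>r<4. tileable TYPE('k::field_char_0) r (prism (lattice_triangle d) n)"
  using assms
proof (induction d rule: less_induct)
  case (less d)
  note plan = tileable_triangle_prism_plan[where 'k='k]
  have full2: "tileable TYPE('k) 0 (prism (lattice_triangle d') 2)" if "d' \<in> {2, 6, 7, 11}" for d'
    using that by (intro plan) (auto simp: planned_triangle_prisms_eq)
  have "tileable TYPE('k) 0 (prism (lattice_triangle 10) 2)"
    using tileable_add_strip[OF full2[of 2], of] by simp
  with full2 have full2: "tileable TYPE('k) 0 (prism (lattice_triangle d') 2)" if "d' \<in> {2, 6, 7, 10, 11}" for d'
    using that by auto
  have three: "\<exists>r<4. tileable TYPE('k) r (prism (lattice_triangle d') 3)" if d': "d' \<in> {1, 3, 4, 5, 6, 7, 8, 10}" for d'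
  proof -
    have "\<exists>r<4. (d', 3, r) \<in> set planned_triangle_prisms"
      using d' by (auto simp: planned_triangle_prisms_eq)
    then show ?thesis using plan by blast
  qed
  consider "d \<ge> 9" "\<not> (d = 10 \<and> odd n)" "\<not> (d = 11 \<and> n = 2)" | "d = 10" "odd n" | "d = 11" "n = 2" | "d \<le> 8" by linarith
  then show ?case
  proof cases
    case 1
    have "\<exists>r<4. tileable TYPE('k) r (prism (lattice_triangle (d - 8)) n)"
      using 1 less.prems by (intro less.IH) auto
    then show ?thesis using tileable_add_strip[of _ "d - 8" n] 1 less.prems by auto
  next
    case 2
    then consider "n = 3" | "n = 2 + 3" using less.prems by auto
    then show ?thesis
    proof cases
      case 1 then show ?thesis using three[of 10] 2 by simp
    next
      case b: 2
      show ?thesis using three[of 10] tileable_stack[OF full2[of 10]] 2 unfolding b by blast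
    qed
  next
    case 3
    then show ?thesis using full2[of 11] by (intro exI[of _ 0]) simp
  next
    case 4
    consider "n = 3" | "d \<in> {6, 7}" "n = 2 + 3" | "d \<in> {2, 6, 7}" "n = 2 + 2" | "n \<noteq> 3" "\<not> (d \<in> {6, 7} \<and> n = 5)" "\<not> (d \<in> {2, 6, 7} \<and> n = 4)"
      by auto
    then show ?thesis
    proof cases
      case 1
      then have "d \<in> {1, 3, 4, 5, 6, 7, 8, 10}" using 4 less.prems by auto
      then show ?thesis using three 1 by simp
    next
      case 2
      have "d \<in> {1, 3, 4, 5, 6, 7, 8, 10}" "d \<in> {2, 6, 7, 10, 11}" using 2 by auto
      then show ?thesis using three[of d] tileable_stack[OF full2[of d]] unfolding 2(2) by blast
    next
      case 3
      have "d \<in> {2, 6, 7, 10, 11}" using 3 by auto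
      then have "tileable TYPE('k) 0 (prism (lattice_triangle d) (2 + 2))" using tileable_stack[OF full2 full2] by blast
      then show ?thesis unfolding 3(2) by (intro exI[of _ 0]) simp
    next
      case c: 4
      have d: "d \<in> {1, 2, 3, 4, 5, 6, 7, 8}" using 4 less.prems(1) by auto
      have "\<exists>r<4. (d, n, r) \<in> set planned_triangle_prisms"
        using d less.prems c by (auto simp: planned_triangle_prisms_eq)
      then show ?thesis using plan by blast
    qed
  qed
qed

text \<open>
  The remainder is zero since the number of points is divisible by 4.
\<close>

lemma tileable_triangle_4_layers:
  assumes "d \<ge> 1"
  shows "tileable TYPE('k::field_char_0) 0 (prism (lattice_triangle d) 4)"
proof -
  obtain r where r: "r < 4" "tileable TYPE('k) r (prism (lattice_triangle d) 4)"
    using tileable_triangle_prism_thin[of d 4] assms by auto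
  then have "4 dvd r"
  proof -
    obtain k where "card (prism (lattice_triangle d) 4) = 4 * k + r" using r(2) unfolding tileable_def by blast
    then have "(\<Sum>x\<le>d. Suc d - x) * 4 = 4 * k + r" by (simp only: card_triangle_prism)
    then show ?thesis by presburger
  qed
  then have "r = 0" using r(1) by auto
  then show ?thesis using r(2) by simp
qed

theorem tileable_triangle_prism:
  assumes "d \<ge> 1" "n \<ge> 2" "\<not> (d = 2 \<and> odd n)" "\<not> (d = 3 \<and> n = 2)"
  shows "\<exists>r<4. tileable TYPE('k::field_char_0) r (prism (lattice_triangle d) n)"
  using assms
proof (induction n rule: less_induct)
  case (less n)
  consider "n \<le> 5" | "d = 3" "n = 6" | "n \<ge> 6" "\<not> (d = 3 \<and> n = 6)" by linarith
  then show ?case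
  proof cases
    case 1
    then have "n \<in> {2, 3, 4, 5}" using less.prems by auto
    then show ?thesis using less.prems by (intro tileable_triangle_prism_thin) auto
  next
    case 2
    have "tileable TYPE('k) 0 (prism (lattice_triangle 3) 6)" by (rule tileable_triangle_prism_plan) (simp add: planned_triangle_prisms_eq)
    then show ?thesis unfolding 2 by (intro exI[of _ 0]) simp
  next
    case 3
    have "\<exists>r<4. tileable TYPE('k) r (prism (lattice_triangle d) (n - 4))"
      using 3 less.prems by (intro less.IH) auto
    moreover have "4 + (n - 4) = n" using 3 by simp
    ultimately show ?thesis using tileable_stack[OF tileable_triangle_4_layers[OF less.prems(1)], of _ "n - 4"] by auto
  qed
qed

text \<open>
  Of the 20 lattice points, 5 points can separate only 19; the origin, the head of the list, is left out.
\<close>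

lemma separable_degree_3_1:
  "\<exists>C\<subseteq>prism (lattice_triangle 3) 2. card C = 19 \<and> separable TYPE('k::field_char_0) 5 C"
proof -
  have t: "tiles (Cut 1 (-1) 0 1 (Cut 0 1 (-1) 2 (Cut 1 (-1) 0 0 Cell Cell) Cell) (Cut 1 0 1 3 Cell Cell))
    (tl (triangle_prism_list 3 2)) 3"
    by code_simp
  have "distinct (tl (triangle_prism_list 3 2))"
    by (rule distinct_tl) (simp add: triangle_prism_list_def distinct_prism_list)
  then have "tileable TYPE('k) 3 (set (tl (triangle_prism_list 3 2)))" using tileable_if_tiles[OF t] by blast
  then obtain k where k: "card (set (tl (triangle_prism_list 3 2))) = 4 * k + 3" "separable TYPE('k) (Suc k) (set (tl (triangle_prism_list 3 2)))"
    unfolding tileable_def by auto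
  have "card (set (tl (triangle_prism_list 3 2))) = length (tl (triangle_prism_list 3 2))"
    by (rule distinct_card) fact
  also have "\<dots> = card (prism (lattice_triangle 3) 2) - 1"
    using distinct_card[OF distinct_prism_list[of 4 "\<lambda>x. 4 - x" 2]]
    by (simp add: set_triangle_prism_list[symmetric] triangle_prism_list_def)
  also have "\<dots> = 19" by (simp add: card_triangle_prism numeral_eq_Suc)
  finally have "card (set (tl (triangle_prism_list 3 2))) = 19" .
  moreover have "set (tl (triangle_prism_list 3 2)) \<subseteq> prism (lattice_triangle 3) 2"
    using set_triangle_prism_list[of 3 2] list.set_sel(2)[of "triangle_prism_list 3 2"] by (metis list.sel(2) subsetI)
  moreover have "k = 4" using k(1) calculation(1) by simp
  ultimately show ?thesis using k(2) by (intro exI[of _ "set (tl (triangle_prism_list 3 2))"]) simp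
qed

text \<open>
  Pairs of layers are cut without remainder. In the remaining layer, a triangle with 6 lattice points
  in a plane, a cell has at most three points: one further point separates three vertices of a unit
  triangle, and a second one two more of the remaining points.
\<close>

lemma separable_degree_2_even:
  assumes "k \<ge> 1"
  shows "\<exists>C\<subseteq>prism (lattice_triangle 2) (2 * k + 1). card C = 12 * k + 3 \<and> separable TYPE('k::field_char_0) (3 * k + 1) C"
    and "\<exists>C\<subseteq>prism (lattice_triangle 2) (2 * k + 1). card C = 12 * k + 5 \<and> separable TYPE('k) (3 * k + 2) C"
proof -
  let ?A = "prism (lattice_triangle 2) (2 * k)"
  have "tileable TYPE('k) 0 ?A" using assms
  proof (induction k rule: dec_induct)
    case base
    have "tileable TYPE('k) 0 (prism (lattice_triangle 2) 2)" by (rule tileable_triangle_prism_plan) (simp add: planned_triangle_prisms_eq)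
    then show ?case by simp
  next
    case (step k)
    have "tileable TYPE('k) 0 (prism (lattice_triangle 2) 2)" by (rule tileable_triangle_prism_plan) (simp add: planned_triangle_prisms_eq)
    from tileable_stack[OF this step.IH] show ?case by simp
  qed
  moreover have cA: "card ?A = 12 * k" by (simp add: card_triangle_prism numeral_eq_Suc)
  ultimately have A: "separable TYPE('k) (3 * k) ?A" unfolding tileable_def by auto
  define B :: "point set" where "B = {(0, 0, 0), (1, 0, 0), (0, 1, 0)}"
  define B2 :: "point set" where "B2 = {(2, 0, 0), (0, 2, 0)}"
  have "separable TYPE('k) 1 (set [(0, 0, 0), (1, 0, 0), (0, 1, 0)])"
    by (rule separable_affine_independent) simp
  then have sB: "separable TYPE('k) 1 B" by (simp add: B_def)
  have "separable TYPE('k) 1 (set [(2, 0, 0), (0, 2, 0)])"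
    by (rule separable_affine_independent) simp
  then have "separable TYPE('k) 1 B2" by (simp add: B2_def)
  then have "separable TYPE('k) (1 + 1) (B \<union> B2)"
    by (rule separable_cut[OF sB, where h="(1, 1, 0)" and m=2]) (auto simp: B_def B2_def)
  then have sBB: "separable TYPE('k) 2 (B \<union> B2)" by (simp add: numeral_2_eq_2)
  have main: "\<exists>C\<subseteq>prism (lattice_triangle 2) (2 * k + 1). card C = 12 * k + card D \<and> separable TYPE('k) (3 * k + l) C"
    if D: "separable TYPE('k) l D" "D \<subseteq> prism (lattice_triangle 2) 1" for l D
  proof (intro exI[of _ "?A \<union> translate (0, 0, 2 * k) ` D"] conjI)
    have fin: "finite D" using D(2) finite_triangle_prism finite_subset by blast
    have low: "linear_value (0, 0, 1) \<alpha> < int (2 * k)" if "\<alpha> \<in> ?A" for \<alpha> using that by (auto simp: prism_def)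
    have high: "linear_value (0, 0, 1) \<alpha> \<ge> int (2 * k)" if "\<alpha> \<in> translate (0, 0, 2 * k) ` D" for \<alpha> using that by auto
    show "separable TYPE('k) (3 * k + l) (?A \<union> translate (0, 0, 2 * k) ` D)"
      by (rule separable_cut[OF A separable_translate[OF D(1)] finite_triangle_prism _ low high]) (use fin in auto)
    have "?A \<inter> translate (0, 0, 2 * k) ` D = {}" using low high by fastforce
    then show "card (?A \<union> translate (0, 0, 2 * k) ` D) = 12 * k + card D"
      using fin finite_triangle_prism by (simp add: card_Un_disjoint cA card_image inj_translate)
    show "?A \<union> translate (0, 0, 2 * k) ` D \<subseteq> prism (lattice_triangle 2) (2 * k + 1)"
      using D(2) by (auto simp: prism_def)
  qed
  have "B \<subseteq> prism (lattice_triangle 2) 1" "B \<union> B2 \<subseteq> prism (lattice_triangle 2) 1"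
    by (auto simp: B_def B2_def prism_def lattice_triangle_def)
  moreover have "card B = 3" "card (B \<union> B2) = 5" by (simp_all add: B_def B2_def)
  ultimately show "\<exists>C\<subseteq>prism (lattice_triangle 2) (2 * k + 1). card C = 12 * k + 3 \<and> separable TYPE('k) (3 * k + 1) C"
    "\<exists>C\<subseteq>prism (lattice_triangle 2) (2 * k + 1). card C = 12 * k + 5 \<and> separable TYPE('k) (3 * k + 2) C"
    using main[OF sB] main[OF sBB] by simp_all
qed

section \<open>Independent rows and columns\<close>

definition rows_independent :: "'i set \<Rightarrow> 'c set \<Rightarrow> ('i \<Rightarrow> 'c \<Rightarrow> 'k::field) \<Rightarrow> bool" where
  "rows_independent I C w \<longleftrightarrow> (\<forall>e. (\<forall>\<alpha>\<in>C. (\<Sum>i\<in>I. e i * w i \<alpha>) = 0) \<longrightarrow> (\<forall>i\<in>I. e i = 0))"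

definition columns_independent :: "'i set \<Rightarrow> 'c set \<Rightarrow> ('i \<Rightarrow> 'c \<Rightarrow> 'k::field) \<Rightarrow> bool" where
  "columns_independent I C w \<longleftrightarrow> (\<forall>c. (\<forall>i\<in>I. (\<Sum>\<alpha>\<in>C. c \<alpha> * w i \<alpha>) = 0) \<longrightarrow> (\<forall>\<alpha>\<in>C. c \<alpha> = 0))"

lemma columns_transpose: "columns_independent I C w \<longleftrightarrow> rows_independent C I (\<lambda>\<alpha> i. w i \<alpha>)"
  by (simp add: columns_independent_def rows_independent_def)

lemma rows_independent_card_le:
  assumes "finite I" "finite C" "rows_independent I C w"
  shows "card I \<le> card C"
proof (rule ccontr)
  assume "\<not> ?thesis"
  then obtain e where "\<exists>i\<in>I. e i \<noteq> 0" "\<forall>\<alpha>\<in>C. (\<Sum>i\<in>I. e i * w i \<alpha>) = 0"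
    using underdetermined_system[OF assms(2,1), of w] by auto
  then show False using assms(3) unfolding rows_independent_def by blast
qed

text \<open>
  The exchange lemma for matrices: a maximal independent set of rows containing \<open>I0\<close> still has
  independent columns, and then it is square.
\<close>

lemma extend_independent_rows:
  assumes fin: "finite I" "finite C" and I0: "I0 \<subseteq> I" "rows_independent I0 C w"
    and col: "columns_independent I C w"
  shows "\<exists>J. I0 \<subseteq> J \<and> J \<subseteq> I \<and> card J = card C \<and> rows_independent J C w \<and> columns_independent J C w"
proof -
  let ?P = "\<lambda>J. I0 \<subseteq> J \<and> J \<subseteq> I \<and> rows_independent J C w"
  have "\<exists>J. ?P J \<and> (\<forall>J'. ?P J' \<longrightarrow> card J' \<le> card J)"
  proof (rule ex_has_greatest_nat)
    show "?P I0" using I0 by simp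
    show "\<forall>J. ?P J \<longrightarrow> card J < Suc (card I)" using card_mono[OF fin(1)] by (simp add: less_Suc_eq_le)
  qed
  then obtain J where J: "I0 \<subseteq> J" "J \<subseteq> I" "rows_independent J C w"
    and max: "\<forall>J'. ?P J' \<longrightarrow> card J' \<le> card J" by (elim exE conjE)
  have fJ: "finite J" using J(2) fin(1) finite_subset by blast
  have colJ: "columns_independent J C w"
    unfolding columns_independent_def
  proof (intro allI impI, rule ccontr)
    fix c assume c: "\<forall>i\<in>J. (\<Sum>\<alpha>\<in>C. c \<alpha> * w i \<alpha>) = 0" and "\<not> (\<forall>\<alpha>\<in>C. c \<alpha> = 0)"
    then obtain i0 where i0: "i0 \<in> I" "(\<Sum>\<alpha>\<in>C. c \<alpha> * w i0 \<alpha>) \<noteq> 0"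
      using col unfolding columns_independent_def by blast
    have "i0 \<notin> J" using c i0 by blast
    have "rows_independent (insert i0 J) C w"
      unfolding rows_independent_def
    proof (intro allI impI)
      fix e assume e: "\<forall>\<alpha>\<in>C. (\<Sum>i\<in>insert i0 J. e i * w i \<alpha>) = 0"
      have "0 = (\<Sum>\<alpha>\<in>C. c \<alpha> * (\<Sum>i\<in>insert i0 J. e i * w i \<alpha>))" using e by simp
      also have "\<dots> = (\<Sum>i\<in>insert i0 J. e i * (\<Sum>\<alpha>\<in>C. c \<alpha> * w i \<alpha>))"
        unfolding sum_distrib_left by (subst sum.swap) (intro sum.cong refl, simp add: mult_ac)
      also have "\<dots> = e i0 * (\<Sum>\<alpha>\<in>C. c \<alpha> * w i0 \<alpha>)"
        using c fJ \<open>i0 \<notin> J\<close> by simp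
      finally have z: "e i0 = 0" using i0 by simp
      then have "\<forall>\<alpha>\<in>C. (\<Sum>i\<in>J. e i * w i \<alpha>) = 0" using e fJ \<open>i0 \<notin> J\<close> by simp
      then have "\<forall>i\<in>J. e i = 0" using J(3) unfolding rows_independent_def by blast
      then show "\<forall>i\<in>insert i0 J. e i = 0" using z by simp
    qed
    moreover have "I0 \<subseteq> insert i0 J" "insert i0 J \<subseteq> I" using J i0 by auto
    ultimately have "card (insert i0 J) \<le> card J" using max by blast
    then show False using fJ \<open>i0 \<notin> J\<close> by simp
  qed
  moreover have "card J = card C"
    using rows_independent_card_le[OF fJ fin(2) J(3)]
      rows_independent_card_le[OF fin(2) fJ, of "\<lambda>\<alpha> i. w i \<alpha>"] colJ by (simp add: columns_transpose)
  ultimately show ?thesis using J by blast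
qed

lemma dual_columns:
  assumes fin: "finite J" "finite C" and card: "card J = card C" and col: "columns_independent J C w"
  shows "\<exists>y. \<forall>i\<in>J. \<forall>i'\<in>J. (\<Sum>\<alpha>\<in>C. y i \<alpha> * w i' \<alpha>) = (if i = i' then 1 else 0)"
proof -
  have "\<exists>y. \<forall>i'\<in>J. (\<Sum>\<alpha>\<in>C. y \<alpha> * w i' \<alpha>) = (if i = i' then 1 else 0)" if i: "i \<in> J" for i
  proof -
    have "card (J - {i}) < card C" using i fin card card_Diff1_less by metis
    then obtain c where c: "\<exists>\<alpha>\<in>C. c \<alpha> \<noteq> 0" "\<And>i'. i' \<in> J - {i} \<Longrightarrow> (\<Sum>\<alpha>\<in>C. c \<alpha> * w i' \<alpha>) = 0"
      using underdetermined_system[of "J - {i}" C "\<lambda>\<alpha> i'. w i' \<alpha>"] fin by auto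
    define d where "d = (\<Sum>\<alpha>\<in>C. c \<alpha> * w i \<alpha>)"
    have "d \<noteq> 0"
    proof
      assume "d = 0"
      then have "\<forall>i'\<in>J. (\<Sum>\<alpha>\<in>C. c \<alpha> * w i' \<alpha>) = 0" using c(2) by (auto simp: d_def)
      then show False using col c(1) unfolding columns_independent_def by blast
    qed
    have "(\<Sum>\<alpha>\<in>C. c \<alpha> / d * w i' \<alpha>) = (if i = i' then 1 else 0)" if "i' \<in> J" for i'
    proof -
      have "(\<Sum>\<alpha>\<in>C. c \<alpha> / d * w i' \<alpha>) = (\<Sum>\<alpha>\<in>C. c \<alpha> * w i' \<alpha>) / d"
        by (simp add: sum_divide_distrib)
      then show ?thesis using \<open>d \<noteq> 0\<close> c(2)[of i'] that by (cases "i = i'") (auto simp: d_def)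
    qed
    then show ?thesis by (intro exI[of _ "\<lambda>\<alpha>. c \<alpha> / d"]) blast
  qed
  then show ?thesis by metis
qed

lemma unit_columns_independent:
  fixes h :: "'l \<Rightarrow> 'c \<Rightarrow> 'k::field"
  assumes "finite C"
  shows "columns_independent (Inr ` C \<union> I) C (\<lambda>i \<alpha>. case i of Inl l \<Rightarrow> h l \<alpha> | Inr \<beta> \<Rightarrow> if \<alpha> = \<beta> then 1 else 0)"
  unfolding columns_independent_def
proof (intro allI impI ballI)
  fix c :: "'c \<Rightarrow> 'k" and \<alpha>
  assume c: "\<forall>i\<in>Inr ` C \<union> I. (\<Sum>\<alpha>\<in>C. c \<alpha> * (case i of Inl l \<Rightarrow> h l \<alpha> | Inr \<beta> \<Rightarrow> if \<alpha> = \<beta> then 1 else 0)) = 0" and \<alpha>: "\<alpha> \<in> C"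
  then have "(\<Sum>\<beta>\<in>C. c \<beta> * (if \<beta> = \<alpha> then 1 else 0)) = 0" by (auto dest: bspec[of _ _ "Inr \<alpha>"])
  moreover have "(\<Sum>\<beta>\<in>C. c \<beta> * (if \<beta> = \<alpha> then 1 else 0)) = (\<Sum>\<beta>\<in>C. if \<beta> = \<alpha> then c \<beta> else 0)"
    by (intro sum.cong) auto
  ultimately show "c \<alpha> = 0" using assms \<alpha> by simp
qed

text \<open>
  Adding unit rows makes the columns independent, so the rows can be extended to a square matrix,
  which has a dual basis.
\<close>

lemma dual_of_independent_rows:
  assumes fin: "finite I" "finite C" and rows: "rows_independent I C h"
  shows "\<exists>z. \<forall>i\<in>I. \<forall>i'\<in>I. (\<Sum>\<alpha>\<in>C. z i \<alpha> * h i' \<alpha>) = (if i = i' then 1 else 0)"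
proof -
  let ?w = "\<lambda>i \<alpha>. case i of Inl l \<Rightarrow> h l \<alpha> | Inr \<beta> \<Rightarrow> if \<alpha> = \<beta> then 1 else 0"
  have "rows_independent (Inl ` I) C ?w"
    unfolding rows_independent_def
  proof (intro allI impI)
    fix e :: "'a + 'b \<Rightarrow> 'c" assume "\<forall>\<alpha>\<in>C. (\<Sum>i\<in>Inl ` I. e i * ?w i \<alpha>) = 0"
    then have "\<forall>\<alpha>\<in>C. (\<Sum>i\<in>I. e (Inl i) * h i \<alpha>) = 0" by (simp add: sum.reindex)
    then have "\<forall>i\<in>I. e (Inl i) = 0" using rows[unfolded rows_independent_def, THEN spec[of _ "\<lambda>i. e (Inl i)"]] by blast
    then show "\<forall>i\<in>Inl ` I. e i = 0" by blast
  qed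
  then obtain J where J: "Inl ` I \<subseteq> J" "J \<subseteq> Inr ` C \<union> Inl ` I" "card J = card C" "columns_independent J C ?w"
    using extend_independent_rows[OF _ fin(2) _ _ unit_columns_independent[OF fin(2), of "Inl ` I" h], of "Inl ` I"] fin by auto
  have "finite J" using J(2) fin finite_subset by blast
  from dual_columns[OF this fin(2) J(3,4)] obtain y where
    y: "\<forall>i\<in>J. \<forall>i'\<in>J. (\<Sum>\<alpha>\<in>C. y i \<alpha> * ?w i' \<alpha>) = (if i = i' then 1 else 0)" by blast
  have "(\<Sum>\<alpha>\<in>C. y (Inl i) \<alpha> * h i' \<alpha>) = (if i = i' then 1 else 0)" if "i \<in> I" "i' \<in> I" for i i'
  proof -
    have "Inl i \<in> J" "Inl i' \<in> J" using that J(1) by auto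
    then have "(\<Sum>\<alpha>\<in>C. y (Inl i) \<alpha> * ?w (Inl i') \<alpha>) = (if (Inl i :: 'a + 'b) = Inl i' then 1 else 0)" using y by blast
    then show ?thesis by simp
  qed
  then show ?thesis by (intro exI[of _ "\<lambda>i. y (Inl i)"]) blast
qed

text \<open>
  Vectors annihilated by \<open>card I\<close> independent functionals lie in a space of dimension
  \<open>card C - card I\<close>. A dependence among the \<open>v i\<close> and the vectors \<open>z l\<close> dual to the functionals exists by
  counting, and applying the functionals removes the \<open>z l\<close>.
\<close>

lemma dependent_if_annihilated:
  fixes v :: "'i \<Rightarrow> 'c \<Rightarrow> 'k::field"
  assumes fin: "finite I" "finite T" "finite C" and rows: "rows_independent I C h"
    and ann: "\<And>l i. l \<in> I \<Longrightarrow> i \<in> T \<Longrightarrow> (\<Sum>\<alpha>\<in>C. h l \<alpha> * v i \<alpha>) = 0"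
    and card: "card C < card T + card I"
  shows "\<exists>c. (\<exists>i\<in>T. c i \<noteq> 0) \<and> (\<forall>\<alpha>\<in>C. (\<Sum>i\<in>T. c i * v i \<alpha>) = 0)"
proof -
  obtain z where z: "\<forall>l\<in>I. \<forall>l'\<in>I. (\<Sum>\<alpha>\<in>C. z l \<alpha> * h l' \<alpha>) = (if l = l' then 1 else 0)"
    using dual_of_independent_rows[OF fin(1,3) rows] by (elim exE)
  let ?M = "\<lambda>s \<alpha>. case s of Inl i \<Rightarrow> v i \<alpha> | Inr l \<Rightarrow> z l \<alpha>"
  have "card (T <+> I) = card T + card I" using fin by (simp add: card_Plus)
  then obtain c where c: "\<exists>s\<in>T <+> I. c s \<noteq> 0" "\<forall>\<alpha>\<in>C. (\<Sum>s\<in>T <+> I. c s * ?M s \<alpha>) = 0"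
    using underdetermined_system[of C "T <+> I" ?M] fin card by auto
  have e: "(\<Sum>i\<in>T. c (Inl i) * v i \<alpha>) + (\<Sum>l\<in>I. c (Inr l) * z l \<alpha>) = 0" if "\<alpha> \<in> C" for \<alpha>
    using c(2) that fin by (simp add: sum.Plus)
  have r: "c (Inr m) = 0" if m: "m \<in> I" for m
  proof -
    have "0 = (\<Sum>\<alpha>\<in>C. h m \<alpha> * ((\<Sum>i\<in>T. c (Inl i) * v i \<alpha>) + (\<Sum>l\<in>I. c (Inr l) * z l \<alpha>)))"
      using e by simp
    also have "\<dots> = (\<Sum>\<alpha>\<in>C. \<Sum>i\<in>T. c (Inl i) * (h m \<alpha> * v i \<alpha>)) + (\<Sum>\<alpha>\<in>C. \<Sum>l\<in>I. c (Inr l) * (z l \<alpha> * h m \<alpha>))"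
      by (simp add: distrib_left sum.distrib sum_distrib_left mult_ac)
    also have "\<dots> = (\<Sum>i\<in>T. c (Inl i) * (\<Sum>\<alpha>\<in>C. h m \<alpha> * v i \<alpha>)) + (\<Sum>l\<in>I. c (Inr l) * (\<Sum>\<alpha>\<in>C. z l \<alpha> * h m \<alpha>))"
      by (simp add: sum_distrib_left sum.swap[of _ C])
    also have "\<dots> = (\<Sum>l\<in>I. if l = m then c (Inr m) else 0)"
      using m by (simp add: ann z cong: sum.cong) (intro sum.cong, auto)
    also have "\<dots> = c (Inr m)" using m fin by simp
    finally show ?thesis by simp
  qed
  have "\<forall>\<alpha>\<in>C. (\<Sum>i\<in>T. c (Inl i) * v i \<alpha>) = 0" using e r by simp
  moreover have "\<exists>i\<in>T. c (Inl i) \<noteq> 0" using c(1) r by auto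
  ultimately show ?thesis by (intro exI[of _ "\<lambda>i. c (Inl i)"]) blast
qed

definition weight_row :: "(nat \<Rightarrow> 'k \<times> 'k \<times> 'k::field) \<Rightarrow> nat \<times> nat \<Rightarrow> point \<Rightarrow> 'k" where
  "weight_row q = (\<lambda>(i, j) \<alpha>. of_nat (weight j \<alpha>) * monomial (q i) \<alpha>)"

lemma separates_iff: "separates k q C \<longleftrightarrow> columns_independent ({..<k} \<times> {..<4}) C (weight_row q)"
proof -
  have "(\<forall>i<k. \<forall>j<4. P i j) \<longleftrightarrow> (\<forall>s\<in>{..<k} \<times> {..<4}. P (fst s) (snd s))" for P :: "nat \<Rightarrow> nat \<Rightarrow> bool"
    by auto
  then show ?thesis unfolding separates_def columns_independent_def weight_row_def
    by (simp add: case_prod_beta')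
qed

text \<open>
  The square matrix of \<open>K\<close> points has independent rows, and so has its part belonging to \<open>k\<close> of the
  points; a maximal square part of that supplies \<open>C\<close>.
\<close>

lemma separable_fewer_points:
  assumes "separable TYPE('k::field) K A" "finite A" "card A = 4 * K" "k \<le> K"
  shows "\<exists>C\<subseteq>A. card C = 4 * k \<and> separable TYPE('k) k C"
proof -
  obtain q :: "nat \<Rightarrow> 'k \<times> 'k \<times> 'k" where q: "\<And>i. i < K \<Longrightarrow> in_torus (q i)" "separates K q A"
    using assms(1) unfolding separable_def by blast
  let ?S = "\<lambda>k. {..<k} \<times> {..<4::nat}"
  let ?w = "weight_row q"
  have "columns_independent (?S K) A ?w" "card (?S K) = card A"
    using q(2) assms(3) by (simp_all add: separates_iff card_cartesian_product)
  from dual_columns[OF _ assms(2) this(2) this(1)] obtain y where y: "\<And>s s'. s \<in> ?S K \<Longrightarrow> s' \<in> ?S K \<Longrightarrow> (\<Sum>\<alpha>\<in>A. y s \<alpha> * ?w s' \<alpha>) = (if s = s' then 1 else 0)"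
    by blast
  have "columns_independent A (?S k) (\<lambda>\<alpha> s. ?w s \<alpha>)"
    unfolding columns_independent_def
  proof (intro allI impI ballI)
    fix e s assume e: "\<forall>\<alpha>\<in>A. (\<Sum>s\<in>?S k. e s * ?w s \<alpha>) = 0" and s: "s \<in> ?S k"
    have sub: "?S k \<subseteq> ?S K" using assms(4) by auto
    have "0 = (\<Sum>\<alpha>\<in>A. y s \<alpha> * (\<Sum>s\<in>?S k. e s * ?w s \<alpha>))" using e by simp
    also have "\<dots> = (\<Sum>s'\<in>?S k. e s' * (\<Sum>\<alpha>\<in>A. y s \<alpha> * ?w s' \<alpha>))"
      unfolding sum_distrib_left by (subst sum.swap) (intro sum.cong refl, simp add: mult_ac)
    also have "\<dots> = (\<Sum>s'\<in>?S k. if s' = s then e s else 0)"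
    proof (intro sum.cong refl)
      fix s' assume "s' \<in> ?S k"
      then have "s \<in> ?S K" "s' \<in> ?S K" using s sub by blast+
      from y[OF this] show "e s' * (\<Sum>\<alpha>\<in>A. y s \<alpha> * ?w s' \<alpha>) = (if s' = s then e s else 0)"
        by (cases "s = s'") simp_all
    qed
    also have "\<dots> = e s" using s by simp
    finally show "e s = 0" by simp
  qed
  then obtain C where C: "C \<subseteq> A" "card C = card (?S k)" "rows_independent C (?S k) (\<lambda>\<alpha> s. ?w s \<alpha>)"
    using extend_independent_rows[of A "?S k" "{}" "\<lambda>\<alpha> s. ?w s \<alpha>"] assms(2) by (auto simp: rows_independent_def)
  then have "separates k q C" unfolding separates_iff columns_transpose by blast
  then have "separable TYPE('k) k C" unfolding separable_def using q(1) assms(4) by (intro exI[of _ q]) auto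
  moreover have "card C = 4 * k" using C(2) by (simp add: card_cartesian_product)
  ultimately show ?thesis using C(1) by blast
qed

section \<open>The Segre-Veronese space in coordinates\<close>

text \<open>
  The coefficients of a power of a linear form. The recursion is the multiplication by one more
  linear factor, and it makes positivity provable by induction.
\<close>

fun multinomial :: "nat \<Rightarrow> ('n::finite \<Rightarrow>\<^sub>0 nat) \<Rightarrow> nat" where
  "multinomial 0 m = (if m = 0 then 1 else 0)"
| "multinomial (Suc d) m = (\<Sum>i | Poly_Mapping.lookup m i > 0. multinomial d (m - Poly_Mapping.single i 1))"

lemma monom_degree_UNIV: "monom_degree m = (\<Sum>i\<in>UNIV. Poly_Mapping.lookup m i)" for m :: "'n::finite \<Rightarrow>\<^sub>0 nat"
  unfolding monom_degree_def by (intro sum.mono_neutral_left) (auto simp: in_keys_iff)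

lemma split_off_variable:
  fixes m :: "'n \<Rightarrow>\<^sub>0 nat"
  assumes "Poly_Mapping.lookup m i > 0"
  shows "Poly_Mapping.single i 1 + (m - Poly_Mapping.single i 1) = m"
  by (rule poly_mapping_eqI) (use assms in \<open>auto simp: lookup_add lookup_minus lookup_single when_def\<close>)

lemma multinomial_pos_iff:
  fixes m :: "'n::finite \<Rightarrow>\<^sub>0 nat"
  shows "multinomial d m > 0 \<longleftrightarrow> monom_degree m = d"
proof (induction d arbitrary: m)
  case 0
  have "monom_degree m = 0 \<longleftrightarrow> m = 0"
    by (auto simp: monom_degree_UNIV intro!: poly_mapping_eqI)
  then show ?case by simp
next
  case (Suc d)
  have deg: "monom_degree m = Suc (monom_degree (m - Poly_Mapping.single i 1))" if "Poly_Mapping.lookup m i > 0" for i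
  proof -
    have "monom_degree (Poly_Mapping.single i (1::nat)) = 1" by (simp add: monom_degree_def)
    then show ?thesis
      using monom_degree_add[of "Poly_Mapping.single i 1" "m - Poly_Mapping.single i 1"]
      unfolding split_off_variable[OF that] by simp
  qed
  have "multinomial (Suc d) m > 0 \<longleftrightarrow> (\<exists>i. Poly_Mapping.lookup m i > 0 \<and> multinomial d (m - Poly_Mapping.single i 1) > 0)"
  proof -
    have "multinomial (Suc d) m = 0 \<longleftrightarrow> (\<forall>i\<in>{i. Poly_Mapping.lookup m i > 0}. multinomial d (m - Poly_Mapping.single i 1) = 0)"
      unfolding multinomial.simps by (rule sum_eq_0_iff) simp
    then have "multinomial (Suc d) m \<noteq> 0 \<longleftrightarrow> (\<exists>i\<in>{i. Poly_Mapping.lookup m i > 0}. multinomial d (m - Poly_Mapping.single i 1) \<noteq> 0)"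
      by (simp only: Bex_def Ball_def not_all not_imp)
    then show ?thesis by (simp del: multinomial.simps)
  qed
  also have "\<dots> \<longleftrightarrow> (\<exists>i. Poly_Mapping.lookup m i > 0 \<and> monom_degree m = Suc d)"
    using Suc.IH deg by auto
  also have "\<dots> \<longleftrightarrow> monom_degree m = Suc d"
  proof -
    have "\<exists>i. Poly_Mapping.lookup m i > 0" if "monom_degree m = Suc d"
    proof (rule ccontr)
      assume "\<not> ?thesis"
      then have "monom_degree m = 0" by (simp add: monom_degree_UNIV)
      with that show False by simp
    qed
    then show ?thesis by blast
  qed
  finally show ?case .
qed

lemma lookup_variable_mult:
  fixes p :: "('n \<Rightarrow>\<^sub>0 nat) \<Rightarrow>\<^sub>0 'k::field"
  shows "Poly_Mapping.lookup (Poly_Mapping.single (Poly_Mapping.single i 1) c * p) m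
    = (if Poly_Mapping.lookup m i > 0 then c * Poly_Mapping.lookup p (m - Poly_Mapping.single i 1) else 0)"
proof -
  have "Poly_Mapping.single (Poly_Mapping.single i 1) c * p
      = (\<Sum>b\<in>Poly_Mapping.keys p. Poly_Mapping.single (Poly_Mapping.single i 1 + b) (c * Poly_Mapping.lookup p b))"
    by (subst poly_mapping_expand[of p]) (simp add: sum_distrib_left mult_single)
  then have e: "Poly_Mapping.lookup (Poly_Mapping.single (Poly_Mapping.single i 1) c * p) m
      = (\<Sum>b\<in>Poly_Mapping.keys p. if Poly_Mapping.single i 1 + b = m then c * Poly_Mapping.lookup p b else 0)"
    by (simp add: lookup_sum lookup_single when_def)
  show ?thesis
  proof (cases "Poly_Mapping.lookup m i > 0")
    case True
    have "Poly_Mapping.single i 1 + b = m \<longleftrightarrow> b = m - Poly_Mapping.single i 1" for b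
      using split_off_variable[OF True] by (metis add_left_cancel)
    then show ?thesis using True unfolding e by (auto simp: in_keys_iff)
  next
    case False
    have "Poly_Mapping.single i 1 + b \<noteq> m" for b
    proof
      assume "Poly_Mapping.single i 1 + b = m"
      then have "Poly_Mapping.lookup m i > 0" by (auto simp: lookup_add)
      with False show False by simp
    qed
    then show ?thesis using False unfolding e by simp
  qed
qed

lemma lookup_linear_form_power:
  fixes u :: "'k::field ^ 'n::finite"
  shows "Poly_Mapping.lookup (linear_form u ^ d) m
    = of_nat (multinomial d m) * (\<Prod>i\<in>UNIV. u $ i ^ Poly_Mapping.lookup m i)"
proof (induction d arbitrary: m)
  case 0
  show ?case by (simp add: lookup_one)
next
  case (Suc d)
  let ?P = "\<lambda>m. \<Prod>i\<in>UNIV. u $ i ^ Poly_Mapping.lookup m i"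
  have P: "u $ i * ?P (m - Poly_Mapping.single i 1) = ?P m" if "Poly_Mapping.lookup m i > 0" for i
  proof -
    have "?P m = ?P (Poly_Mapping.single i 1 + (m - Poly_Mapping.single i 1))"
      by (simp only: split_off_variable[OF that])
    also have "\<dots> = ?P (Poly_Mapping.single i 1) * ?P (m - Poly_Mapping.single i 1)"
      by (simp only: lookup_add power_add prod.distrib)
    also have "?P (Poly_Mapping.single i 1) = (\<Prod>j\<in>UNIV. if j = i then u $ i else 1)"
      by (intro prod.cong) (auto simp: lookup_single when_def)
    also have "\<dots> = u $ i" by simp
    finally show ?thesis by simp
  qed
  have "linear_form u ^ Suc d = (\<Sum>i\<in>UNIV. Poly_Mapping.single (Poly_Mapping.single i 1) (u $ i) * linear_form u ^ d)"
    by (simp add: linear_form_def sum_distrib_right)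
  then have "Poly_Mapping.lookup (linear_form u ^ Suc d) m
      = (\<Sum>i\<in>UNIV. if Poly_Mapping.lookup m i > 0 then u $ i * Poly_Mapping.lookup (linear_form u ^ d) (m - Poly_Mapping.single i 1) else 0)"
    by (simp only: lookup_sum lookup_variable_mult)
  also have "\<dots> = (\<Sum>i | Poly_Mapping.lookup m i > 0. u $ i * Poly_Mapping.lookup (linear_form u ^ d) (m - Poly_Mapping.single i 1))"
    by (simp add: sum.If_cases)
  also have "\<dots> = (\<Sum>i | Poly_Mapping.lookup m i > 0. of_nat (multinomial d (m - Poly_Mapping.single i 1)) * ?P m)"
  proof (intro sum.cong refl)
    fix i assume "i \<in> {i. Poly_Mapping.lookup m i > 0}"
    then have "u $ i * ?P (m - Poly_Mapping.single i 1) = ?P m" by (intro P) simp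
    then show "u $ i * Poly_Mapping.lookup (linear_form u ^ d) (m - Poly_Mapping.single i 1)
        = of_nat (multinomial d (m - Poly_Mapping.single i 1)) * ?P m"
      unfolding Suc.IH by (simp add: mult.left_commute)
  qed
  also have "\<dots> = of_nat (multinomial (Suc d) m) * ?P m"
    by (simp add: sum_distrib_right)
  finally show ?case .
qed

type_synonym bimonomial = "(3 \<Rightarrow>\<^sub>0 nat) \<times> (2 \<Rightarrow>\<^sub>0 nat)"

definition bimonomials :: "nat \<Rightarrow> nat \<Rightarrow> bimonomial set" where
  "bimonomials d e = {(a, b). monom_degree a = d \<and> monom_degree b = e}"

text \<open>
  The exponents of the variables that are not set to 1 in the chart. The degrees determine the
  remaining two exponents.
\<close>

definition chart_point :: "bimonomial \<Rightarrow> point" where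
  "chart_point = (\<lambda>(a, b). (Poly_Mapping.lookup a 1, Poly_Mapping.lookup a 2, Poly_Mapping.lookup b 1))"

definition SV_coeff :: "nat \<Rightarrow> nat \<Rightarrow> bimonomial \<Rightarrow> nat" where
  "SV_coeff d e = (\<lambda>(a, b). multinomial d a * multinomial e b)"

lemma SV_coeff_pos_iff: "SV_coeff d e \<beta> > 0 \<longleftrightarrow> \<beta> \<in> bimonomials d e"
  by (cases \<beta>) (simp add: SV_coeff_def bimonomials_def multinomial_pos_iff)

lemma degree_three: "monom_degree a = Poly_Mapping.lookup a 1 + Poly_Mapping.lookup a 2 + Poly_Mapping.lookup a 3"
  for a :: "3 \<Rightarrow>\<^sub>0 nat"
  by (simp add: monom_degree_UNIV sum_3)

lemma degree_two: "monom_degree b = Poly_Mapping.lookup b 1 + Poly_Mapping.lookup b 2" for b :: "2 \<Rightarrow>\<^sub>0 nat"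
  by (simp add: monom_degree_UNIV sum_2)

lemma bij_chart_point: "bij_betw chart_point (bimonomials d e) (prism (lattice_triangle d) (Suc e))"
  unfolding bij_betw_def
proof
  show "inj_on chart_point (bimonomials d e)"
  proof (rule inj_onI)
    fix \<beta> \<gamma> assume \<beta>: "\<beta> \<in> bimonomials d e" and \<gamma>: "\<gamma> \<in> bimonomials d e" and eq: "chart_point \<beta> = chart_point \<gamma>"
    obtain a b where ab1: "\<beta> = (a, b)" by (cases \<beta>)
    obtain a' b' where ab2: "\<gamma> = (a', b')" by (cases \<gamma>)
    note ab = ab1 ab2
    have "Poly_Mapping.lookup a i = Poly_Mapping.lookup a' i" for i
      using eq \<beta> \<gamma> exhaust_3[of i] by (auto simp: ab chart_point_def bimonomials_def degree_three)
    moreover have "Poly_Mapping.lookup b i = Poly_Mapping.lookup b' i" for i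
      using eq \<beta> \<gamma> exhaust_2[of i] by (auto simp: ab chart_point_def bimonomials_def degree_two)
    ultimately show "\<beta> = \<gamma>" by (simp add: ab poly_mapping_eqI)
  qed
  show "chart_point ` bimonomials d e = prism (lattice_triangle d) (Suc e)"
  proof (intro subset_antisym subsetI)
    fix \<alpha> assume "\<alpha> \<in> chart_point ` bimonomials d e"
    then show "\<alpha> \<in> prism (lattice_triangle d) (Suc e)"
      by (auto simp: chart_point_def bimonomials_def prism_def lattice_triangle_def degree_three degree_two)
  next
    fix \<alpha> assume "\<alpha> \<in> prism (lattice_triangle d) (Suc e)"
    then obtain x y z where xyz: "\<alpha> = (x, y, z)" "x + y \<le> d" "z \<le> e" by (auto simp: prism_def lattice_triangle_def)
    define a :: "3 \<Rightarrow>\<^sub>0 nat" where "a = Poly_Mapping.single 1 x + Poly_Mapping.single 2 y + Poly_Mapping.single 3 (d - x - y)"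
    define b :: "2 \<Rightarrow>\<^sub>0 nat" where "b = Poly_Mapping.single 1 z + Poly_Mapping.single 2 (e - z)"
    have "(a, b) \<in> bimonomials d e" "chart_point (a, b) = \<alpha>"
      using xyz by (simp_all add: bimonomials_def chart_point_def degree_three degree_two a_def b_def lookup_add lookup_single when_def)
    then show "\<alpha> \<in> chart_point ` bimonomials d e" by force
  qed
qed

lemma finite_bimonomials: "finite (bimonomials d e)"
  using bij_betw_finite[OF bij_chart_point] finite_triangle_prism by blast

lemma card_bimonomials: "card (bimonomials d e) = card (prism (lattice_triangle d) (Suc e))"
  by (rule bij_betw_same_card[OF bij_chart_point])

lemma SV_space_eq: "SV_space d e = {p :: bimonomial \<Rightarrow>\<^sub>0 'k::field. Poly_Mapping.keys p \<subseteq> bimonomials d e}"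
proof
  have "pm.subspace {p :: bimonomial \<Rightarrow>\<^sub>0 'k. Poly_Mapping.keys p \<subseteq> bimonomials d e}"
  proof (rule pm.subspaceI)
    fix p q :: "bimonomial \<Rightarrow>\<^sub>0 'k" and c
    show "0 \<in> {p :: bimonomial \<Rightarrow>\<^sub>0 'k. Poly_Mapping.keys p \<subseteq> bimonomials d e}" by simp
    assume p: "p \<in> {p. Poly_Mapping.keys p \<subseteq> bimonomials d e}"
    then show "pm_scale c p \<in> {p. Poly_Mapping.keys p \<subseteq> bimonomials d e}" by (auto simp: in_keys_iff subset_iff)
    assume "q \<in> {p. Poly_Mapping.keys p \<subseteq> bimonomials d e}"
    with p show "p + q \<in> {p. Poly_Mapping.keys p \<subseteq> bimonomials d e}" using keys_add[of p q] by auto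
  qed
  moreover have "{tensor p q | p q. p \<in> forms d \<and> q \<in> forms e} \<subseteq> {p :: bimonomial \<Rightarrow>\<^sub>0 'k. Poly_Mapping.keys p \<subseteq> bimonomials d e}"
    by (auto simp: in_keys_iff lookup_tensor forms_def bimonomials_def)
  ultimately show "SV_space d e \<subseteq> {p :: bimonomial \<Rightarrow>\<^sub>0 'k. Poly_Mapping.keys p \<subseteq> bimonomials d e}"
    unfolding SV_space_def by (rule pm.span_minimal[rotated])
  show "{p :: bimonomial \<Rightarrow>\<^sub>0 'k. Poly_Mapping.keys p \<subseteq> bimonomials d e} \<subseteq> SV_space d e"
  proof
    fix p :: "bimonomial \<Rightarrow>\<^sub>0 'k" assume "p \<in> {p. Poly_Mapping.keys p \<subseteq> bimonomials d e}"
    then have k: "Poly_Mapping.keys p \<subseteq> bimonomials d e" by simp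
    have "Poly_Mapping.single \<beta> (Poly_Mapping.lookup p \<beta>) \<in> SV_space d e" if "\<beta> \<in> Poly_Mapping.keys p" for \<beta>
    proof -
      obtain a b where ab: "\<beta> = (a, b)" by (cases \<beta>)
      have "Poly_Mapping.single \<beta> (Poly_Mapping.lookup p \<beta>) = tensor (Poly_Mapping.single a (Poly_Mapping.lookup p \<beta>)) (Poly_Mapping.single b 1)"
        by (intro poly_mapping_eqI) (auto simp: ab lookup_tensor lookup_single when_def split_paired_all)
      moreover have "(a, b) \<in> bimonomials d e" using that k ab by blast
      then have "Poly_Mapping.single a (Poly_Mapping.lookup p \<beta>) \<in> forms d" "Poly_Mapping.single b (1::'k) \<in> forms e"
        by (simp_all add: forms_def bimonomials_def)
      ultimately show ?thesis unfolding SV_space_def by (intro pm.span_base) blast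
    qed
    then have "(\<Sum>\<beta>\<in>Poly_Mapping.keys p. Poly_Mapping.single \<beta> (Poly_Mapping.lookup p \<beta>)) \<in> SV_space d e"
      unfolding SV_space_def by (intro pm.span_sum)
    then show "p \<in> SV_space d e" using poly_mapping_expand[of p] by simp
  qed
qed

lemma dim_SV_space: "pm.dim (SV_space d e :: (bimonomial \<Rightarrow>\<^sub>0 'k::field) set) = card (bimonomials d e)"
proof -
  let ?s = "\<lambda>\<beta>. Poly_Mapping.single \<beta> (1::'k)"
  let ?S = "?s ` bimonomials d e"
  have inj: "inj_on ?s (bimonomials d e)"
    by (rule inj_onI) (metis lookup_single_eq lookup_single_not_eq zero_neq_one)
  have sub: "?S \<subseteq> SV_space d e" unfolding SV_space_eq by auto
  have spans: "SV_space d e \<subseteq> pm.span ?S"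
  proof
    fix p :: "bimonomial \<Rightarrow>\<^sub>0 'k" assume "p \<in> SV_space d e"
    then have k: "Poly_Mapping.keys p \<subseteq> bimonomials d e" by (simp add: SV_space_eq)
    have "p = (\<Sum>\<beta>\<in>Poly_Mapping.keys p. pm_scale (Poly_Mapping.lookup p \<beta>) (?s \<beta>))"
    proof -
      have "Poly_Mapping.single \<beta> c = pm_scale c (?s \<beta>)" for \<beta> c
        by (rule poly_mapping_eqI) (simp add: lookup_single when_def)
      then have "(\<Sum>\<beta>\<in>Poly_Mapping.keys p. Poly_Mapping.single \<beta> (Poly_Mapping.lookup p \<beta>))
          = (\<Sum>\<beta>\<in>Poly_Mapping.keys p. pm_scale (Poly_Mapping.lookup p \<beta>) (?s \<beta>))"
        by (intro sum.cong refl)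
      with poly_mapping_expand[of p] show ?thesis by (rule trans)
    qed
    also have "\<dots> \<in> pm.span ?S" using k by (intro pm.span_sum pm.span_scale pm.span_base) auto
    finally show "p \<in> pm.span ?S" .
  qed
  have "pm.independent ?S"
  proof (rule pm.independent_if_scalars_zero)
    show "finite ?S" using finite_bimonomials by simp
    fix f and v assume 0: "(\<Sum>v\<in>?S. pm_scale (f v) v) = 0" and "v \<in> ?S"
    then obtain \<beta> where \<beta>: "\<beta> \<in> bimonomials d e" "v = ?s \<beta>" by blast
    have "0 = Poly_Mapping.lookup (\<Sum>v\<in>?S. pm_scale (f v) v) \<beta>" by (simp only: 0 lookup_zero)
    also have "\<dots> = (\<Sum>\<gamma>\<in>bimonomials d e. if \<gamma> = \<beta> then f (?s \<beta>) else 0)"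
      by (simp add: sum.reindex[OF inj] lookup_sum lookup_single when_def) (intro sum.cong, auto)
    also have "\<dots> = f v" using \<beta> finite_bimonomials by simp
    finally show "f v = 0" by simp
  qed
  from pm.dim_unique[OF sub spans this] show ?thesis using card_image[OF inj] by blast
qed

section \<open>Parametrization of secants\<close>

definition power_tensor :: "nat \<Rightarrow> nat \<Rightarrow> 'k::field ^ 3 \<Rightarrow> 'k ^ 2 \<Rightarrow> bimonomial \<Rightarrow>\<^sub>0 'k" where
  "power_tensor d e u v = tensor (linear_form u ^ d) (linear_form v ^ e)"

lemma lookup_power_tensor:
  "Poly_Mapping.lookup (power_tensor d e u v) (a, b) = of_nat (SV_coeff d e (a, b))
    * ((\<Prod>i\<in>UNIV. u $ i ^ Poly_Mapping.lookup a i) * (\<Prod>i\<in>UNIV. v $ i ^ Poly_Mapping.lookup b i))"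
  by (simp add: power_tensor_def lookup_tensor lookup_linear_form_power SV_coeff_def mult_ac)

lemma power_tensor_scale: "power_tensor d e (c *s u) (c' *s v) = pm_scale (c ^ d * c' ^ e) (power_tensor d e u v)"
  by (simp add: power_tensor_def linear_form_scale pm_scale_power tensor_scale)

lemma keys_power_tensor: "Poly_Mapping.keys (power_tensor d e u v) \<subseteq> bimonomials d e"
proof
  fix \<beta> assume "\<beta> \<in> Poly_Mapping.keys (power_tensor d e u v)"
  then have "SV_coeff d e \<beta> > 0" by (cases \<beta>) (auto simp: in_keys_iff lookup_power_tensor intro!: gr0I)
  then show "\<beta> \<in> bimonomials d e" using SV_coeff_pos_iff by blast
qed

lemma power_tensor_in_SV_space: "power_tensor d e u v \<in> SV_space d e"
  by (simp add: SV_space_eq keys_power_tensor)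

lemma subspace_SV_space: "pm.subspace (SV_space d e)"
  by (simp add: SV_space_def)

lemma power_tensor_nonzero:
  fixes u :: "'k::field_char_0 ^ 3"
  assumes "u \<noteq> 0" "v \<noteq> 0"
  shows "power_tensor d e u v \<noteq> 0"
proof -
  obtain i j where ij: "u $ i \<noteq> 0" "v $ j \<noteq> 0" using assms by (auto simp: vec_eq_iff)
  let ?a = "Poly_Mapping.single i d" and ?b = "Poly_Mapping.single j e"
  have "(?a, ?b) \<in> bimonomials d e" by (simp add: bimonomials_def monom_degree_def)
  then have "SV_coeff d e (?a, ?b) > 0" by (simp only: SV_coeff_pos_iff)
  moreover have "(\<Prod>l\<in>UNIV. u $ l ^ Poly_Mapping.lookup ?a l) \<noteq> 0" "(\<Prod>l\<in>UNIV. v $ l ^ Poly_Mapping.lookup ?b l) \<noteq> 0"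
    using ij by (auto simp: lookup_single when_def)
  ultimately have "Poly_Mapping.lookup (power_tensor d e u v) (?a, ?b) \<noteq> 0" by (simp add: lookup_power_tensor)
  then show ?thesis by auto
qed

lemma SV_variety_eq:
  "SV_variety d e = {pm.span {power_tensor d e u v} | (u :: 'k::field ^ 3) v. u \<noteq> 0 \<and> v \<noteq> 0}"
proof -
  have m: "SV_map d e (vec.span {u}, vec.span {v}) = pm.span {power_tensor d e u v}" for u :: "'k ^ 3" and v :: "'k ^ 2"
    by (simp add: SV_map_span power_tensor_def)
  show ?thesis
  proof (intro subset_antisym subsetI)
    fix L :: "(bimonomial \<Rightarrow>\<^sub>0 'k) set" assume "L \<in> SV_variety d e"
    then obtain u :: "'k ^ 3" and v :: "'k ^ 2" where "u \<noteq> 0" "v \<noteq> 0" "L = SV_map d e (vec.span {u}, vec.span {v})"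
      unfolding SV_variety_def vec.projectivization_def by blast
    then show "L \<in> {pm.span {power_tensor d e u v} | (u :: 'k ^ 3) v. u \<noteq> 0 \<and> v \<noteq> 0}" unfolding m by blast
  next
    fix L :: "(bimonomial \<Rightarrow>\<^sub>0 'k) set" assume "L \<in> {pm.span {power_tensor d e u v} | (u :: 'k ^ 3) v. u \<noteq> 0 \<and> v \<noteq> 0}"
    then obtain u :: "'k ^ 3" and v :: "'k ^ 2" where uv: "u \<noteq> 0" "v \<noteq> 0" "L = SV_map d e (vec.span {u}, vec.span {v})"
      unfolding m by blast
    then show "L \<in> SV_variety d e"
      unfolding SV_variety_def vec.projectivization_def by (intro image_eqI[of _ _ "(vec.span {u}, vec.span {v})"]) auto
  qed
qed

definition secants :: "('i \<Rightarrow>\<^sub>0 'k::field) set set \<Rightarrow> nat \<Rightarrow> ('i \<Rightarrow>\<^sub>0 'k) set set" where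
  "secants X k = (\<Union>S\<in>{S. S \<subseteq> X \<and> finite S \<and> card S = k}. pm.projectivization (pm.span (\<Union>S)))"

lemma secant_variety_closure: "secant_variety V X k = zariski V closure_of secants X k"
  by (simp add: secant_variety_def secants_def)

lemma secants_in_projectivization:
  "secants (SV_variety d e :: (bimonomial \<Rightarrow>\<^sub>0 'k::field) set set) k \<subseteq> pm.projectivization (SV_space d e)"
proof -
  have "pm.span (\<Union>S) \<subseteq> SV_space d e" if "S \<subseteq> SV_variety d e" for S :: "(bimonomial \<Rightarrow>\<^sub>0 'k) set set"
  proof (rule pm.span_minimal[OF _ subspace_SV_space])
    have "L \<subseteq> SV_space d e" if L: "L \<in> SV_variety d e" for L :: "(bimonomial \<Rightarrow>\<^sub>0 'k) set"
    proof -
      obtain u :: "'k ^ 3" and v :: "'k ^ 2" where "L = pm.span {power_tensor d e u v}"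
        using L unfolding SV_variety_eq by blast
      then show ?thesis using pm.span_minimal[OF _ subspace_SV_space] power_tensor_in_SV_space by blast
    qed
    then show "\<Union>S \<subseteq> SV_space d e" using that by blast
  qed
  then show ?thesis unfolding secants_def pm.projectivization_def by blast
qed

text \<open>
  Sums of \<open>k\<close> multiples of arbitrary points of the cone over the Segre-Veronese variety. For each
  index, variable 0 is the coefficient, 1 to 3 are the homogeneous coordinates in the plane and 4, 5
  those on the line.
\<close>

definition full_param :: "nat \<Rightarrow> nat \<Rightarrow> nat \<Rightarrow> (nat \<times> nat \<Rightarrow> 'k::field) \<Rightarrow> bimonomial \<Rightarrow>\<^sub>0 'k" where
  "full_param d e k z = (\<Sum>i<k. pm_scale (z (i, 0))
     (power_tensor d e (vector [z (i, 1), z (i, 2), z (i, 3)]) (vector [z (i, 4), z (i, 5)])))"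

text \<open>
  The same with the last homogeneous coordinates set to 1. There are \<open>4 * k\<close> variables, the dimension of the cone
  over a non-defective secant variety that does not fill the space.
\<close>

definition chart_param :: "nat \<Rightarrow> nat \<Rightarrow> nat \<Rightarrow> (nat \<times> nat \<Rightarrow> 'k::field) \<Rightarrow> bimonomial \<Rightarrow>\<^sub>0 'k" where
  "chart_param d e k x = (\<Sum>i<k. pm_scale (x (i, 0))
     (power_tensor d e (vector [x (i, 1), x (i, 2), 1]) (vector [x (i, 3), 1])))"

lemma prod_UNIV_3: "(\<Prod>i\<in>(UNIV::3 set). f i) = f 1 * (f 2 * f 3)"
  unfolding UNIV_3 by simp

lemma prod_UNIV_2: "(\<Prod>i\<in>(UNIV::2 set). f i) = f 1 * f 2"
  unfolding UNIV_2 by simp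

lemma lookup_chart_param:
  "Poly_Mapping.lookup (chart_param d e k x) \<beta>
    = of_nat (SV_coeff d e \<beta>) * (\<Sum>i<k. x (i, 0) * monomial (x (i, 1), x (i, 2), x (i, 3)) (chart_point \<beta>))"
proof -
  obtain a b where \<beta>: "\<beta> = (a, b)" by (cases \<beta>)
  show ?thesis
    unfolding \<beta> chart_param_def lookup_sum sum_distrib_left
    by (intro sum.cong refl) (simp add: lookup_power_tensor prod_UNIV_3 prod_UNIV_2 chart_point_def mult_ac)
qed

lemma polyfun_monomial:
  assumes "polyfun f" "polyfun g" "polyfun h"
  shows "polyfun (\<lambda>x. monomial (f x, g x, h x) \<alpha>)"
proof -
  obtain a b c where "\<alpha> = (a, b, c)" by (cases \<alpha>)
  moreover have "polyfun (\<lambda>x. f x ^ a * g x ^ b * h x ^ c)"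
    by (intro polyfun.mult polyfun_power assms)
  ultimately show ?thesis by simp
qed

lemma polyfun_chart_param: "polyfun (\<lambda>x :: nat \<times> nat \<Rightarrow> 'a::field. Poly_Mapping.lookup (chart_param d e k x) \<beta>)"
proof -
  have "polyfun (\<lambda>x :: nat \<times> nat \<Rightarrow> 'a. x (i, 0) * monomial (x (i, 1), x (i, 2), x (i, 3)) (chart_point \<beta>))" for i :: nat
    by (rule polyfun.mult[OF polyfun.var polyfun_monomial[OF polyfun.var polyfun.var polyfun.var]])
  then have "polyfun (\<lambda>x :: nat \<times> nat \<Rightarrow> 'a. of_nat (SV_coeff d e \<beta>) * (\<Sum>i<k. x (i, 0) * monomial (x (i, 1), x (i, 2), x (i, 3)) (chart_point \<beta>)))"
    by (rule polyfun.mult[OF polyfun.const polyfun_sum])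
  then show ?thesis unfolding lookup_chart_param .
qed

lemma polyfun_full_param: "polyfun (\<lambda>z :: nat \<times> nat \<Rightarrow> 'a::field. Poly_Mapping.lookup (full_param d e k z) \<beta>)"
proof -
  obtain a b where \<beta>: "\<beta> = (a, b)" by (cases \<beta>)
  have pw: "polyfun (\<lambda>z :: nat \<times> nat \<Rightarrow> 'a. z r ^ n)" for r :: "nat \<times> nat" and n by (rule polyfun_power) (rule polyfun.var)
  have "polyfun (\<lambda>z :: nat \<times> nat \<Rightarrow> 'a. z (i, 0) * (of_nat (SV_coeff d e (a, b))
    * ((z (i, 1) ^ Poly_Mapping.lookup a 1 * (z (i, 2) ^ Poly_Mapping.lookup a 2 * z (i, 3) ^ Poly_Mapping.lookup a 3))
     * (z (i, 4) ^ Poly_Mapping.lookup b 1 * z (i, 5) ^ Poly_Mapping.lookup b 2))))" for i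
    by (intro polyfun.mult pw polyfun.var polyfun.const)
  then have "polyfun (\<lambda>z :: nat \<times> nat \<Rightarrow> 'a. \<Sum>i<k. z (i, 0) * (of_nat (SV_coeff d e (a, b))
    * ((z (i, 1) ^ Poly_Mapping.lookup a 1 * (z (i, 2) ^ Poly_Mapping.lookup a 2 * z (i, 3) ^ Poly_Mapping.lookup a 3))
     * (z (i, 4) ^ Poly_Mapping.lookup b 1 * z (i, 5) ^ Poly_Mapping.lookup b 2))))"
    by (rule polyfun_sum)
  then show ?thesis
    by (simp only: \<beta> full_param_def lookup_sum lookup_pm_scale lookup_power_tensor prod_UNIV_3 prod_UNIV_2 vector_3 vector_2)
qed

lemma full_param_in_chart:
  fixes z :: "nat \<times> nat \<Rightarrow> 'k::field"
  assumes "\<And>i. i < k \<Longrightarrow> z (i, 3) \<noteq> 0 \<and> z (i, 5) \<noteq> 0"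
  shows "\<exists>x. full_param d e k z = chart_param d e k x"
proof -
  define x :: "nat \<times> nat \<Rightarrow> 'k" where "x = (\<lambda>(i, j). if j = 0 then z (i, 0) * (z (i, 3) ^ d * z (i, 5) ^ e) else if j = 1 then z (i, 1) / z (i, 3)
    else if j = 2 then z (i, 2) / z (i, 3) else z (i, 4) / z (i, 5))"
  have "full_param d e k z = chart_param d e k x"
    unfolding full_param_def chart_param_def
  proof (intro sum.cong refl)
    fix i assume "i \<in> {..<k}"
    then have nz: "z (i, 3) \<noteq> 0" "z (i, 5) \<noteq> 0" using assms[of i] by simp_all
    have u: "vector [z (i, 1), z (i, 2), z (i, 3)] = z (i, 3) *s (vector [x (i, 1), x (i, 2), 1] :: 'k ^ 3)"
      using nz by (simp add: vec_eq_iff forall_3 x_def)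
    have v: "vector [z (i, 4), z (i, 5)] = z (i, 5) *s (vector [x (i, 3), 1] :: 'k ^ 2)"
      using nz by (simp add: vec_eq_iff forall_2 x_def)
    show "pm_scale (z (i, 0)) (power_tensor d e (vector [z (i, 1), z (i, 2), z (i, 3)]) (vector [z (i, 4), z (i, 5)]))
      = pm_scale (x (i, 0)) (power_tensor d e (vector [x (i, 1), x (i, 2), 1]) (vector [x (i, 3), 1]))"
      unfolding u v power_tensor_scale by (simp add: x_def)
  qed
  then show ?thesis by blast
qed

text \<open>
  The chart covers the parameters for which the product of the last coordinates does not vanish.
  This product is not the zero function, so it can be cancelled.
\<close>

lemma form_vanishes_full_param:
  fixes f :: "(bimonomial \<Rightarrow>\<^sub>0 'k::field_char_0) \<Rightarrow> 'k"
  assumes f: "is_form n f" and 0: "\<And>x. f (chart_param d e k x) = 0"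
  shows "f (full_param d e k z) = 0"
proof -
  let ?\<Delta> = "\<lambda>z :: nat \<times> nat \<Rightarrow> 'k. \<Prod>i<k. z (i, 3) * z (i, 5)"
  have "f (full_param d e k z) * ?\<Delta> z = 0" for z
  proof (cases "?\<Delta> z = 0")
    case False
    then have "\<And>i. i < k \<Longrightarrow> z (i, 3) \<noteq> 0 \<and> z (i, 5) \<noteq> 0" by simp
    then obtain x where "full_param d e k z = chart_param d e k x" using full_param_in_chart by blast
    then show ?thesis using 0 by simp
  qed simp
  moreover have "polyfun (\<lambda>z. f (full_param d e k z))" by (rule is_form_comp_polyfun[OF f polyfun_full_param])
  moreover have "polyfun ?\<Delta>"
    by (rule polyfun_prod) (rule polyfun.mult[OF polyfun.var polyfun.var])
  ultimately have "(\<forall>z. f (full_param d e k z) = 0) \<or> (\<forall>z. ?\<Delta> z = 0)" by (intro polyfun_domain)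
  moreover have "\<not> (\<forall>z. ?\<Delta> z = 0)"
  proof
    assume "\<forall>z. ?\<Delta> z = 0"
    then have "?\<Delta> (\<lambda>_. 1) = 0" by (rule spec)
    then show False by simp
  qed
  ultimately show ?thesis by blast
qed

lemma span_image_lessThan:
  "y \<in> pm.span (w ` {..<k::nat}) \<Longrightarrow> \<exists>t. y = (\<Sum>i<k. pm_scale (t i) (w i))"
proof (induction k arbitrary: y)
  case 0 then show ?case by simp
next
  case (Suc k)
  have "w ` {..<Suc k} = insert (w k) (w ` {..<k})" by (simp add: lessThan_Suc)
  then obtain c where "y - pm_scale c (w k) \<in> pm.span (w ` {..<k})"
    using Suc.prems by (auto simp: pm.span_insert)
  then obtain t where t: "y - pm_scale c (w k) = (\<Sum>i<k. pm_scale (t i) (w i))" using Suc.IH by blast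
  have "y = (\<Sum>i<Suc k. pm_scale ((t(k := c)) i) (w i))" using t by (simp add: algebra_simps)
  then show ?case by blast
qed

lemma form_vanishes_on_secants:
  fixes f :: "(bimonomial \<Rightarrow>\<^sub>0 'k::field_char_0) \<Rightarrow> 'k"
  assumes f: "is_form n f" and 0: "\<And>x. f (chart_param d e k x) = 0" and L: "L \<in> secants (SV_variety d e) k"
  shows "vanishes f L"
proof -
  obtain S where S: "S \<subseteq> SV_variety d e" "finite S" "card S = k" "L \<in> pm.projectivization (pm.span (\<Union>S))"
    using L unfolding secants_def by blast
  then obtain y where y: "y \<in> pm.span (\<Union>S)" "L = pm.span {y}" by (auto simp: projectivization_iff)
  obtain h where h: "bij_betw h {..<k} S" using ex_bij_betw_nat_finite[OF S(2)] S(3) by (auto simp: atLeast0LessThan)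
  have "\<exists>u v. h i = pm.span {power_tensor d e u v}" if "i < k" for i
  proof -
    have "h i \<in> SV_variety d e" using h S(1) that by (auto simp: bij_betw_def)
    then show ?thesis unfolding SV_variety_eq by blast
  qed
  then obtain u v where uv: "\<And>i. i < k \<Longrightarrow> h i = pm.span {power_tensor d e (u i) (v i)}" by metis
  let ?w = "\<lambda>i. power_tensor d e (u i) (v i)"
  have "\<Union>S \<subseteq> pm.span (?w ` {..<k})"
  proof
    fix y assume "y \<in> \<Union>S"
    then obtain i where "i < k" "y \<in> h i" using h by (auto simp: bij_betw_def)
    then have "y \<in> pm.span {?w i}" using uv by simp
    moreover have "pm.span {?w i} \<subseteq> pm.span (?w ` {..<k})" using \<open>i < k\<close> by (intro pm.span_mono) auto
    ultimately show "y \<in> pm.span (?w ` {..<k})" by blast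
  qed
  then have "pm.span (\<Union>S) \<subseteq> pm.span (?w ` {..<k})" by (rule pm.span_minimal) (rule pm.subspace_span)
  then obtain t where t: "y = (\<Sum>i<k. pm_scale (t i) (?w i))" using y(1) span_image_lessThan by blast
  define z where "z = (\<lambda>(i, j). if j = 0 then t i else if j = 1 then u i $ 1 else if j = 2 then u i $ 2 else if j = 3 then u i $ 3
    else if j = (4::nat) then v i $ 1 else v i $ 2)"
  have "full_param d e k z = y"
  proof -
    have "vector [u i $ 1, u i $ 2, u i $ 3] = u i" "vector [v i $ 1, v i $ 2] = v i" for i
      by (simp_all add: vec_eq_iff forall_3 forall_2)
    then show ?thesis by (simp add: full_param_def t z_def)
  qed
  then have "f y = 0" using form_vanishes_full_param[OF f 0, of z] by simp
  then show ?thesis using y(2) vanishes_span[OF f] by simp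
qed

lemma lookup_chart_tensor:
  "Poly_Mapping.lookup (power_tensor d e (vector [a, b, 1]) (vector [c, 1])) \<beta>
    = of_nat (SV_coeff d e \<beta>) * monomial (a, b, c) (chart_point \<beta>)"
  by (cases \<beta>) (simp add: lookup_power_tensor prod_UNIV_3 prod_UNIV_2 chart_point_def mult_ac)

lemma infinite_SV_variety:
  assumes "d \<ge> 1"
  shows "infinite (SV_variety d e :: (bimonomial \<Rightarrow>\<^sub>0 'k::field_char_0) set set)"
proof -
  let ?w = "\<lambda>c :: 'k. power_tensor d e (vector [c, 0, 1]) (vector [0, 1])"
  have "(0, 0, 0) \<in> prism (lattice_triangle d) (Suc e)" "(1, 0, 0) \<in> prism (lattice_triangle d) (Suc e)"
    using assms by (auto simp: prism_def lattice_triangle_def)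
  then obtain \<beta>0 \<beta>1 where \<beta>: "\<beta>0 \<in> bimonomials d e" "chart_point \<beta>0 = (0, 0, 0)"
    "\<beta>1 \<in> bimonomials d e" "chart_point \<beta>1 = (1, 0, 0)"
    using bij_chart_point[of d e] unfolding bij_betw_def by (metis (no_types, lifting) imageE)
  have "inj (\<lambda>c. pm.span {?w c})"
  proof (rule injI)
    fix c c' assume "pm.span {?w c} = pm.span {?w c'}"
    then have "?w c \<in> pm.span {?w c'}" by (metis pm.span_base singletonI)
    then obtain l where l: "?w c = pm_scale l (?w c')" by (auto simp: pm.span_singleton)
    have k0: "SV_coeff d e \<beta>0 \<noteq> 0" "SV_coeff d e \<beta>1 \<noteq> 0" using \<beta> SV_coeff_pos_iff by blast+
    have "l = 1" using arg_cong[OF l, of "\<lambda>p. Poly_Mapping.lookup p \<beta>0"] k0 by (simp add: lookup_chart_tensor \<beta>)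
    then show "c = c'" using arg_cong[OF l, of "\<lambda>p. Poly_Mapping.lookup p \<beta>1"] k0 by (simp add: lookup_chart_tensor \<beta>)
  qed
  then have "infinite (range (\<lambda>c. pm.span {?w c}))" using infinite_UNIV_char_0 finite_imageD by blast
  moreover have "range (\<lambda>c. pm.span {?w c}) \<subseteq> SV_variety d e"
  proof -
    have "(vector [c, 0, 1] :: 'k ^ 3) \<noteq> 0" "(vector [0, 1] :: 'k ^ 2) \<noteq> 0" for c
      by (auto simp: vec_eq_iff intro: exI[of _ 3] exI[of _ 2])
    then show ?thesis unfolding SV_variety_eq by blast
  qed
  ultimately show ?thesis using finite_subset by blast
qed

text \<open>
  The \<open>k\<close> summands may belong to fewer than \<open>k\<close> distinct points of the variety. As the variety is
  infinite, further points can be added.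
\<close>

lemma chart_param_in_secants:
  fixes x :: "nat \<times> nat \<Rightarrow> 'k::field_char_0"
  assumes "d \<ge> 1" and nz: "chart_param d e k x \<noteq> 0"
  shows "pm.span {chart_param d e k x} \<in> secants (SV_variety d e) k"
proof -
  let ?w = "\<lambda>i. power_tensor d e (vector [x (i, 1), x (i, 2), 1]) (vector [x (i, 3), 1])"
  let ?S0 = "(\<lambda>i. pm.span {?w i}) ` {..<k}"
  have "(vector [a, b, 1] :: 'k ^ 3) \<noteq> 0" "(vector [c, 1] :: 'k ^ 2) \<noteq> 0" for a b c :: 'k
    by (auto simp: vec_eq_iff intro: exI[of _ 3] exI[of _ 2])
  then have S0: "?S0 \<subseteq> SV_variety d e" unfolding SV_variety_eq by blast
  have c: "card ?S0 \<le> k" using card_image_le[of "{..<k}" "\<lambda>i. pm.span {?w i}"] by simp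
  have "infinite (SV_variety d e - ?S0)" using infinite_SV_variety[OF assms(1)] by (simp add: Diff_infinite_finite)
  then obtain S1 where S1: "S1 \<subseteq> SV_variety d e - ?S0" "finite S1" "card S1 = k - card ?S0"
    using infinite_arbitrarily_large[of "SV_variety d e - ?S0" "k - card ?S0"] by blast
  define S where "S = ?S0 \<union> S1"
  have "card S = k" unfolding S_def using S1 c by (subst card_Un_disjoint) auto
  moreover have "S \<subseteq> SV_variety d e" "finite S" using S0 S1 by (auto simp: S_def)
  moreover have "chart_param d e k x \<in> pm.span (\<Union>S)"
    unfolding chart_param_def
  proof (intro pm.span_sum pm.span_scale pm.span_base)
    fix i assume "i \<in> {..<k}"
    then have "pm.span {?w i} \<in> S" by (simp add: S_def)
    then show "?w i \<in> \<Union>S" using pm.span_base[of "?w i" "{?w i}"] by blast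
  qed
  ultimately have "S \<in> {S. S \<subseteq> SV_variety d e \<and> finite S \<and> card S = k}"
    "pm.span {chart_param d e k x} \<in> pm.projectivization (pm.span (\<Union>S))"
    using nz unfolding pm.projectivization_def by simp_all
  then show ?thesis unfolding secants_def by (rule UN_I)
qed

lemma SV_variety_eq_secants: "SV_variety d e = secants (SV_variety d e :: (bimonomial \<Rightarrow>\<^sub>0 'k::field_char_0) set set) 1"
proof (intro subset_antisym subsetI)
  fix L :: "(bimonomial \<Rightarrow>\<^sub>0 'k) set" assume L: "L \<in> SV_variety d e"
  then obtain u v where uv: "L = pm.span {power_tensor d e u v}" "u \<noteq> 0" "v \<noteq> 0" unfolding SV_variety_eq by blast
  have "L \<in> pm.projectivization (pm.span (\<Union>{L}))"
    using uv power_tensor_nonzero[OF uv(2,3)]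
    by (auto simp: projectivization_iff pm.span_span intro!: bexI[of _ "power_tensor d e u v"] pm.span_base)
  then show "L \<in> secants (SV_variety d e) 1" unfolding secants_def using L by (intro UN_I[of "{L}"]) auto
next
  fix M :: "(bimonomial \<Rightarrow>\<^sub>0 'k) set" assume "M \<in> secants (SV_variety d e) 1"
  then obtain S where S: "S \<subseteq> SV_variety d e" "card S = 1" "M \<in> pm.projectivization (pm.span (\<Union>S))"
    unfolding secants_def by blast
  then obtain L where SL: "S = {L}" by (auto simp: card_1_singleton_iff)
  then obtain u v where uv: "L = pm.span {power_tensor d e u v}" using S(1) unfolding SV_variety_eq by blast
  obtain y where y: "y \<in> L" "y \<noteq> 0" "M = pm.span {y}"
    using S(3) unfolding SL by (auto simp: projectivization_iff uv pm.span_span)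
  obtain c where c: "y = pm_scale c (power_tensor d e u v)" using y(1) unfolding uv by (auto simp: pm.span_singleton)
  then have "c \<noteq> 0" using y(2) by auto
  have "M = L"
  proof
    show "M \<subseteq> L" unfolding y(3) uv using y(1) uv by (intro pm.span_minimal) auto
    have "power_tensor d e u v = pm_scale (1 / c) y" using \<open>c \<noteq> 0\<close> by (simp add: c)
    then have "power_tensor d e u v \<in> M" unfolding y(3) by (simp add: pm.span_base pm.span_scale)
    then show "L \<subseteq> M" unfolding uv y(3) by (intro pm.span_minimal) auto
  qed
  then show "M \<in> SV_variety d e" using S(1) SL by simp
qed

section \<open>Dimensions of secant varieties and ranks\<close>

abbreviation chart_coord :: "(nat \<times> nat \<Rightarrow> 'k) \<Rightarrow> nat \<Rightarrow> 'k \<times> 'k \<times> 'k" where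
  "chart_coord x i \<equiv> (x (i, 1), x (i, 2), x (i, 3))"

lemma chart_param_cone: "\<exists>x'. chart_param d e k x' = pm_scale t (chart_param d e k x)"
proof (intro exI poly_mapping_eqI)
  fix \<beta>
  show "Poly_Mapping.lookup (chart_param d e k (\<lambda>(i, j). if j = 0 then t * x (i, 0) else x (i, j))) \<beta>
    = Poly_Mapping.lookup (pm_scale t (chart_param d e k x)) \<beta>"
    by (simp add: lookup_chart_param sum_distrib_left mult_ac)
qed

lemma chart_param_cong: "(\<forall>s\<in>{..<k} \<times> {..<4}. x s = y s) \<Longrightarrow> chart_param d e k x = chart_param d e k y"
  unfolding chart_param_def by (intro sum.cong refl) simp

lemma pd_var_power:
  "pd s (\<lambda>x. x r ^ n) x = (if s = r then of_nat n * x r ^ (n - 1) else (0 :: 'k::field_char_0))"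
  using pd_power_minus_const[of s r 0 n x] by simp

lemma polyfun_var_power: "polyfun (\<lambda>x. x r ^ n)"
  by (rule polyfun_power) (rule polyfun.var)

lemma euler_var_power: "x s * pd s (\<lambda>x. x r ^ n) x = (if s = r then of_nat n * x r ^ n else (0 :: 'k::field_char_0))"
  unfolding pd_var_power by (cases n) simp_all

lemma euler_mult:
  fixes f :: "('p \<Rightarrow> 'k::field_char_0) \<Rightarrow> 'k"
  assumes "polyfun f" "polyfun g"
  shows "x s * pd s (\<lambda>x. f x * g x) x = (x s * pd s f x) * g x + f x * (x s * pd s g x)"
  by (simp add: pd_mult[OF assms] algebra_simps)

text \<open>
  Multiplying a derivative by its variable reproduces the monomial up to its exponent, which keeps
  the formulas free of exponents lowered by 1.
\<close>

lemma euler_chart_term: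
  fixes x :: "nat \<times> nat \<Rightarrow> 'k::field_char_0"
  assumes "j < 4"
  shows "x (i', j) * pd (i', j) (\<lambda>x. x (i, 0) * monomial (chart_coord x i) \<alpha>) x
    = (if i = i' then x (i, 0) * (of_nat (weight j \<alpha>) * monomial (chart_coord x i) \<alpha>) else 0)"
proof -
  obtain a b c where \<alpha>: "\<alpha> = (a, b, c)" by (cases \<alpha>)
  let ?A = "\<lambda>x :: nat \<times> nat \<Rightarrow> 'k. x (i, 1) ^ a" and ?B = "\<lambda>x :: nat \<times> nat \<Rightarrow> 'k. x (i, 2) ^ b"
    and ?C = "\<lambda>x :: nat \<times> nat \<Rightarrow> 'k. x (i, 3) ^ c" and ?t = "\<lambda>x :: nat \<times> nat \<Rightarrow> 'k. x (i, 0) ^ 1"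
  have p: "polyfun ?A" "polyfun ?B" "polyfun ?C" "polyfun ?t" by (rule polyfun_var_power)+
  have AB: "polyfun (\<lambda>x. ?A x * ?B x)" by (rule polyfun.mult[OF p(1,2)])
  have ABC: "polyfun (\<lambda>x. ?A x * ?B x * ?C x)" by (rule polyfun.mult[OF AB p(3)])
  have "x (i', j) * pd (i', j) (\<lambda>x. ?t x * (?A x * ?B x * ?C x)) x
    = (x (i', j) * pd (i', j) ?t x) * (?A x * ?B x * ?C x) + ?t x * (((x (i', j) * pd (i', j) ?A x) * ?B x
      + ?A x * (x (i', j) * pd (i', j) ?B x)) * ?C x + ?A x * ?B x * (x (i', j) * pd (i', j) ?C x))"
    by (simp only: euler_mult[OF p(4) ABC] euler_mult[OF AB p(3)] euler_mult[OF p(1,2)])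
  also have "\<dots> = (if i = i' then x (i, 0) * (of_nat (weight j \<alpha>) * (?A x * ?B x * ?C x)) else 0)"
    unfolding euler_var_power \<alpha> using assms by (auto simp: numeral_eq_Suc less_Suc_eq)
  finally show ?thesis by (simp add: \<alpha>)
qed

lemma polyfun_chart_term:
  "polyfun (\<lambda>x :: nat \<times> nat \<Rightarrow> 'k::field. x (i, 0) * monomial (chart_coord x i) \<alpha>)"
  by (rule polyfun.mult[OF polyfun.var polyfun_monomial[OF polyfun.var polyfun.var polyfun.var]])

lemma euler_chart_param:
  fixes x :: "nat \<times> nat \<Rightarrow> 'k::field_char_0"
  assumes "i' < k" "j < 4"
  shows "x (i', j) * pd (i', j) (\<lambda>x. Poly_Mapping.lookup (chart_param d e k x) \<beta>) x
    = of_nat (SV_coeff d e \<beta>) * (x (i', 0) * (of_nat (weight j (chart_point \<beta>)) * monomial (chart_coord x i') (chart_point \<beta>)))"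
proof -
  let ?T = "\<lambda>i x. x (i, 0) * monomial (chart_coord x i) (chart_point \<beta>)"
  have "pd (i', j) (\<lambda>x. Poly_Mapping.lookup (chart_param d e k x) \<beta>) x
      = pd (i', j) (\<lambda>x. \<Sum>i\<in>{..<k}. of_nat (SV_coeff d e \<beta>) * ?T i x) x"
    by (simp only: lookup_chart_param sum_distrib_left)
  also have "\<dots> = (\<Sum>i\<in>{..<k}. of_nat (SV_coeff d e \<beta>) * pd (i', j) (?T i) x)"
    by (rule pd_linear_combination) (simp, rule polyfun_chart_term)
  finally have "x (i', j) * pd (i', j) (\<lambda>x. Poly_Mapping.lookup (chart_param d e k x) \<beta>) x
      = of_nat (SV_coeff d e \<beta>) * (\<Sum>i\<in>{..<k}. x (i', j) * pd (i', j) (?T i) x)"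
    by (simp only: sum_distrib_left mult.left_commute)
  also have "(\<Sum>i\<in>{..<k}. x (i', j) * pd (i', j) (?T i) x)
      = (\<Sum>i\<in>{..<k}. if i = i' then x (i', 0) * (of_nat (weight j (chart_point \<beta>)) * monomial (chart_coord x i') (chart_point \<beta>)) else 0)"
    unfolding euler_chart_term[OF assms(2)] by (intro sum.cong) auto
  also have "\<dots> = x (i', 0) * (of_nat (weight j (chart_point \<beta>)) * monomial (chart_coord x i') (chart_point \<beta>))"
    using assms(1) by simp
  finally show ?thesis .
qed

text \<open>
  The two properties of \<open>Y\<close> on which its dimension depends: it contains the image of the chart, and
  forms that vanish on the image vanish on \<open>Y\<close>. They are shared by the secants, by their closure and, for
  \<open>k = 1\<close>, by the variety itself.
\<close>

definition secant_dense :: "nat \<Rightarrow> nat \<Rightarrow> nat \<Rightarrow> (bimonomial \<Rightarrow>\<^sub>0 'k::field) set set \<Rightarrow> bool" where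
  "secant_dense d e k Y \<longleftrightarrow> Y \<subseteq> pm.projectivization (SV_space d e)
     \<and> (\<forall>n f. is_form n f \<longrightarrow> (\<forall>x. f (chart_param d e k x) = 0) \<longrightarrow> (\<forall>L\<in>Y. vanishes f L))
     \<and> (\<forall>x. chart_param d e k x \<noteq> 0 \<longrightarrow> pm.span {chart_param d e k x} \<in> Y)"

lemma secant_dense_secants:
  assumes "d \<ge> 1"
  shows "secant_dense d e k (secants (SV_variety d e :: (bimonomial \<Rightarrow>\<^sub>0 'k::field_char_0) set set) k)"
  unfolding secant_dense_def
proof (intro conjI allI impI ballI)
  show "secants (SV_variety d e :: (bimonomial \<Rightarrow>\<^sub>0 'k) set set) k \<subseteq> pm.projectivization (SV_space d e)"
    by (rule secants_in_projectivization)
  fix n and L :: "(bimonomial \<Rightarrow>\<^sub>0 'k) set" and f :: "(bimonomial \<Rightarrow>\<^sub>0 'k) \<Rightarrow> 'k"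
  assume f: "is_form n f" "\<forall>x. f (chart_param d e k x) = 0" and L: "L \<in> secants (SV_variety d e) k"
  show "vanishes f L" by (rule form_vanishes_on_secants[OF f(1) _ L]) (use f(2) in blast)
next
  fix x :: "nat \<times> nat \<Rightarrow> 'k" assume "chart_param d e k x \<noteq> 0"
  then show "pm.span {chart_param d e k x} \<in> secants (SV_variety d e) k"
    by (rule chart_param_in_secants[OF assms])
qed

lemma secant_dense_variety:
  assumes "d \<ge> 1"
  shows "secant_dense d e 1 (SV_variety d e :: (bimonomial \<Rightarrow>\<^sub>0 'k::field_char_0) set set)"
  by (subst SV_variety_eq_secants) (rule secant_dense_secants[OF assms])

lemma secant_dense_secant_variety:
  assumes "d \<ge> 1"
  shows "secant_dense d e k (secant_variety (SV_space d e) (SV_variety d e :: (bimonomial \<Rightarrow>\<^sub>0 'k::field_char_0) set set) k)"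
proof -
  let ?S = "secants (SV_variety d e :: (bimonomial \<Rightarrow>\<^sub>0 'k) set set) k"
  let ?V = "SV_space d e :: (bimonomial \<Rightarrow>\<^sub>0 'k) set"
  have dense: "secant_dense d e k ?S" by (rule secant_dense_secants[OF assms])
  have sub: "?S \<subseteq> zariski ?V closure_of ?S"
    by (rule closure_of_subset) (simp add: topspace_zariski secants_in_projectivization)
  have proj: "zariski ?V closure_of ?S \<subseteq> pm.projectivization ?V"
    using closure_of_subset_topspace[of "zariski ?V" ?S] by (simp add: topspace_zariski)
  have "vanishes f L" if f: "is_form n f" "\<forall>x. f (chart_param d e k x) = 0" and L: "L \<in> zariski ?V closure_of ?S" for n f L
  proof -
    have "?S \<subseteq> {L \<in> pm.projectivization ?V. vanishes f L}"
      using dense f unfolding secant_dense_def by blast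
    then have "zariski ?V closure_of ?S \<subseteq> {L \<in> pm.projectivization ?V. vanishes f L}"
      by (rule closure_of_minimal) (rule closedin_vanishing[OF f(1)])
    then show ?thesis using L by blast
  qed
  moreover have "\<forall>x. chart_param d e k x \<noteq> 0 \<longrightarrow> pm.span {chart_param d e k x} \<in> zariski ?V closure_of ?S"
    using dense sub unfolding secant_dense_def by blast
  ultimately show ?thesis using proj unfolding secant_dense_def secant_variety_closure by blast
qed

lemma krull_dim_le:
  assumes "\<And>n Z. irreducible_chain T n Z \<Longrightarrow> n < \<rho>"
  shows "krull_dim T \<le> enat (\<rho> - 1)"
  unfolding krull_dim_chain
proof (rule Sup_least)
  fix x assume "x \<in> {enat n | n. \<exists>Z. irreducible_chain T n Z}"
  then obtain n Z where n: "x = enat n" "irreducible_chain T n Z" by blast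
  have "n < \<rho>" by (rule assms[OF n(2)])
  then show "x \<le> enat (\<rho> - 1)" using n(1) by simp
qed

lemma krull_dim_secant_rank:
  fixes Y :: "(bimonomial \<Rightarrow>\<^sub>0 'k::field_char_0) set set"
  assumes Y: "secant_dense d e k Y"
    and rank: "\<And>(x :: nat \<times> nat \<Rightarrow> 'k) T. T \<subseteq> {..<k} \<times> {..<4} \<Longrightarrow> card T > \<rho> \<Longrightarrow> \<exists>c. (\<exists>s\<in>T. c s \<noteq> 0) \<and>
      (\<forall>\<beta>. (\<Sum>s\<in>T. c s * pd s (\<lambda>x. Poly_Mapping.lookup (chart_param d e k x) \<beta>) x) = 0)"
  shows "krull_dim (subtopology (zariski (SV_space d e)) Y) \<le> enat (\<rho> - 1)"
proof (rule krull_dim_le)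
  fix n Z assume Z: "irreducible_chain (subtopology (zariski (SV_space d e)) Y) n Z"
  show "n < \<rho>"
  proof (rule chain_length_less_rank[where \<phi>="chart_param d e k" and S="{..<k} \<times> {..<4}"
        and V="SV_space d e" and Y=Y and Z=Z])
    show "polyfun (\<lambda>x :: nat \<times> nat \<Rightarrow> 'k. Poly_Mapping.lookup (chart_param d e k x) r)" for r
      by (rule polyfun_chart_param)
    show "\<exists>c. (\<exists>s\<in>T. c s \<noteq> 0) \<and> (\<forall>\<beta>. (\<Sum>s\<in>T. c s * pd s (\<lambda>x. Poly_Mapping.lookup (chart_param d e k x) \<beta>) x) = 0)"
      if "T \<subseteq> {..<k} \<times> {..<4}" "card T > \<rho>" for x :: "nat \<times> nat \<Rightarrow> 'k" and T
      using that by (rule rank)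
    show "\<exists>x'. chart_param d e k x' = pm_scale t (chart_param d e k x)" for t and x :: "nat \<times> nat \<Rightarrow> 'k"
      by (rule chart_param_cone)
    show "irreducible_chain (subtopology (zariski (SV_space d e)) Y) n Z" by (rule Z)
    show "finite ({..<k} \<times> {..<4::nat})" by simp
    show "chart_param d e k x = chart_param d e k y" if "\<forall>i\<in>{..<k} \<times> {..<4}. x i = y i" for x y :: "nat \<times> nat \<Rightarrow> 'k"
      using that by (rule chart_param_cong)
    show "Y \<subseteq> pm.projectivization (SV_space d e)" using Y unfolding secant_dense_def by blast
    show "vanishes f L" if "is_form n f" "\<forall>x. f (chart_param d e k x) = 0" "L \<in> Y"
      for n L and f :: "(bimonomial \<Rightarrow>\<^sub>0 'k) \<Rightarrow> 'k"
      using Y that unfolding secant_dense_def by blast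
  qed
qed

lemma krull_dim_secant_le_parameters:
  fixes Y :: "(bimonomial \<Rightarrow>\<^sub>0 'k::field_char_0) set set"
  assumes "secant_dense d e k Y"
  shows "krull_dim (subtopology (zariski (SV_space d e)) Y) \<le> enat (4 * k - 1)"
proof (rule krull_dim_secant_rank[OF assms])
  fix T :: "(nat \<times> nat) set" assume "T \<subseteq> {..<k} \<times> {..<4}" "card T > 4 * k"
  moreover have "card ({..<k} \<times> {..<4::nat}) = 4 * k" by (simp add: card_cartesian_product)
  ultimately have False using card_mono[of "{..<k} \<times> {..<4}" T] by simp
  then show "\<exists>c. (\<exists>s\<in>T. c s \<noteq> 0) \<and> (\<forall>\<beta>. (\<Sum>s\<in>T. c s * pd s (\<lambda>x. Poly_Mapping.lookup (chart_param d e k x) \<beta>) x) = 0)"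
    for x :: "nat \<times> nat \<Rightarrow> 'k" ..
qed

text \<open>
  At every parameter, functionals annihilating all partial derivatives bound their rank, by
  \<open>dependent_if_annihilated\<close>.
\<close>

lemma krull_dim_secant_le_annihilators:
  fixes Y :: "(bimonomial \<Rightarrow>\<^sub>0 'k::field_char_0) set set"
  assumes Y: "secant_dense d e k Y" and I: "finite I" and m: "card I \<le> card (bimonomials d e)"
    and ann: "\<And>x :: nat \<times> nat \<Rightarrow> 'k. \<exists>h. rows_independent I (bimonomials d e) h \<and> (\<forall>l\<in>I. \<forall>s\<in>{..<k} \<times> {..<4}.
      (\<Sum>\<beta>\<in>bimonomials d e. h l \<beta> * pd s (\<lambda>x. Poly_Mapping.lookup (chart_param d e k x) \<beta>) x) = 0)"
  shows "krull_dim (subtopology (zariski (SV_space d e)) Y) \<le> enat (card (bimonomials d e) - card I - 1)"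
proof (rule krull_dim_secant_rank[OF Y])
  fix x :: "nat \<times> nat \<Rightarrow> 'k" and T :: "(nat \<times> nat) set"
  assume T: "T \<subseteq> {..<k} \<times> {..<4}" "card T > card (bimonomials d e) - card I"
  let ?v = "\<lambda>s \<beta>. pd s (\<lambda>x. Poly_Mapping.lookup (chart_param d e k x) \<beta>) x"
  obtain h where h: "rows_independent I (bimonomials d e) h" and
    h0: "\<forall>l\<in>I. \<forall>s\<in>{..<k} \<times> {..<4}. (\<Sum>\<beta>\<in>bimonomials d e. h l \<beta> * ?v s \<beta>) = 0"
    using ann[of x] by (elim exE conjE)
  have fT: "finite T" using T(1) finite_subset by blast
  have "\<exists>c. (\<exists>i\<in>T. c i \<noteq> 0) \<and> (\<forall>\<alpha>\<in>bimonomials d e. (\<Sum>i\<in>T. c i * ?v i \<alpha>) = 0)"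
  proof (rule dependent_if_annihilated[OF I fT finite_bimonomials h])
    show "(\<Sum>\<alpha>\<in>bimonomials d e. h l \<alpha> * ?v i \<alpha>) = 0" if "l \<in> I" "i \<in> T" for l i
      using h0 that T(1) by blast
    show "card (bimonomials d e) < card T + card I" using T(2) m by linarith
  qed
  then obtain c where c: "\<exists>i\<in>T. c i \<noteq> 0" "\<forall>\<alpha>\<in>bimonomials d e. (\<Sum>i\<in>T. c i * ?v i \<alpha>) = 0"
    by (elim exE conjE)
  have "(\<Sum>i\<in>T. c i * ?v i \<alpha>) = 0" for \<alpha>
  proof (cases "\<alpha> \<in> bimonomials d e")
    case False
    then have "SV_coeff d e \<alpha> = 0" using SV_coeff_pos_iff[of d e \<alpha>] by simp
    then have "?v i \<alpha> = 0" for i by (simp add: lookup_chart_param)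
    then show ?thesis by simp
  qed (use c(2) in blast)
  with c(1) show "\<exists>c. (\<exists>s\<in>T. c s \<noteq> 0) \<and> (\<forall>\<beta>. (\<Sum>s\<in>T. c s * ?v s \<beta>) = 0)" by blast
qed

text \<open>
  If all coordinates of the parameter \<open>p\<close> are non-zero, then by Euler's identities the partial
  derivatives at \<open>p\<close> are non-zero multiples of the rows of the separating matrix, up to factors in the
  columns, and hence have rank \<open>card C\<close> on \<open>C\<close>. Since the value of the map is a combination of its
  derivatives in the coefficients, it can replace one of them, and \<open>krull_dim_ge_rank\<close> applies to the
  remaining \<open>card C - 1\<close>.
\<close>

lemma krull_dim_secant_ge_separable:
  fixes Y :: "(bimonomial \<Rightarrow>\<^sub>0 'k::field_char_0) set set"
  assumes Y: "secant_dense d e k Y" and k: "k \<ge> 1"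
    and C: "C \<subseteq> prism (lattice_triangle d) (Suc e)" "C \<noteq> {}" and sep: "separable TYPE('k) k C"
  shows "enat (card C - 1) \<le> krull_dim (subtopology (zariski (SV_space d e)) Y)"
proof -
  obtain q :: "nat \<Rightarrow> 'k \<times> 'k \<times> 'k" where q: "\<And>i. i < k \<Longrightarrow> in_torus (q i)" "separates k q C"
    using sep unfolding separable_def by blast
  define CB where "CB = {\<beta> \<in> bimonomials d e. chart_point \<beta> \<in> C}"
  have bij: "bij_betw chart_point CB C"
  proof (rule bij_betw_subset[OF bij_chart_point])
    show "CB \<subseteq> bimonomials d e" by (auto simp: CB_def)
    have "C \<subseteq> chart_point ` bimonomials d e" using C(1) bij_chart_point[of d e] by (simp add: bij_betw_def)
    then show "chart_point ` CB = C" unfolding CB_def by blast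
  qed
  have fC: "finite C" using C(1) finite_triangle_prism finite_subset by blast
  have fCB: "finite CB" using bij_betw_finite[OF bij] fC by simp
  have cCB: "card CB = card C" by (rule bij_betw_same_card[OF bij])
  obtain \<alpha>0 where \<alpha>0: "\<alpha>0 \<in> C" using C(2) by blast
  obtain \<beta>0 where \<beta>0: "\<beta>0 \<in> CB" "chart_point \<beta>0 = \<alpha>0" using bij \<alpha>0 unfolding bij_betw_def by (metis imageE)
  (* The coefficients have to be non-zero, and the value of the map must not vanish on \<open>C\<close>. If the sum
     with all coefficients 1 vanishes at \<open>\<alpha>0\<close>, then changing one coefficient to 2 repairs this. *)
  have "\<exists>t. (\<forall>i. t i \<noteq> 0) \<and> (\<Sum>i<k. t i * monomial (q i) \<alpha>0) \<noteq> 0"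
  proof (cases "(\<Sum>i<k. monomial (q i) \<alpha>0) = 0")
    case False
    then show ?thesis by (intro exI[of _ "\<lambda>i. 1"]) simp
  next
    case True
    have "(\<Sum>i<k. (if i = 0 then 2 else 1) * monomial (q i) \<alpha>0)
        = (\<Sum>i<k. monomial (q i) \<alpha>0 + (if i = 0 then monomial (q 0) \<alpha>0 else 0))"
      by (intro sum.cong) auto
    also have "\<dots> = monomial (q 0) \<alpha>0" using True k by (simp add: sum.distrib)
    finally have "(\<Sum>i<k. (if i = 0 then 2 else 1) * monomial (q i) \<alpha>0) \<noteq> 0"
      using monomial_nonzero[OF q(1)[of 0]] k by simp
    then show ?thesis by (intro exI[of _ "\<lambda>i. if i = 0 then 2 else 1"]) simp
  qed
  then obtain t where t: "\<And>i. t i \<noteq> 0" "(\<Sum>i<k. t i * monomial (q i) \<alpha>0) \<noteq> 0" by blast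
  define p where "p = (\<lambda>(i, j). if j = 0 then t i else if j = 1 then fst (q i) else if j = (2::nat) then fst (snd (q i)) else snd (snd (q i)))"
  have pq: "chart_coord p i = q i" and p0: "p (i, 0) = t i" for i by (simp_all add: p_def)
  have p_nz: "p (i, j) \<noteq> 0" if "i < k" for i j
    using q(1)[OF that] t(1)[of i] by (cases "q i") (auto simp: p_def)
  let ?S = "{..<k} \<times> {..<4::nat}"
  (* The index \<open>None\<close> stands for the value of the map, \<open>Some s\<close> for its derivative in the variable \<open>s\<close>. *)
  define w where "w = (\<lambda>r \<beta>. case r of None \<Rightarrow> Poly_Mapping.lookup (chart_param d e k p) \<beta>
    | Some s \<Rightarrow> pd s (\<lambda>x. Poly_Mapping.lookup (chart_param d e k x) \<beta>) p)"
  let ?I = "insert None (Some ` ?S)"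
  have coeff: "SV_coeff d e \<beta> \<noteq> 0" if "\<beta> \<in> CB" for \<beta> using that SV_coeff_pos_iff[of d e \<beta>] by (simp add: CB_def)
  have col: "columns_independent ?I CB w"
    unfolding columns_independent_def
  proof (intro allI impI)
    fix c assume c: "\<forall>r\<in>?I. (\<Sum>\<beta>\<in>CB. c \<beta> * w r \<beta>) = 0"
    define c' where "c' \<alpha> = c (inv_into CB chart_point \<alpha>) * of_nat (SV_coeff d e (inv_into CB chart_point \<alpha>))" for \<alpha>
    have c': "c' (chart_point \<beta>) = c \<beta> * of_nat (SV_coeff d e \<beta>)" if "\<beta> \<in> CB" for \<beta>
      using that bij by (simp add: c'_def bij_betw_def inv_into_f_f)
    have "(\<Sum>\<alpha>\<in>C. c' \<alpha> * (of_nat (weight j \<alpha>) * monomial (q i) \<alpha>)) = 0" if ij: "i < k" "j < 4" for i j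
    proof -
      have "t i * (\<Sum>\<alpha>\<in>C. c' \<alpha> * (of_nat (weight j \<alpha>) * monomial (q i) \<alpha>))
        = t i * (\<Sum>\<beta>\<in>CB. c' (chart_point \<beta>) * (of_nat (weight j (chart_point \<beta>)) * monomial (q i) (chart_point \<beta>)))"
        using sum.reindex_bij_betw[OF bij, of "\<lambda>\<alpha>. c' \<alpha> * (of_nat (weight j \<alpha>) * monomial (q i) \<alpha>)"] by simp
      also have "\<dots> = (\<Sum>\<beta>\<in>CB. c \<beta> * (p (i, j) * w (Some (i, j)) \<beta>))"
        unfolding sum_distrib_left
      proof (intro sum.cong refl)
        fix \<beta> assume "\<beta> \<in> CB"
        then show "t i * (c' (chart_point \<beta>) * (of_nat (weight j (chart_point \<beta>)) * monomial (q i) (chart_point \<beta>)))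
          = c \<beta> * (p (i, j) * w (Some (i, j)) \<beta>)"
          unfolding w_def option.case euler_chart_param[OF ij] pq p0 by (simp add: c')
      qed
      also have "\<dots> = p (i, j) * (\<Sum>\<beta>\<in>CB. c \<beta> * w (Some (i, j)) \<beta>)"
        by (simp add: sum_distrib_left mult.left_commute)
      also have "\<dots> = 0" using c ij by simp
      finally show ?thesis using t(1) by simp
    qed
    then have "\<forall>\<alpha>\<in>C. c' \<alpha> = 0" using q(2) unfolding separates_def by blast
    then show "\<forall>\<beta>\<in>CB. c \<beta> = 0" using c' coeff bij unfolding bij_betw_def by fastforce
  qed
  have rows: "rows_independent {None} CB w"
    unfolding rows_independent_def
  proof (intro allI impI)
    fix c :: "(nat \<times> nat) option \<Rightarrow> 'k" assume "\<forall>\<alpha>\<in>CB. (\<Sum>i\<in>{None}. c i * w i \<alpha>) = 0"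
    from bspec[OF this \<beta>0(1)] have "c None * w None \<beta>0 = 0" by simp
    moreover have "w None \<beta>0 = of_nat (SV_coeff d e \<beta>0) * (\<Sum>i<k. t i * monomial (q i) \<alpha>0)"
      unfolding w_def option.case lookup_chart_param pq p0 \<beta>0(2) ..
    then have "w None \<beta>0 \<noteq> 0" using t(2) coeff[OF \<beta>0(1)] by simp
    ultimately show "\<forall>i\<in>{None}. c i = 0" by simp
  qed
  obtain J where J: "{None} \<subseteq> J" "J \<subseteq> ?I" "card J = card CB" "columns_independent J CB w"
    using extend_independent_rows[of ?I CB "{None}" w, OF _ fCB _ rows col] by auto
  have fJ: "finite J" by (rule finite_subset[OF J(2)]) simp
  obtain y where y: "\<forall>i\<in>J. \<forall>i'\<in>J. (\<Sum>\<alpha>\<in>CB. y i \<alpha> * w i' \<alpha>) = (if i = i' then 1 else 0)"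
    using dual_columns[OF fJ fCB J(3,4)] by (elim exE)
  define n where "n = card C - 1"
  have "card (J - {None}) = n" using J(1,3) cCB fJ by (simp add: n_def)
  then obtain b' where b': "bij_betw b' {..<n} (J - {None})"
    using ex_bij_betw_nat_finite[of "J - {None}"] fJ by (auto simp: atLeast0LessThan)
  define b where "b j = the (b' j)" for j
  have b'J: "b' j \<in> J" and b'b: "b' j = Some (b j)" if "j < n" for j
  proof -
    have "b' j \<in> J - {None}" using bij_betwE[OF b'] that by blast
    then have "b' j \<in> J" "b' j \<noteq> None" by simp_all
    then show "b' j \<in> J" "b' j = Some (b j)" unfolding b_def by simp_all
  qed
  have b'inj: "b' i = b' j \<longleftrightarrow> i = j" if "i < n" "j < n" for i j
    using b' that unfolding bij_betw_def inj_on_def by auto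
  have N: "None \<in> J" using J(1) by blast
  show ?thesis
    unfolding n_def[symmetric]
  proof (rule krull_dim_ge_rank[where \<phi>="chart_param d e k" and p=p and b=b and C=CB and ?y0.0="y None" and y="\<lambda>i. y (b' i)"])
    show "polyfun (\<lambda>x :: nat \<times> nat \<Rightarrow> 'k. Poly_Mapping.lookup (chart_param d e k x) r)" for r
      by (rule polyfun_chart_param)
    show "inj_on b {..<n}" using b'inj b'b unfolding inj_on_def by (metis lessThan_iff)
    show "finite CB" by (rule fCB)
    have wN: "w None \<beta> = Poly_Mapping.lookup (chart_param d e k p) \<beta>" for \<beta> by (simp add: w_def)
    have wb: "w (b' j) \<beta> = pd (b j) (\<lambda>x. Poly_Mapping.lookup (chart_param d e k x) \<beta>) p" if "j < n" for j \<beta>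
      using b'b[OF that] by (simp add: w_def)
    show "(\<Sum>r\<in>CB. y None r * Poly_Mapping.lookup (chart_param d e k p) r) = 1"
      using y N unfolding wN[symmetric] by simp
    show "(\<Sum>r\<in>CB. y None r * pd (b j) (\<lambda>x. Poly_Mapping.lookup (chart_param d e k x) r) p) = 0" if "j < n" for j
    proof -
      have "None \<noteq> b' j" using b'b[OF that] by simp
      then show ?thesis using y N b'J[OF that] unfolding wb[OF that, symmetric] by simp
    qed
    show "(\<Sum>r\<in>CB. y (b' i) r * Poly_Mapping.lookup (chart_param d e k p) r) = 0" if "i < n" for i
    proof -
      have "b' i \<noteq> None" using b'b[OF that] by simp
      then show ?thesis using y N b'J[OF that] unfolding wN[symmetric] by simp
    qed
    show "(\<Sum>r\<in>CB. y (b' i) r * pd (b j) (\<lambda>x. Poly_Mapping.lookup (chart_param d e k x) r) p) = (if i = j then 1 else 0)"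
      if "i < n" "j < n" for i j
      using y b'J[OF that(1)] b'J[OF that(2)] b'inj[OF that] unfolding wb[OF that(2), symmetric] by simp
    show "Y \<subseteq> pm.projectivization (SV_space d e)" using Y unfolding secant_dense_def by blast
    show "pm.span {chart_param d e k x} \<in> Y" if "chart_param d e k x \<noteq> 0"
      for x :: "nat \<times> nat \<Rightarrow> 'k"
      using Y that unfolding secant_dense_def by blast
  qed
qed

section \<open>Forms that are singular at the given points\<close>

text \<open>
  A function on a set of lattice points is the array of coefficients of a polynomial in three
  variables with these exponents, the dehomogenization of a bihomogeneous form.
\<close>

definition eval_array :: "point set \<Rightarrow> (point \<Rightarrow> 'k::field) \<Rightarrow> 'k \<times> 'k \<times> 'k \<Rightarrow> 'k" where
  "eval_array P f q = (\<Sum>\<beta>\<in>P. f \<beta> * monomial q \<beta>)"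

definition array_product :: "point set \<Rightarrow> point set \<Rightarrow> (point \<Rightarrow> 'k::field) \<Rightarrow> (point \<Rightarrow> 'k) \<Rightarrow> point \<Rightarrow> 'k" where
  "array_product P Q f g \<alpha> = (\<Sum>s | s \<in> P \<times> Q \<and> translate (fst s) (snd s) = \<alpha>. f (fst s) * g (snd s))"

lemma eval_array_product:
  assumes "finite P" "finite Q" "finite A" and A: "\<And>\<beta> \<gamma>. \<beta> \<in> P \<Longrightarrow> \<gamma> \<in> Q \<Longrightarrow> translate \<beta> \<gamma> \<in> A"
  shows "eval_array A (array_product P Q f g) q = eval_array P f q * eval_array Q g q"
proof -
  let ?F = "\<lambda>s. f (fst s) * g (snd s) * monomial q (translate (fst s) (snd s))"
  have "eval_array P f q * eval_array Q g q = (\<Sum>s\<in>P \<times> Q. ?F s)"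
    by (simp add: eval_array_def sum_product sum.cartesian_product monomial_translate case_prod_beta' mult_ac)
  also have "\<dots> = (\<Sum>\<alpha>\<in>A. \<Sum>s | s \<in> P \<times> Q \<and> translate (fst s) (snd s) = \<alpha>. ?F s)"
    using assms by (intro sum.group[symmetric]) auto
  also have "\<dots> = eval_array A (array_product P Q f g) q"
    unfolding eval_array_def array_product_def sum_distrib_right by (intro sum.cong refl) auto
  finally show ?thesis by simp
qed

text \<open>
  Kronecker substitution with a base \<open>M\<close> larger than all exponents.
\<close>

lemma array_zero_if_eval_zero:
  fixes f :: "point \<Rightarrow> 'k::field_char_0"
  assumes "finite P" and 0: "\<And>q. eval_array P f q = 0" and \<alpha>: "\<alpha> \<in> P"
  shows "f \<alpha> = 0"
proof -
  define M where "M = Suc (\<Sum>(x, y, z)\<in>P. x + y + z)"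
  have M: "x < M \<and> y < M \<and> z < M" if "(x, y, z) \<in> P" for x y z
    using member_le_sum[OF that, of "\<lambda>(x, y, z). x + y + z"] assms(1) by (simp add: M_def)
  define N where "N = (\<lambda>(x, y, z). x + M * (y + M * z))"
  have inj: "inj_on N P"
  proof (rule inj_onI)
    fix \<beta> \<gamma> assume \<beta>: "\<beta> \<in> P" and \<gamma>: "\<gamma> \<in> P" and eq: "N \<beta> = N \<gamma>"
    obtain x y z where b: "\<beta> = (x, y, z)" by (cases \<beta>)
    obtain x' y' z' where c: "\<gamma> = (x', y', z')" by (cases \<gamma>)
    have lt: "x < M" "y < M" "x' < M" "y' < M" using M \<beta> \<gamma> unfolding b c by blast+
    have e: "x + M * (y + M * z) = x' + M * (y' + M * z')" using eq by (simp add: N_def b c)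
    have "x = x'" using arg_cong[OF e, of "\<lambda>n. n mod M"] lt by simp
    moreover from e this have e': "y + M * z = y' + M * z'" using lt by simp
    have "y = y'" using arg_cong[OF e', of "\<lambda>n. n mod M"] lt by simp
    ultimately show "\<beta> = \<gamma>" using e lt by (simp add: b c)
  qed
  define p where "p = (\<Sum>\<beta>\<in>P. monom (f \<beta>) (N \<beta>))"
  have "poly p s = 0" for s
  proof -
    have "monomial (s, s ^ M, s ^ (M * M)) \<beta> = s ^ N \<beta>" for \<beta>
      by (cases \<beta>) (simp add: N_def power_add power_mult[symmetric] distrib_left mult.assoc)
    then have "poly p s = eval_array P f (s, s ^ M, s ^ (M * M))"
      by (simp add: p_def poly_sum poly_monom eval_array_def)
    then show ?thesis by (simp add: 0)
  qed
  then have "p = 0" by (intro poly_fun_zero)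
  then have "0 = coeff p (N \<alpha>)" by simp
  also have "\<dots> = (\<Sum>\<beta>\<in>P. if \<beta> = \<alpha> then f \<alpha> else 0)"
    unfolding p_def coeff_sum using inj \<alpha> by (intro sum.cong refl) (auto simp: inj_on_def)
  also have "\<dots> = f \<alpha>" using assms(1) \<alpha> by simp
  finally show ?thesis by simp
qed

lemma polyfun_eval_array:
  assumes "polyfun a" "polyfun b" "polyfun c"
  shows "polyfun (\<lambda>x. eval_array P f (a x, b x, c x))"
  unfolding eval_array_def
  by (rule polyfun_sum) (rule polyfun.mult[OF polyfun.const polyfun_monomial[OF assms]])

lemma eval_array_domain:
  fixes f g :: "point \<Rightarrow> 'k::field_char_0"
  assumes fin: "finite P" "finite Q" and 0: "\<And>q. eval_array P f q * eval_array Q g q = 0"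
  shows "(\<forall>\<beta>\<in>P. f \<beta> = 0) \<or> (\<forall>\<gamma>\<in>Q. g \<gamma> = 0)"
proof -
  let ?q = "\<lambda>x :: nat \<Rightarrow> 'k. (x 0, x 1, x 2)"
  have pf: "polyfun (\<lambda>x. eval_array P f (?q x))" and pg: "polyfun (\<lambda>x. eval_array Q g (?q x))"
    by (rule polyfun_eval_array[OF polyfun.var polyfun.var polyfun.var])+
  have z: "eval_array P f (?q x) * eval_array Q g (?q x) = 0" for x by (rule 0)
  have "(\<forall>x. eval_array P f (?q x) = 0) \<or> (\<forall>x. eval_array Q g (?q x) = 0)"
    by (rule polyfun_domain[OF pf pg z])
  moreover have "eval_array R h q = 0" if "\<forall>x. eval_array R h (?q x) = 0" for R h q
  proof -
    obtain a b c where "q = (a, b, c)" by (cases q)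
    then show ?thesis using spec[OF that, of "\<lambda>i. if i = 0 then a else if i = 1 then b else c"] by simp
  qed
  ultimately have "(\<forall>q. eval_array P f q = 0) \<or> (\<forall>q. eval_array Q g q = 0)" by blast
  then show ?thesis
  proof
    assume "\<forall>q. eval_array P f q = 0"
    then show ?thesis using array_zero_if_eval_zero[OF fin(1), of f] by blast
  next
    assume "\<forall>q. eval_array Q g q = 0"
    then show ?thesis using array_zero_if_eval_zero[OF fin(2), of g] by blast
  qed
qed

lemma eval_array_linear:
  "eval_array P (\<lambda>\<beta>. a * f \<beta> + b * g \<beta>) q = a * eval_array P f q + b * eval_array P g q"
  by (simp add: eval_array_def sum_distrib_left sum.distrib distrib_right mult.assoc)

lemma vanishing_array:
  fixes q :: "nat \<Rightarrow> 'k \<times> 'k \<times> 'k::field"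
  assumes "finite P" "k < card P"
  shows "\<exists>f. (\<exists>\<beta>\<in>P. f \<beta> \<noteq> 0) \<and> (\<forall>i<k. eval_array P f (q i) = 0)"
  using underdetermined_system[of "{..<k}" P "\<lambda>\<beta> i. monomial (q i) \<beta>"] assms
  by (auto simp: eval_array_def)

definition independent_pair :: "point set \<Rightarrow> (point \<Rightarrow> 'k::field) \<Rightarrow> (point \<Rightarrow> 'k) \<Rightarrow> bool" where
  "independent_pair P f g \<longleftrightarrow> (\<forall>a b. (\<forall>\<beta>\<in>P. a * f \<beta> + b * g \<beta> = 0) \<longrightarrow> a = 0 \<and> b = 0)"

text \<open>
  The second polynomial is subject to one more linear condition: its coefficient at a point \<open>\<beta>0\<close> where
  the first has a non-zero coefficient vanishes. So no multiple of the first equals it.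
\<close>

lemma vanishing_pencil:
  fixes q :: "nat \<Rightarrow> 'k \<times> 'k \<times> 'k::field"
  assumes "finite P" "Suc k < card P"
  shows "\<exists>f g. independent_pair P f g \<and> (\<forall>i<k. eval_array P f (q i) = 0 \<and> eval_array P g (q i) = 0)"
proof -
  obtain f \<beta>0 where f: "\<beta>0 \<in> P" "f \<beta>0 \<noteq> 0" "\<forall>i<k. eval_array P f (q i) = 0"
    using vanishing_array[of P k q] assms by auto
  let ?M = "\<lambda>\<beta> i. if i < k then monomial (q i) \<beta> else if \<beta> = \<beta>0 then 1 else 0"
  obtain g where g: "\<exists>\<beta>\<in>P. g \<beta> \<noteq> 0" "\<forall>i\<in>{..k}. (\<Sum>\<beta>\<in>P. g \<beta> * ?M \<beta> i) = 0"
    using underdetermined_system[of "{..k}" P ?M] assms by auto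
  have "(\<Sum>\<beta>\<in>P. g \<beta> * ?M \<beta> k) = (\<Sum>\<beta>\<in>P. if \<beta> = \<beta>0 then g \<beta>0 else 0)"
    by (intro sum.cong refl) auto
  moreover have "(\<Sum>\<beta>\<in>P. g \<beta> * ?M \<beta> k) = 0" by (rule bspec[OF g(2)]) simp
  ultimately have g0: "g \<beta>0 = 0" using f(1) assms(1) by simp
  have gi: "\<forall>i<k. eval_array P g (q i) = 0"
  proof (intro allI impI)
    fix i assume "i < k"
    then show "eval_array P g (q i) = 0" using bspec[OF g(2), of i] by (simp add: eval_array_def)
  qed
  have "independent_pair P f g"
    unfolding independent_pair_def
  proof (intro allI impI)
    fix a b assume ab: "\<forall>\<beta>\<in>P. a * f \<beta> + b * g \<beta> = 0"
    then have "a = 0" using f(1,2) g0 by fastforce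
    then show "a = 0 \<and> b = 0" using ab g(1) by auto
  qed
  then show ?thesis using f(3) gi by blast
qed

lemma quadratic_root:
  fixes a b c :: "'k::alg_closed_field"
  assumes "a \<noteq> 0"
  shows "\<exists>r. a * r ^ 2 + b * r + c = 0"
proof -
  have "degree [:c, b, a:] > 0" using assms by simp
  from alg_closed_imp_poly_has_root[OF this] obtain r where "poly [:c, b, a:] r = 0" by blast
  then show ?thesis by (intro exI[of _ r]) (simp add: power2_eq_square algebra_simps)
qed

text \<open>
  Over an algebraically closed field a quadratic relation between \<open>f\<close> and \<open>g\<close> splits into linear
  factors. One of them vanishes, which contradicts the independence of \<open>f\<close> and \<open>g\<close>.
\<close>

lemma quadratic_forms_independent:
  fixes f g :: "point \<Rightarrow> 'k::{alg_closed_field, field_char_0}"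
  assumes P: "finite P" and ind: "independent_pair P f g"
    and 0: "\<And>q. a * (eval_array P f q * eval_array P f q) + b * (eval_array P f q * eval_array P g q)
      + c * (eval_array P g q * eval_array P g q) = 0"
  shows "a = 0 \<and> b = 0 \<and> c = 0"
proof -
  have no_relation: "s = 0 \<and> t = 0" if "\<forall>\<beta>\<in>P. s * f \<beta> + t * g \<beta> = 0" for s t
    using ind that unfolding independent_pair_def by blast
  have a: "a = 0"
  proof (rule ccontr)
    assume "a \<noteq> 0"
    then obtain r where r: "a * r ^ 2 + b * r + c = 0" using quadratic_root by blast
    have "eval_array P (\<lambda>\<beta>. 1 * f \<beta> + (- r) * g \<beta>) q * eval_array P (\<lambda>\<beta>. a * f \<beta> + (a * r + b) * g \<beta>) q = 0" for q
      unfolding eval_array_linear using 0[of q] r by algebra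
    then have "(\<forall>\<beta>\<in>P. 1 * f \<beta> + (- r) * g \<beta> = 0) \<or> (\<forall>\<beta>\<in>P. a * f \<beta> + (a * r + b) * g \<beta> = 0)"
      by (rule eval_array_domain[OF P P])
    then show False using no_relation[of 1 "- r"] no_relation[of a "a * r + b"] \<open>a \<noteq> 0\<close> by auto
  qed
  have "eval_array P (\<lambda>\<beta>. 0 * f \<beta> + 1 * g \<beta>) q * eval_array P (\<lambda>\<beta>. b * f \<beta> + c * g \<beta>) q = 0" for q
    unfolding eval_array_linear using 0[of q] a by algebra
  then have "(\<forall>\<beta>\<in>P. 0 * f \<beta> + 1 * g \<beta> = 0) \<or> (\<forall>\<beta>\<in>P. b * f \<beta> + c * g \<beta> = 0)"
    by (rule eval_array_domain[OF P P])
  then show ?thesis using a no_relation[of 0 1] no_relation[of b c] by auto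
qed

text \<open>
  The division cancels the integer factors in the coordinates of a power tensor, so that the value of
  the functional at the image of a point is the value of the polynomial \<open>F\<close> at this point.
\<close>

definition form_functional :: "nat \<Rightarrow> nat \<Rightarrow> (point \<Rightarrow> 'k::field) \<Rightarrow> bimonomial \<Rightarrow> 'k" where
  "form_functional d e F \<beta> = F (chart_point \<beta>) / of_nat (SV_coeff d e \<beta>)"

lemma form_functional_zero_iff:
  fixes F :: "point \<Rightarrow> 'k::field_char_0"
  shows "(\<forall>\<beta>\<in>bimonomials d e. form_functional d e F \<beta> = 0) \<longleftrightarrow> (\<forall>\<alpha>\<in>prism (lattice_triangle d) (Suc e). F \<alpha> = 0)"
proof -
  have "form_functional d e F \<beta> = 0 \<longleftrightarrow> F (chart_point \<beta>) = 0" if "\<beta> \<in> bimonomials d e" for \<beta>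
    using that SV_coeff_pos_iff[of d e \<beta>] by (simp add: form_functional_def)
  moreover have "prism (lattice_triangle d) (Suc e) = chart_point ` bimonomials d e"
    using bij_chart_point[of d e] by (simp add: bij_betw_def)
  ultimately show ?thesis by simp
qed

text \<open>
  The functional pulls back along \<open>chart_param\<close> to a sum of terms \<open>x (i, 0) * f * g\<close>, with \<open>f, g\<close>
  evaluated at the \<open>i\<close>-th point, and both factors vanish there, so all derivatives vanish.
\<close>

lemma form_functional_kills_tangents:
  fixes x :: "nat \<times> nat \<Rightarrow> 'k::field_char_0"
  assumes fin: "finite P" "finite Q"
    and A: "\<And>\<beta> \<gamma>. \<beta> \<in> P \<Longrightarrow> \<gamma> \<in> Q \<Longrightarrow> translate \<beta> \<gamma> \<in> prism (lattice_triangle d) (Suc e)"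
    and f: "\<And>i. i < k \<Longrightarrow> eval_array P f (chart_coord x i) = 0" and g: "\<And>i. i < k \<Longrightarrow> eval_array Q g (chart_coord x i) = 0"
  shows "(\<Sum>\<beta>\<in>bimonomials d e. form_functional d e (array_product P Q f g) \<beta>
    * pd s (\<lambda>x. Poly_Mapping.lookup (chart_param d e k x) \<beta>) x) = 0"
proof -
  let ?H = "form_functional d e (array_product P Q f g)"
  let ?F = "\<lambda>i x. eval_array P f (chart_coord x i)" and ?G = "\<lambda>i x. eval_array Q g (chart_coord x i)"
  have pF: "polyfun (?F i)" and pG: "polyfun (?G i)" for i
    by (rule polyfun_eval_array[OF polyfun.var polyfun.var polyfun.var])+
  have FG: "polyfun (\<lambda>x. ?F i x * ?G i x)" for i by (rule polyfun.mult[OF pF pG])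
  have "(\<Sum>\<beta>\<in>bimonomials d e. ?H \<beta> * Poly_Mapping.lookup (chart_param d e k x) \<beta>)
      = (\<Sum>i\<in>{..<k}. 1 * (x (i, 0) * (?F i x * ?G i x)))" for x :: "nat \<times> nat \<Rightarrow> 'k"
  proof -
    let ?A = "prism (lattice_triangle d) (Suc e)"
    have "?H \<beta> * Poly_Mapping.lookup (chart_param d e k x) \<beta>
        = (\<Sum>i<k. x (i, 0) * (array_product P Q f g (chart_point \<beta>) * monomial (chart_coord x i) (chart_point \<beta>)))"
      if "\<beta> \<in> bimonomials d e" for \<beta>
      using that SV_coeff_pos_iff[of d e \<beta>] by (simp add: form_functional_def lookup_chart_param sum_distrib_left mult_ac)
    then have "(\<Sum>\<beta>\<in>bimonomials d e. ?H \<beta> * Poly_Mapping.lookup (chart_param d e k x) \<beta>)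
      = (\<Sum>\<beta>\<in>bimonomials d e. (\<lambda>\<alpha>. \<Sum>i<k. x (i, 0) * (array_product P Q f g \<alpha> * monomial (chart_coord x i) \<alpha>)) (chart_point \<beta>))"
      by (intro sum.cong refl)
    also have "\<dots> = (\<Sum>\<alpha>\<in>?A. \<Sum>i<k. x (i, 0) * (array_product P Q f g \<alpha> * monomial (chart_coord x i) \<alpha>))"
      by (rule sum.reindex_bij_betw[OF bij_chart_point])
    also have "\<dots> = (\<Sum>i<k. x (i, 0) * eval_array ?A (array_product P Q f g) (chart_coord x i))"
      unfolding eval_array_def sum_distrib_left by (rule sum.swap)
    also have "\<dots> = (\<Sum>i<k. x (i, 0) * (?F i x * ?G i x))"
      by (simp only: eval_array_product[OF fin finite_triangle_prism A])
    finally show ?thesis by simp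
  qed
  then have "pd s (\<lambda>x. \<Sum>\<beta>\<in>bimonomials d e. ?H \<beta> * Poly_Mapping.lookup (chart_param d e k x) \<beta>) x
      = pd s (\<lambda>x. \<Sum>i\<in>{..<k}. 1 * (x (i, 0) * (?F i x * ?G i x))) x"
    by (simp only:)
  also have "\<dots> = (\<Sum>i\<in>{..<k}. 1 * pd s (\<lambda>x. x (i, 0) * (?F i x * ?G i x)) x)"
    by (rule pd_linear_combination) (simp, rule polyfun.mult[OF polyfun.var FG])
  also have "\<dots> = 0"
  proof (intro sum.neutral ballI)
    fix i assume "i \<in> {..<k}"
    then show "1 * pd s (\<lambda>x. x (i, 0) * (?F i x * ?G i x)) x = 0"
      unfolding pd_mult[OF polyfun.var FG] pd_mult[OF pF pG] using f[of i] g[of i] by simp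
  qed
  finally show ?thesis
    by (subst pd_linear_combination[OF finite_bimonomials polyfun_chart_param, symmetric])
qed

text \<open>
  More coefficients than points guarantee non-zero polynomials \<open>f\<close> and \<open>g\<close> through the points, and their
  product defines one annihilating functional.
\<close>

lemma krull_dim_le_one_annihilator:
  fixes Y :: "(bimonomial \<Rightarrow>\<^sub>0 'k::field_char_0) set set"
  assumes Y: "secant_dense d e k Y" and fin: "finite P" "finite Q" and card: "k < card P" "k < card Q"
    and A: "\<And>\<beta> \<gamma>. \<beta> \<in> P \<Longrightarrow> \<gamma> \<in> Q \<Longrightarrow> translate \<beta> \<gamma> \<in> prism (lattice_triangle d) (Suc e)"
    and ne: "card (bimonomials d e) \<ge> 1"
  shows "krull_dim (subtopology (zariski (SV_space d e)) Y) \<le> enat (card (bimonomials d e) - 2)"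
proof -
  have "krull_dim (subtopology (zariski (SV_space d e)) Y) \<le> enat (card (bimonomials d e) - card {0::nat} - 1)"
  proof (rule krull_dim_secant_le_annihilators[OF Y])
    fix x :: "nat \<times> nat \<Rightarrow> 'k"
    obtain f where f: "\<exists>\<beta>\<in>P. f \<beta> \<noteq> 0" "\<forall>i<k. eval_array P f (chart_coord x i) = 0"
      using vanishing_array[OF fin(1) card(1), of "chart_coord x"] by (elim exE conjE)
    obtain g where g: "\<exists>\<beta>\<in>Q. g \<beta> \<noteq> 0" "\<forall>i<k. eval_array Q g (chart_coord x i) = 0"
      using vanishing_array[OF fin(2) card(2), of "chart_coord x"] by (elim exE conjE)
    let ?h = "form_functional d e (array_product P Q f g)"
    have "rows_independent {0::nat} (bimonomials d e) (\<lambda>_. ?h)"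
      unfolding rows_independent_def
    proof (intro allI impI)
      fix c :: "nat \<Rightarrow> 'k" assume c: "\<forall>\<alpha>\<in>bimonomials d e. (\<Sum>i\<in>{0}. c i * ?h \<alpha>) = 0"
      have "\<not> (\<forall>\<beta>\<in>bimonomials d e. ?h \<beta> = 0)"
      proof
        assume "\<forall>\<beta>\<in>bimonomials d e. ?h \<beta> = 0"
        then have z: "\<forall>\<alpha>\<in>prism (lattice_triangle d) (Suc e). array_product P Q f g \<alpha> = 0"
          by (simp only: form_functional_zero_iff)
        have "eval_array P f q * eval_array Q g q = 0" for q
        proof -
          have "eval_array P f q * eval_array Q g q = eval_array (prism (lattice_triangle d) (Suc e)) (array_product P Q f g) q"
            by (rule eval_array_product[OF fin finite_triangle_prism A, symmetric])
          also have "\<dots> = 0" unfolding eval_array_def using z by (intro sum.neutral) simp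
          finally show ?thesis .
        qed
        from eval_array_domain[OF fin this] show False using f(1) g(1) by blast
      qed
      then show "\<forall>i\<in>{0}. c i = 0" using c by auto
    qed
    moreover have "(\<Sum>\<beta>\<in>bimonomials d e. ?h \<beta> * pd s (\<lambda>x. Poly_Mapping.lookup (chart_param d e k x) \<beta>) x) = 0" for s
      by (rule form_functional_kills_tangents[OF fin A]) (use f(2) g(2) in blast)+
    ultimately show "\<exists>h. rows_independent {0::nat} (bimonomials d e) h \<and> (\<forall>l\<in>{0}. \<forall>s\<in>{..<k} \<times> {..<4}.
        (\<Sum>\<beta>\<in>bimonomials d e. h l \<beta> * pd s (\<lambda>x. Poly_Mapping.lookup (chart_param d e k x) \<beta>) x) = 0)"
      by (intro exI[of _ "\<lambda>_. ?h"]) blast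
  qed (use ne in auto)
  then show ?thesis by (simp add: numeral_2_eq_2)
qed

text \<open>
  A pencil \<open>f, g\<close> of polynomials through the points defines the three annihilating functionals of
  \<open>f\<^sup>2, f g, g\<^sup>2\<close>.
\<close>

lemma krull_dim_le_three_annihilators:
  fixes Y :: "(bimonomial \<Rightarrow>\<^sub>0 'k::{alg_closed_field, field_char_0}) set set"
  assumes Y: "secant_dense d e k Y" and fin: "finite P" and card: "Suc k < card P"
    and A: "\<And>\<beta> \<gamma>. \<beta> \<in> P \<Longrightarrow> \<gamma> \<in> P \<Longrightarrow> translate \<beta> \<gamma> \<in> prism (lattice_triangle d) (Suc e)"
    and ne: "card (bimonomials d e) \<ge> 3"
  shows "krull_dim (subtopology (zariski (SV_space d e)) Y) \<le> enat (card (bimonomials d e) - 4)"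
proof -
  have "krull_dim (subtopology (zariski (SV_space d e)) Y) \<le> enat (card (bimonomials d e) - card {0::nat, 1, 2} - 1)"
  proof (rule krull_dim_secant_le_annihilators[OF Y])
    fix x :: "nat \<times> nat \<Rightarrow> 'k"
    obtain f g where ind: "independent_pair P f g" and
      fg: "\<forall>i<k. eval_array P f (chart_coord x i) = 0 \<and> eval_array P g (chart_coord x i) = 0"
      using vanishing_pencil[OF fin card, of "chart_coord x"] by (elim exE conjE)
    define F where "F l = (if l = (0::nat) then array_product P P f f else if l = 1 then array_product P P f g else array_product P P g g)" for l
    let ?h = "\<lambda>l. form_functional d e (F l)"
    let ?A = "prism (lattice_triangle d) (Suc e)"
    have "rows_independent {0::nat, 1, 2} (bimonomials d e) ?h"
      unfolding rows_independent_def
    proof (intro allI impI)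
      fix c :: "nat \<Rightarrow> 'k" assume c: "\<forall>\<alpha>\<in>bimonomials d e. (\<Sum>i\<in>{0, 1, 2}. c i * ?h i \<alpha>) = 0"
      have "\<forall>\<beta>\<in>bimonomials d e. form_functional d e (\<lambda>\<alpha>. c 0 * F 0 \<alpha> + c 1 * F 1 \<alpha> + c 2 * F 2 \<alpha>) \<beta> = 0"
        using c by (simp add: form_functional_def add_divide_distrib add.assoc)
      then have z: "\<forall>\<alpha>\<in>?A. c 0 * F 0 \<alpha> + c 1 * F 1 \<alpha> + c 2 * F 2 \<alpha> = 0" by (simp only: form_functional_zero_iff)
      have "c 0 * (eval_array P f q * eval_array P f q) + c 1 * (eval_array P f q * eval_array P g q)
          + c 2 * (eval_array P g q * eval_array P g q) = 0" for q
      proof -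
        have "c 0 * eval_array ?A (F 0) q + c 1 * eval_array ?A (F 1) q + c 2 * eval_array ?A (F 2) q
            = (\<Sum>\<alpha>\<in>?A. (c 0 * F 0 \<alpha> + c 1 * F 1 \<alpha> + c 2 * F 2 \<alpha>) * monomial q \<alpha>)"
          by (simp add: eval_array_def sum_distrib_left sum.distrib distrib_right mult.assoc)
        also have "\<dots> = 0" using z by (intro sum.neutral) simp
        finally show ?thesis by (simp add: F_def eval_array_product[OF fin fin finite_triangle_prism A])
      qed
      from quadratic_forms_independent[OF fin ind this] show "\<forall>i\<in>{0, 1, 2}. c i = 0" by simp
    qed
    moreover have "(\<Sum>\<beta>\<in>bimonomials d e. ?h l \<beta> * pd s (\<lambda>x. Poly_Mapping.lookup (chart_param d e k x) \<beta>) x) = 0" for l s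
    proof -
      have "\<exists>u v. F l = array_product P P u v \<and> (\<forall>i<k. eval_array P u (chart_coord x i) = 0 \<and> eval_array P v (chart_coord x i) = 0)"
        unfolding F_def using fg by (cases "l = 0"; cases "l = 1") auto
      then obtain u v where uv: "F l = array_product P P u v" "\<And>i. i < k \<Longrightarrow> eval_array P u (chart_coord x i) = 0"
        "\<And>i. i < k \<Longrightarrow> eval_array P v (chart_coord x i) = 0" by blast
      show ?thesis unfolding uv(1) by (rule form_functional_kills_tangents[OF fin fin A uv(2,3)])
    qed
    ultimately show "\<exists>h. rows_independent {0::nat, 1, 2} (bimonomials d e) h \<and> (\<forall>l\<in>{0, 1, 2}. \<forall>s\<in>{..<k} \<times> {..<4}.
        (\<Sum>\<beta>\<in>bimonomials d e. h l \<beta> * pd s (\<lambda>x. Poly_Mapping.lookup (chart_param d e k x) \<beta>) x) = 0)"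
      by (intro exI[of _ ?h]) blast
  qed (use ne in auto)
  then show ?thesis by (simp add: numeral_eq_Suc)
qed

section \<open>Defective and non-defective secant varieties\<close>

lemma variety_dim_SV:
  assumes "d \<ge> 1" "e \<ge> 1"
  shows "variety_dim (SV_space d e) (SV_variety d e :: (bimonomial \<Rightarrow>\<^sub>0 'k::field_char_0) set set) = 3"
proof -
  let ?C = "set [(0, 0, 0), (1, 0, 0), (0, 1, 0), (0, 0, 1)] :: point set"
  have dense: "secant_dense d e 1 (SV_variety d e :: (bimonomial \<Rightarrow>\<^sub>0 'k) set set)"
    by (rule secant_dense_variety[OF assms(1)])
  have "separable TYPE('k) 1 ?C" by (rule separable_affine_independent) simp
  moreover have "?C \<subseteq> prism (lattice_triangle d) (Suc e)" using assms by (auto simp: prism_def lattice_triangle_def)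
  ultimately have "enat (card ?C - 1) \<le> variety_dim (SV_space d e) (SV_variety d e :: (bimonomial \<Rightarrow>\<^sub>0 'k) set set)"
    unfolding variety_dim_def by (intro krull_dim_secant_ge_separable[OF dense]) auto
  moreover have c: "card ?C - 1 = 3" by simp
  ultimately have "enat 3 \<le> variety_dim (SV_space d e) (SV_variety d e :: (bimonomial \<Rightarrow>\<^sub>0 'k) set set)"
    unfolding c by blast
  moreover have "variety_dim (SV_space d e) (SV_variety d e :: (bimonomial \<Rightarrow>\<^sub>0 'k) set set) \<le> enat (4 * 1 - 1)"
    unfolding variety_dim_def by (rule krull_dim_secant_le_parameters[OF dense])
  ultimately show ?thesis by (intro antisym) (simp_all add: numeral_eq_enat)
qed

lemma expected_secant_dim_SV:
  assumes "d \<ge> 1" "e \<ge> 1"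
  shows "expected_secant_dim (SV_space d e) (SV_variety d e :: (bimonomial \<Rightarrow>\<^sub>0 'k::field_char_0) set set) k
    = enat (min (4 * k - 1) (card (bimonomials d e) - 1))"
proof -
  have "enat k * (3 + 1) - 1 = enat (4 * k - 1)"
    by (simp add: numeral_eq_enat one_enat_def mult.commute)
  then show ?thesis
    unfolding expected_secant_dim_def variety_dim_SV[OF assms] dim_SV_space by (simp add: min_enat_simps)
qed

lemma secant_dim_upper:
  fixes k e :: nat
  assumes "d \<ge> 1"
  defines "Y \<equiv> secant_variety (SV_space d e) (SV_variety d e :: (bimonomial \<Rightarrow>\<^sub>0 'k::field_char_0) set set) k"
  shows "variety_dim (SV_space d e) Y \<le> enat (4 * k - 1)"
    and "variety_dim (SV_space d e) Y \<le> enat (card (bimonomials d e) - 1)"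
proof -
  have Y: "secant_dense d e k Y" unfolding Y_def by (rule secant_dense_secant_variety[OF assms(1)])
  show "variety_dim (SV_space d e) Y \<le> enat (4 * k - 1)"
    unfolding variety_dim_def by (rule krull_dim_secant_le_parameters[OF Y])
  have "krull_dim (subtopology (zariski (SV_space d e)) Y) \<le> enat (card (bimonomials d e) - card ({} :: nat set) - 1)"
    by (rule krull_dim_secant_le_annihilators[OF Y]) (auto simp: rows_independent_def)
  then show "variety_dim (SV_space d e) Y \<le> enat (card (bimonomials d e) - 1)"
    unfolding variety_dim_def by simp
qed

lemma secant_dim_lower:
  assumes "d \<ge> 1" "k \<ge> 1" "C \<subseteq> prism (lattice_triangle d) (Suc e)" "C \<noteq> {}" "separable TYPE('k::field_char_0) k C"
  shows "enat (card C - 1) \<le> variety_dim (SV_space d e) (secant_variety (SV_space d e) (SV_variety d e :: (bimonomial \<Rightarrow>\<^sub>0 'k) set set) k)"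
  unfolding variety_dim_def
  by (rule krull_dim_secant_ge_separable[OF secant_dense_secant_variety[OF assms(1)] assms(2-5)])

text \<open>
  With \<open>card A = 4 * K + r\<close>: for \<open>k \<le> K\<close> the rank is \<open>4 * k\<close>, the number of parameters, because this
  holds for \<open>K\<close> and fewer points give fewer independent rows. For \<open>k > K\<close> it is the dimension of the
  ambient space.
\<close>

lemma nondefective_if_tileable:
  assumes "d \<ge> 1" "e \<ge> 1" and tile: "tileable TYPE('k::field_char_0) r (prism (lattice_triangle d) (Suc e))" "r < 4"
  shows "nondefective (SV_space d e) (SV_variety d e :: (bimonomial \<Rightarrow>\<^sub>0 'k) set set)"
  unfolding nondefective_def
proof (intro allI impI)
  fix k :: nat assume k: "k \<ge> 1"
  let ?A = "prism (lattice_triangle d) (Suc e)"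
  let ?dim = "variety_dim (SV_space d e) (secant_variety (SV_space d e) (SV_variety d e :: (bimonomial \<Rightarrow>\<^sub>0 'k) set set) k)"
  obtain K A' where K: "card ?A = 4 * K + r" "separable TYPE('k) (if r = 0 then K else Suc K) ?A"
    "A' \<subseteq> ?A" "card A' = 4 * K" "separable TYPE('k) K A'"
    using tile(1) unfolding tileable_def by blast
  have N: "card (bimonomials d e) = 4 * K + r" using K(1) by (simp add: card_bimonomials)
  have "?dim = enat (min (4 * k - 1) (card (bimonomials d e) - 1))"
  proof (cases "k \<le> K")
    case True
    have "finite A'" using K(3) finite_triangle_prism finite_subset by blast
    then obtain C where C: "C \<subseteq> A'" "card C = 4 * k" "separable TYPE('k) k C"
      using separable_fewer_points[OF K(5) _ K(4) True] by blast
    have "C \<noteq> {}" using C(2) k by auto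
    then have "enat (4 * k - 1) \<le> ?dim"
      using secant_dim_lower[OF assms(1) k _ _ C(3), of e] C K(3) by auto
    moreover have "?dim \<le> enat (4 * k - 1)" by (rule secant_dim_upper(1)[OF assms(1)])
    moreover have "min (4 * k - 1) (card (bimonomials d e) - 1) = 4 * k - 1" using True N by simp
    ultimately show ?thesis by simp
  next
    case False
    then have "separable TYPE('k) k ?A" using separable_mono[OF K(2)] by (simp split: if_splits)
    moreover have "?A \<noteq> {}"
    proof -
      have "(0, 0, 0) \<in> ?A" by (simp add: prism_def lattice_triangle_def)
      then show ?thesis by blast
    qed
    ultimately have "enat (card ?A - 1) \<le> ?dim" using secant_dim_lower[OF assms(1) k subset_refl] by blast
    moreover have "?dim \<le> enat (card (bimonomials d e) - 1)" by (rule secant_dim_upper(2)[OF assms(1)])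
    moreover have "min (4 * k - 1) (card (bimonomials d e) - 1) = card (bimonomials d e) - 1"
      using False N tile(2) by simp
    ultimately show ?thesis by (simp add: card_bimonomials)
  qed
  then show "?dim = expected_secant_dim (SV_space d e) (SV_variety d e :: (bimonomial \<Rightarrow>\<^sub>0 'k) set set) k"
    by (simp only: expected_secant_dim_SV[OF assms(1,2)])
qed

theorem theorem1p3:
  fixes d e :: nat
    and V :: "(((3 \<Rightarrow>\<^sub>0 nat) \<times> (2 \<Rightarrow>\<^sub>0 nat)) \<Rightarrow>\<^sub>0 'k::{alg_closed_field, field_char_0}) set"
    and X :: "(((3 \<Rightarrow>\<^sub>0 nat) \<times> (2 \<Rightarrow>\<^sub>0 nat)) \<Rightarrow>\<^sub>0 'k) set set"
  assumes "d \<ge> 1" and "e \<ge> 1"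
    and "V = SV_space d e"
    and "X = SV_variety d e"
  shows "(\<not> (d = 2 \<and> even e) \<and> \<not> (d = 3 \<and> e = 1) \<longrightarrow> nondefective V X) \<and>
         (\<forall>k. d = 2 \<and> e = 2 * k \<longrightarrow>
           variety_codim V (secant_variety V X (3 * k + 1)) = 3 \<and>
           expected_secant_codim V X (3 * k + 1) = 2 \<and>
           variety_codim V (secant_variety V X (3 * k + 2)) = 1 \<and>
           expected_secant_codim V X (3 * k + 2) = 0) \<and>
         (d = 3 \<and> e = 1 \<longrightarrow>
           variety_codim V (secant_variety V X 5) = 1 \<and>
           expected_secant_codim V X 5 = 0)"
proof (intro conjI impI allI)
  assume "\<not> (d = 2 \<and> even e) \<and> \<not> (d = 3 \<and> e = 1)"
  then have "\<exists>r<4. tileable TYPE('k) r (prism (lattice_triangle d) (Suc e))"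
    using assms(1,2) by (intro tileable_triangle_prism) auto
  then show "nondefective V X"
    unfolding assms(3,4) using nondefective_if_tileable[OF assms(1,2), where 'k='k] by blast
next
  fix k assume de: "d = 2 \<and> e = 2 * k"
  have k: "k \<ge> 1" using de assms(2) by auto
  have N: "card (bimonomials d e) = 12 * k + 6" using de by (simp add: card_bimonomials card_triangle_prism numeral_eq_Suc)
  have dimV: "pm.dim V = 12 * k + 6" by (simp add: assms(3) dim_SV_space N)
  (* Polynomials with exponents in \<open>?P\<close> have bidegree \<open>(1, k)\<close>; products of two of them have bidegree
     \<open>(2, 2 * k)\<close>. *)
  let ?P = "prism (lattice_triangle 1) (Suc k)"
  have cP: "card ?P = 3 * k + 3" by (simp add: card_triangle_prism)
  have A: "translate \<beta> \<gamma> \<in> prism (lattice_triangle d) (Suc e)" if "\<beta> \<in> ?P" "\<gamma> \<in> ?P" for \<beta> \<gamma>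
    using that de by (auto simp: prism_def lattice_triangle_def)
  have pe: "Suc e = 2 * k + 1" using de by simp
  have dense: "secant_dense d e l (secant_variety V X l)" for l
    unfolding assms(3,4) by (rule secant_dense_secant_variety[OF assms(1)])
  obtain C where C: "C \<subseteq> prism (lattice_triangle d) (Suc e)" "card C = 12 * k + 3" "separable TYPE('k) (3 * k + 1) C"
    using separable_degree_2_even(1)[OF k, where 'k='k] de pe by auto
  have "enat (card C - 1) \<le> variety_dim V (secant_variety V X (3 * k + 1))"
    unfolding assms(3,4) using C by (intro secant_dim_lower assms(1)) auto
  moreover have "variety_dim V (secant_variety V X (3 * k + 1)) \<le> enat (card (bimonomials d e) - 4)"
    unfolding variety_dim_def assms(3)
    by (rule krull_dim_le_three_annihilators[OF dense[unfolded assms(3)] finite_triangle_prism _ A]) (use cP N in auto)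
  ultimately have dim1: "variety_dim V (secant_variety V X (3 * k + 1)) = enat (12 * k + 2)"
    using C(2) N by simp
  then show "variety_codim V (secant_variety V X (3 * k + 1)) = 3"
    by (simp add: variety_codim_def dimV numeral_eq_enat)
  obtain C' where C': "C' \<subseteq> prism (lattice_triangle d) (Suc e)" "card C' = 12 * k + 5" "separable TYPE('k) (3 * k + 2) C'"
    using separable_degree_2_even(2)[OF k, where 'k='k] de pe by auto
  have "enat (card C' - 1) \<le> variety_dim V (secant_variety V X (3 * k + 2))"
    unfolding assms(3,4) using C' by (intro secant_dim_lower assms(1)) auto
  moreover have "variety_dim V (secant_variety V X (3 * k + 2)) \<le> enat (card (bimonomials d e) - 2)"
    unfolding variety_dim_def assms(3)
    by (rule krull_dim_le_one_annihilator[OF dense[unfolded assms(3)] finite_triangle_prism finite_triangle_prism _ _ A]) (use cP N in auto)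
  ultimately have dim2: "variety_dim V (secant_variety V X (3 * k + 2)) = enat (12 * k + 4)"
    using C'(2) N by simp
  then show "variety_codim V (secant_variety V X (3 * k + 2)) = 1"
    by (simp add: variety_codim_def dimV one_enat_def)
  show "expected_secant_codim V X (3 * k + 1) = 2" "expected_secant_codim V X (3 * k + 2) = 0"
    unfolding expected_secant_codim_def dimV unfolding assms(3,4) expected_secant_dim_SV[OF assms(1,2)] N
    by (simp_all add: numeral_eq_enat zero_enat_def)
next
  assume de: "d = 3 \<and> e = 1"
  have N: "card (bimonomials d e) = 20" using de by (simp add: card_bimonomials card_triangle_prism numeral_eq_Suc)
  have dimV: "pm.dim V = 20" by (simp add: assms(3) dim_SV_space N)
  have dense: "secant_dense d e l (secant_variety V X l)" for l
    unfolding assms(3,4) by (rule secant_dense_secant_variety[OF assms(1)])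
  (* Bidegrees \<open>(2, 0)\<close> and \<open>(1, 1)\<close>, with 6 coefficients each, enough for passing through 5 points. *)
  let ?P = "prism (lattice_triangle 2) 1" and ?Q = "prism (lattice_triangle 1) 2"
  have cP: "card ?P = 6" "card ?Q = 6" by (simp_all add: card_triangle_prism numeral_eq_Suc)
  have A: "translate \<beta> \<gamma> \<in> prism (lattice_triangle d) (Suc e)" if "\<beta> \<in> ?P" "\<gamma> \<in> ?Q" for \<beta> \<gamma>
    using that de by (auto simp: prism_def lattice_triangle_def)
  have pe: "Suc e = 2" using de by simp
  have prism: "prism (lattice_triangle d) (Suc e) = prism (lattice_triangle 3) 2" unfolding pe using de by simp
  obtain C where C: "C \<subseteq> prism (lattice_triangle d) (Suc e)" "card C = 19" "separable TYPE('k) 5 C"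
    using separable_degree_3_1[where 'k='k] unfolding prism by blast
  have "enat (card C - 1) \<le> variety_dim V (secant_variety V X 5)"
    unfolding assms(3,4) using C by (intro secant_dim_lower assms(1)) auto
  moreover have "variety_dim V (secant_variety V X 5) \<le> enat (card (bimonomials d e) - 2)"
    unfolding variety_dim_def assms(3)
    by (rule krull_dim_le_one_annihilator[OF dense[unfolded assms(3)] finite_triangle_prism finite_triangle_prism _ _ A]) (use cP N in auto)
  ultimately have "variety_dim V (secant_variety V X 5) = enat 18" using C(2) N by simp
  then show "variety_codim V (secant_variety V X 5) = 1"
    by (simp add: variety_codim_def dimV one_enat_def)
  show "expected_secant_codim V X 5 = 0"
    unfolding expected_secant_codim_def dimV unfolding assms(3,4) expected_secant_dim_SV[OF assms(1,2)] N
    by (simp add: zero_enat_def)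
qed

end
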